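(* Let $P\in\mathcal{M}_7$. Then $$S(P)\le \frac{5}{4}\sqrt{50-6\sqrt{5}}=7.560546\ldots$$ with equality if and only if $P$ is a pentagonal bipyramid with two vertices at the poles $\pm e_3$ and the other five forming an equilateral pentagon in the equator $\mathbb{S}^2\cap(\operatorname{span}(e_3))^{\perp}$.
   Context: $\mathbb{S}^2=\{(x,y,z)\in\mathbb{R}^3: x^2+y^2+z^2=1\}$ is the unit sphere and $e_3=(0,0,1)$. For an integer $K\ge 4$, $\mathcal{I}_K$ denotes the set of all convex polytopes with at most $K$ distinct vertices chosen from $\mathbb{S}^2$, and $\mathcal{M}_K$ denotes the corresponding subset of polytopes with congruent isosceles or congruent equilateral triangular facets. $S(P)$ denotes the surface area of $P$.
   Formalization: The equality case is read up to an orthogonal transformation of space: equality holds iff some rotation or reflection maps P onto a pentagonal bipyramid with apexes ±e_3 and an equilateral equatorial pentagon, since rotated copies also attain the bound. *)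

theory Defs
  imports "HOL-Analysis.Analysis"
begin

definition e3 :: "real^3" where
  "e3 = axis 3 1"

definition inscribed_polytopes :: "nat \<Rightarrow> (real^3) set set" where
  "inscribed_polytopes K =
     {P. polytope P \<and> {v. v extreme_point_of P} \<subseteq> sphere 0 1 \<and> card {v. v extreme_point_of P} \<le> K}"

definition congruent_sets :: "(real^3) set \<Rightarrow> (real^3) set \<Rightarrow> bool" where
  "congruent_sets A B \<longleftrightarrow> (\<exists>f. (\<forall>x y. dist (f x) (f y) = dist x y) \<and> f ` A = B)"

definition isosceles_triangle :: "(real^3) set \<Rightarrow> bool" where
  "isosceles_triangle T \<longleftrightarrow>
     (\<exists>a b c. \<not> collinear {a, b, c} \<and> T = convex hull {a, b, c} \<and> dist a b = dist a c)"

definition equilateral_triangle :: "(real^3) set \<Rightarrow> bool" where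
  "equilateral_triangle T \<longleftrightarrow>
     (\<exists>a b c. \<not> collinear {a, b, c} \<and> T = convex hull {a, b, c} \<and>
        dist a b = dist a c \<and> dist a b = dist b c)"

text \<open>A polytope with triangular facets is three-dimensional; the dimension is stated explicitly
  because the empty set and single points have no facets at all and would qualify vacuously.\<close>

definition isosceles_polytopes :: "nat \<Rightarrow> (real^3) set set" where
  "isosceles_polytopes K =
     {P \<in> inscribed_polytopes K.
        aff_dim P = 3 \<and>
        ((\<forall>F. F facet_of P \<longrightarrow> isosceles_triangle F) \<or>
         (\<forall>F. F facet_of P \<longrightarrow> equilateral_triangle F)) \<and>
        (\<forall>F G. F facet_of P \<longrightarrow> G facet_of P \<longrightarrow> congruent_sets F G)}"

text \<open>Two-dimensional Lebesgue measure of a set lying in a plane of \<open>real^3\<close>, read off in any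
  isometric parametrisation of such a plane. The value does not depend on the parametrisation,
  since isometries of \<open>real^2\<close> preserve Lebesgue measure.\<close>

definition planar_area :: "(real^3) set \<Rightarrow> real" where
  "planar_area F =
     (THE A. \<exists>f :: real^2 \<Rightarrow> real^3. (\<forall>x y. dist (f x) (f y) = dist x y) \<and>
        F \<subseteq> range f \<and> A = measure lebesgue (f -` F))"

text \<open>Meant for three-dimensional polytopes, whose facets are two-dimensional.\<close>

definition surface_area :: "(real^3) set \<Rightarrow> real" where
  "surface_area P = (\<Sum>F | F facet_of P. planar_area F)"

text \<open>The cyclic list \<open>p 0, \<dots>, p 4\<close> gives the pentagon's sides. For five distinct points
  on a circle, equal sides force the points to be equally spaced, so a self-intersecting (star)
  order has the same vertex set as the convex one.\<close>

definition equilateral_pentagon :: "(real^3) set \<Rightarrow> bool" where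
  "equilateral_pentagon V \<longleftrightarrow>
     (\<exists>p :: nat \<Rightarrow> real^3. inj_on p {..<5} \<and> V = p ` {..<5} \<and>
        (\<exists>l. \<forall>i<5. dist (p i) (p ((i + 1) mod 5)) = l))"

definition equator :: "(real^3) set" where
  "equator = sphere 0 1 \<inter> orthogonal_comp (span {e3})"

definition equatorial_pentagonal_bipyramid :: "(real^3) set \<Rightarrow> bool" where
  "equatorial_pentagonal_bipyramid P \<longleftrightarrow>
     (\<exists>V. V \<subseteq> equator \<and> equilateral_pentagon V \<and> P = convex hull ({e3, - e3} \<union> V))"

end

theory Submission
  imports Defs
begin

text \<open>All facets are congruent, so they have the same distance d from the origin. A facet and its
  neighbour across a leg see the acute angle opposite to that leg, which forces both to have the
  origin on their inner side; hence the origin is interior, the ball of radius d touches every facet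
  at its circumcentre, and the facets are not obtuse. Central projection gives a tiling of the sphere
  by F = 2V - 4 congruent isosceles triangles with apex angle \<open>\<alpha>\<close> and base angle \<open>\<beta>\<close>, and summing the
  angles at all vertices gives \<open>\<alpha> + 2\<beta> = 2\<pi>V / F\<close>. This leaves a one-parameter family of facets, whose
  area is a rational function of \<open>tan (\<alpha> / 2)\<close>. For V = 7 some vertex has degree at least 5, so one of
  the angles is at most 72 degrees; under this restriction the area is largest for \<open>\<alpha> = 2\<pi>/5\<close>,
  \<open>\<beta> = \<pi>/2\<close>. With fewer vertices the bound is far from being attained.\<close>

section \<open>The area of a triangle in space\<close>

text \<open>Congruence fixes only the square of the signed distance from the origin to a facet
  plane; its sign comes from the barycentric coordinates of the circumcentre. The coordinate of a
  base vertex is always positive, that of the apex only for a non-obtuse facet. The degree argument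
  is indispensable: at an apex angle of 72 degrees the squared area minus its bound changes sign, so
  slightly beyond that value the bound fails. Small apex angles and small base angles are two
  separate intervals of the parameter, and acuteness closes the second one from above. The 72
  degrees are 360/5: ten facets have 30 corners, more than four for each of seven vertices. No
  topology of the sphere enters. The angle sum at a vertex is obtained by measuring arcs of
  directions, the facet count by sweeping with a linear functional. In the equality case the inner
  products of all sides are known, and each neighbouring facet is then determined by the one before
  it; walking around a pole reconstructs the solid. Area is invariant under orthogonal maps, so the
  extremal solid is determined only up to such a map.\<close>

definition tri_area :: "real^3 \<Rightarrow> real^3 \<Rightarrow> real^3 \<Rightarrow> real" where
  "tri_area a b c = sqrt ((dist a b)\<^sup>2 * (dist a c)\<^sup>2 - (((dist a b)\<^sup>2 + (dist a c)\<^sup>2 - (dist b c)\<^sup>2) / 2)\<^sup>2) / 2"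

text \<open>Polarisation. Working with differences from a base point \<open>z\<close> avoids any
  assumption of linearity on \<open>f\<close>.\<close>

lemma isometry_inner:
  fixes f :: "'a::real_inner \<Rightarrow> 'b::real_inner"
  assumes "\<And>x y. dist (f x) (f y) = dist x y"
  shows "(f x - f z) \<bullet> (f y - f z) = (x - z) \<bullet> (y - z)"
proof -
  have eq: "u \<bullet> v = ((norm u)\<^sup>2 + (norm v)\<^sup>2 - (norm (u - v))\<^sup>2) / 2" for u v :: "'c::real_inner"
    by (simp add: power2_norm_eq_inner inner_diff_left inner_diff_right inner_commute)
  have "norm (f p - f q) = norm (p - q)" for p q
    using assms by (simp add: dist_norm)
  then show ?thesis
    unfolding eq[of "f x - f z"] eq[of "x - z"] by simp
qed

lemma isometry_affine:
  fixes f :: "'a::real_inner \<Rightarrow> 'b::real_inner"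
  assumes "\<And>x y. dist (f x) (f y) = dist x y"
  shows "f (u *\<^sub>R x + v *\<^sub>R y + (1 - u - v) *\<^sub>R z) = u *\<^sub>R f x + v *\<^sub>R f y + (1 - u - v) *\<^sub>R f z"
proof -
  note I = isometry_inner[of f, OF assms]
  define p where "p = u *\<^sub>R x + v *\<^sub>R y + (1 - u - v) *\<^sub>R z"
  define w where "w = (f p - f z) - u *\<^sub>R (f x - f z) - v *\<^sub>R (f y - f z)"
  have p: "p - z = u *\<^sub>R (x - z) + v *\<^sub>R (y - z)"
    by (simp add: p_def algebra_simps)
  define P X Y where "P = f p - f z" and "X = f x - f z" and "Y = f y - f z"
  have J: "P \<bullet> P = (p - z) \<bullet> (p - z)" "P \<bullet> X = (p - z) \<bullet> (x - z)" "P \<bullet> Y = (p - z) \<bullet> (y - z)"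
    "X \<bullet> X = (x - z) \<bullet> (x - z)" "X \<bullet> Y = (x - z) \<bullet> (y - z)" "Y \<bullet> Y = (y - z) \<bullet> (y - z)"
    unfolding P_def X_def Y_def I by simp_all
  have "w = P - u *\<^sub>R X - v *\<^sub>R Y" by (simp add: w_def P_def X_def Y_def)
  then have "w \<bullet> w = P \<bullet> P - 2 * u * (P \<bullet> X) - 2 * v * (P \<bullet> Y) + u\<^sup>2 * (X \<bullet> X) + 2 * u * v * (X \<bullet> Y) + v\<^sup>2 * (Y \<bullet> Y)"
    by (simp only: inner_diff_left inner_diff_right) (simp add: inner_commute power2_eq_square algebra_simps)
  also have "\<dots> = 0"
    unfolding J p inner_add_left inner_add_right inner_scaleR_left inner_scaleR_right
      inner_commute[of "y - z" "x - z"]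
    by (simp add: power2_eq_square algebra_simps)
  finally have "w \<bullet> w = 0" .
  then have "w = 0" by simp
  then show ?thesis
    unfolding w_def p_def[symmetric] by (simp add: algebra_simps)
qed

lemma convex_hull_3_coords:
  "convex hull {a, b, c} = {u *\<^sub>R b + v *\<^sub>R c + (1 - u - v) *\<^sub>R a | u v. 0 \<le> u \<and> 0 \<le> v \<and> u + v \<le> 1}"
  unfolding convex_hull_3_alt
  by (force simp: algebra_simps)

lemma isometry_image_triangle:
  fixes f :: "'a::real_inner \<Rightarrow> 'b::real_inner"
  assumes "\<And>x y. dist (f x) (f y) = dist x y"
  shows "f ` (convex hull {a, b, c}) = convex hull {f a, f b, f c}"
proof -
  have "f ` (convex hull {a, b, c}) = {f (u *\<^sub>R b + v *\<^sub>R c + (1 - u - v) *\<^sub>R a) | u v. 0 \<le> u \<and> 0 \<le> v \<and> u + v \<le> 1}"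
    unfolding convex_hull_3_coords by blast
  then show ?thesis
    unfolding isometry_affine[of f, OF assms] convex_hull_3_coords .
qed

lemma isometry_inj:
  assumes "\<And>x y. dist (f x) (f y) = dist x y"
  shows "inj f"
  by (metis assms dist_eq_0_iff injI)

text \<open>The radicand is the Gram determinant of the two edge vectors at \<open>A\<close>, with
  their inner product taken from the law of cosines. In the plane it is the square of the
  determinant in the coordinate formula, but in side lengths it is invariant under isometric
  charts.\<close>

lemma measure_triangle_dist:
  fixes A B C :: "real^2"
  shows "measure lebesgue (convex hull {A, B, C}) =
    sqrt ((dist A B)\<^sup>2 * (dist A C)\<^sup>2 - (((dist A B)\<^sup>2 + (dist A C)\<^sup>2 - (dist B C)\<^sup>2) / 2)\<^sup>2) / 2"
proof -
  have [simp]: "(UNIV :: 2 set) = {1, 2}"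
    using exhaust_2 by auto
  have dist_eq: "(dist (A :: real ^ 2) B) ^ 2 = (A $ 1 - B $ 1) ^ 2 + (A $ 2 - B $ 2) ^ 2" for A B
    by (subst dist_vec_def, subst L2_set_def) (simp add: sum_nonneg dist_norm)
  have c: "measure lebesgue (convex hull {A, B, C}) = Henstock_Kurzweil_Integration.content (convex hull {A, B, C})"
    by (simp add: measure_completion borel_compact compact_convex_hull finite_imp_compact)
  have "(dist A B)\<^sup>2 * (dist A C)\<^sup>2 - (((dist A B)\<^sup>2 + (dist A C)\<^sup>2 - (dist B C)\<^sup>2) / 2)\<^sup>2 =
    ((C $ 1 - A $ 1) * (B $ 2 - A $ 2) - (B $ 1 - A $ 1) * (C $ 2 - A $ 2))\<^sup>2"
    unfolding dist_eq by (simp add: field_simps) (simp add: power2_eq_square algebra_simps)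
  then show ?thesis
    unfolding c content_triangle by simp
qed

lemma triangle_isometric_plane:
  fixes a b c :: "real^3"
  assumes "\<not> collinear {a, b, c}"
  obtains f :: "real^2 \<Rightarrow> real^3" and A B C where "\<And>x y. dist (f x) (f y) = dist x y" "f A = a" "f B = b" "f C = c"
proof -
  define p where "p = b - a"
  define q where "q = c - a"
  have p0: "p \<noteq> 0" using assms by (auto simp: p_def)
  define e where "e = p /\<^sub>R norm p"
  have ee: "e \<bullet> e = 1" using p0 by (simp add: e_def dot_square_norm power2_eq_square field_simps)
  define r where "r = q - (q \<bullet> e) *\<^sub>R e"
  have r0: "r \<noteq> 0"
  proof
    assume "r = 0"
    then have "q = ((q \<bullet> e) / norm p) *\<^sub>R p" by (simp add: r_def e_def divide_inverse)
    then have "collinear {0, b - a, c - a}" unfolding p_def q_def collinear_lemma by blast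
    then have "collinear {b, a, c}" by (subst collinear_3) simp_all
    then have "collinear {a, b, c}" by (simp add: insert_commute)
    with assms show False by simp
  qed
  define g where "g = r /\<^sub>R norm r"
  have gg: "g \<bullet> g = 1" using r0 by (simp add: g_def dot_square_norm power2_eq_square field_simps)
  have eg: "e \<bullet> g = 0" by (simp add: g_def r_def inner_diff_right ee inner_commute)
  define f :: "real^2 \<Rightarrow> real^3" where "f = (\<lambda>x. a + (x$1) *\<^sub>R e + (x$2) *\<^sub>R g)"
  have "dist (f x) (f y) = dist x y" for x y
  proof -
    have "f x - f y = (x$1 - y$1) *\<^sub>R e + (x$2 - y$2) *\<^sub>R g"
      by (simp add: f_def algebra_simps)
    then have "(f x - f y) \<bullet> (f x - f y) = (x$1 - y$1)\<^sup>2 + (x$2 - y$2)\<^sup>2"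
      by (simp add: inner_add_left inner_add_right ee gg eg inner_commute power2_eq_square)
    also have "\<dots> = (x - y) \<bullet> (x - y)"
      by (simp add: inner_vec_def sum_2 power2_eq_square)
    finally show ?thesis by (simp add: dist_norm norm_eq)
  qed
  moreover have "f 0 = a" by (simp add: f_def)
  moreover have "f (vector [norm p, 0]) = b" using p0 by (simp add: f_def e_def p_def)
  moreover have "f (vector [q \<bullet> e, norm r]) = c" using r0 by (simp add: f_def g_def r_def q_def)
  ultimately show ?thesis using that by blast
qed

text \<open>\<open>THE\<close> demands existence and uniqueness. Existence is the Gram-Schmidt chart
  of \<open>triangle_isometric_plane\<close>; uniqueness holds because every isometric chart pulls
  the triangle back to a plane triangle with the same side lengths, and the area formula depends on
  nothing else.\<close>

lemma planar_area_triangle: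
  assumes "\<not> collinear {a, b, c}"
  shows "planar_area (convex hull {a, b, c}) = tri_area a b c"
proof -
  let ?T = "convex hull {a, b, c}"
  have area: "measure lebesgue (f -` ?T) = tri_area a b c"
    if f: "\<forall>x y. dist (f x) (f y) = dist x y" and r: "?T \<subseteq> range f" for f :: "real^2 \<Rightarrow> real^3"
  proof -
    have "{a, b, c} \<subseteq> range f" using r hull_subset[of "{a, b, c}" convex] by blast
    then obtain A B C where ABC: "a = f A" "b = f B" "c = f C" by auto
    have i: "inj f" using isometry_inj[of f] f by blast
    have "?T = f ` (convex hull {A, B, C})"
      unfolding ABC using isometry_image_triangle[of f A B C] f by simp
    then have "f -` ?T = convex hull {A, B, C}"
      using i by (simp add: inj_vimage_image_eq)
    then show ?thesis
      using f by (simp add: measure_triangle_dist tri_area_def ABC)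
  qed
  obtain f :: "real^2 \<Rightarrow> real^3" and A B C
    where f: "\<And>x y. dist (f x) (f y) = dist x y" "f A = a" "f B = b" "f C = c"
    using triangle_isometric_plane[OF assms] by metis
  have "?T \<subseteq> range f"
    unfolding isometry_image_triangle[of f A B C, OF f(1), unfolded f(2-4), symmetric] by (rule image_mono) simp
  with f(1) area[of f]
  have ex: "\<exists>f::real^2 \<Rightarrow> real^3. (\<forall>x y. dist (f x) (f y) = dist x y) \<and> ?T \<subseteq> range f \<and> tri_area a b c = measure lebesgue (f -` ?T)"
    by metis
  show ?thesis
    unfolding planar_area_def by (rule the_equality) (use ex area in auto)
qed

section \<open>Arcs and planar cones\<close>

lemma cos_ge_imp:
  assumes "0 \<le> x" "x \<le> 2 * pi" "0 \<le> h" "h \<le> pi" "cos x \<ge> cos h"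
  shows "x \<le> h \<or> x \<ge> 2 * pi - h"
proof (cases "x \<le> pi")
  case True
  then show ?thesis using assms cos_mono_le_eq[of h x] by auto
next
  case False
  have "cos (2 * pi - x) = cos x" by (simp add: cos_diff)
  then show ?thesis using assms False cos_mono_le_eq[of h "2 * pi - x"] by auto
qed

lemma cos_gt_of_near:
  assumes "0 \<le> h" "h \<le> pi" "\<bar>x\<bar> < h"
  shows "cos x > cos h"
  using assms cos_monotone_0_pi[of "\<bar>x\<bar>" h] by simp

text \<open>Closed arcs will cover the circle and open arcs will be disjoint in it, hence an upper
  estimate for the former and a lower one for the latter.\<close>

lemma measure_closed_arc:
  assumes "0 \<le> h" "h \<le> pi / 2" "0 \<le> \<mu>" "\<mu> < 2 * pi"
  shows "measure lebesgue ({0..2*pi} \<inter> {\<psi>. cos (\<psi> - \<mu>) \<ge> cos h}) \<le> 2 * h" (is "measure _ ?S \<le> _")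
proof -
  \<comment> \<open>An arc crossing 0 or 2 \<pi> falls apart into two intervals; half-width at most
    \<pi>/2 excludes crossing both ends.\<close>
  define C where "C = (if \<mu> \<le> h then {0..\<mu>+h} \<union> {\<mu> - h + 2*pi..2*pi}
    else if \<mu> + h < 2 * pi then {\<mu>-h..\<mu>+h} else {\<mu>-h..2*pi} \<union> {0..\<mu>+h-2*pi})"
  have "?S \<subseteq> C"
  proof
    fix \<psi> assume \<psi>: "\<psi> \<in> ?S"
    have "cos \<bar>\<psi> - \<mu>\<bar> \<ge> cos h" using \<psi> by simp
    then have "\<bar>\<psi> - \<mu>\<bar> \<le> h \<or> \<bar>\<psi> - \<mu>\<bar> \<ge> 2 * pi - h"
      using \<psi> assms by (intro cos_ge_imp) auto
    then show "\<psi> \<in> C" using \<psi> assms pi_gt_zero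
      unfolding C_def by (auto simp: abs_if split: if_splits)
  qed
  moreover have "C \<in> lmeasurable" unfolding C_def by auto
  moreover have "closed {\<psi>. cos (\<psi> - \<mu>) \<ge> cos h}"
    by (intro closed_Collect_le continuous_intros)
  then have "?S \<in> sets lebesgue"
    by (intro sets.Int) (auto intro: borel_closed)
  ultimately have "measure lebesgue ?S \<le> measure lebesgue C"
    by (intro measure_mono_fmeasurable) auto
  also have "\<dots> \<le> 2 * h"
  proof -
    have "measure lebesgue ({a..b} \<union> {c..d}) \<le> (b - a) + (d - c)" if "a \<le> b" "c \<le> d" for a b c d :: real
      using measure_Un_le[of "{a..b}" lebesgue "{c..d}"] that by simp
    from this[of 0 "\<mu>+h" "\<mu> - h + 2*pi" "2*pi"] this[of "\<mu>-h" "2*pi" 0 "\<mu>+h-2*pi"]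
    show ?thesis using assms unfolding C_def by auto
  qed
  finally show ?thesis .
qed

lemma measure_open_arc:
  assumes "0 < h" "h \<le> pi / 2" "0 \<le> \<mu>" "\<mu> < 2 * pi"
  shows "measure lebesgue ({0..2*pi} \<inter> {\<psi>. cos (\<psi> - \<mu>) > cos h}) \<ge> 2 * h" (is "measure _ ?S \<ge> _")
proof -
  define C where "C = (if \<mu> < h then {0..<\<mu>+h} \<union> {\<mu> - h + 2*pi<..2*pi}
    else if \<mu> + h \<le> 2 * pi then {\<mu>-h<..<\<mu>+h} else {\<mu>-h<..2*pi} \<union> {0..<\<mu>+h-2*pi})"
  have "C \<subseteq> ?S"
  proof
    fix \<psi> assume \<psi>: "\<psi> \<in> C"
    consider "\<bar>\<psi> - \<mu>\<bar> < h" | "\<bar>\<psi> - \<mu> - 2 * pi\<bar> < h" | "\<bar>\<psi> - \<mu> + 2 * pi\<bar> < h"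
      using \<psi> assms unfolding C_def by (auto simp: abs_if split: if_splits)
    then have "cos (\<psi> - \<mu>) > cos h"
    proof cases
      case 1
      then show ?thesis using assms by (intro cos_gt_of_near) auto
    next
      case 2
      then have "cos (\<psi> - \<mu> - 2 * pi) > cos h" using assms by (intro cos_gt_of_near) auto
      then show ?thesis using cos_periodic[of "\<psi> - \<mu> - 2 * pi"] by simp
    next
      case 3
      then have "cos (\<psi> - \<mu> + 2 * pi) > cos h" using assms by (intro cos_gt_of_near) auto
      then show ?thesis using cos_periodic[of "\<psi> - \<mu>"] by simp
    qed
    then show "\<psi> \<in> ?S" using \<psi> assms unfolding C_def by (auto split: if_splits)
  qed
  moreover have "C \<in> sets lebesgue" unfolding C_def by auto
  moreover have "open {\<psi>. cos (\<psi> - \<mu>) > cos h}"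
    by (intro open_Collect_less continuous_intros)
  then have "?S \<in> lmeasurable"
    by (intro fmeasurable_Int_fmeasurable) (auto intro: borel_open)
  ultimately have "measure lebesgue C \<le> measure lebesgue ?S"
    by (intro measure_mono_fmeasurable) auto
  moreover have "measure lebesgue C = 2 * h"
  proof -
    have 1: "measure lebesgue ({a..<b} \<union> {c<..d}) = (b - a) + (d - c)" if "a \<le> b" "c \<le> d" "b \<le> c" for a b c d :: real
      using that by (subst measure_Union) auto
    have 2: "measure lebesgue ({c<..d} \<union> {a..<b}) = (b - a) + (d - c)" if "a \<le> b" "c \<le> d" "b \<le> c" for a b c d :: real
      using 1[OF that] by (simp add: Un_commute)
    from 1[of 0 "\<mu>+h" "\<mu> - h + 2*pi" "2*pi"] 2[of 0 "\<mu>+h-2*pi" "\<mu>-h" "2*pi"]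
    show ?thesis using assms unfolding C_def by auto
  qed
  ultimately show ?thesis by simp
qed

section \<open>Spherical angles and the arcs of directions in planar cones\<close>

definition perp :: "'a::real_inner \<Rightarrow> 'a \<Rightarrow> 'a" where
  "perp v x = x - (x \<bullet> v) *\<^sub>R v"

text \<open>For unit \<open>v\<close>, the angle at \<open>v\<close> of the spherical triangle,
  equal to the dihedral angle along the axis through 0 and \<open>v\<close>; it is not the angle of
  the flat facet.\<close>

definition sang :: "'a::real_inner \<Rightarrow> 'a \<Rightarrow> 'a \<Rightarrow> real" where
  "sang v x y = arccos (perp v x \<bullet> perp v y / (norm (perp v x) * norm (perp v y)))"

lemma sang_commute: "sang v x y = sang v y x"
  by (simp add: sang_def inner_commute mult.commute)

lemma orthonormal_frame_3:
  fixes v e :: "real^3"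
  assumes v: "v \<bullet> v = 1" and e: "e \<bullet> e = 1" and ev: "e \<bullet> v = 0"
  defines "f \<equiv> cross3 v e"
  shows "f \<bullet> f = 1" "e \<bullet> f = 0" "f \<bullet> v = 0"
    "x \<bullet> v = 0 \<Longrightarrow> x = (x \<bullet> e) *\<^sub>R e + (x \<bullet> f) *\<^sub>R f"
proof -
  show ef: "e \<bullet> f = 0" and fv: "f \<bullet> v = 0" by (simp_all add: f_def dot_cross_self)
  have "(norm f)\<^sup>2 + (v \<bullet> e)\<^sup>2 = (norm v * norm e)\<^sup>2"
    unfolding f_def by (rule norm_cross_dot)
  then show ff: "f \<bullet> f = 1"
    using e ev v by (simp add: dot_square_norm inner_commute power_mult_distrib)
  assume x: "x \<bullet> v = 0"
  define r where "r = x - (x \<bullet> e) *\<^sub>R e - (x \<bullet> f) *\<^sub>R f"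
  have r: "r \<bullet> v = 0" "r \<bullet> e = 0" "r \<bullet> f = 0"
    using x e ff fv ev ef by (simp_all add: r_def inner_diff_left inner_commute[of f e])
  have "cross3 r f = (r \<bullet> e) *\<^sub>R v - (r \<bullet> v) *\<^sub>R e"
    unfolding f_def by (rule Lagrange)
  then have "cross3 r f = 0" using r by simp
  with r(3) have "r = 0 \<or> f = 0" using norm_and_cross_eq_0[of r f] by blast
  with ff have "r = 0" by auto
  then show "x = (x \<bullet> e) *\<^sub>R e + (x \<bullet> f) *\<^sub>R f" by (simp add: r_def algebra_simps)
qed

lemma orthonormal_complement_3:
  fixes v :: "real^3"
  assumes "norm v = 1"
  obtains e f where "e \<bullet> e = 1" "f \<bullet> f = 1" "e \<bullet> f = 0" "e \<bullet> v = 0" "f \<bullet> v = 0"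
    "\<And>x. x \<bullet> v = 0 \<Longrightarrow> x = (x \<bullet> e) *\<^sub>R e + (x \<bullet> f) *\<^sub>R f"
proof -
  have vv: "v \<bullet> v = 1" using assms by (simp add: norm_eq_1)
  obtain e0 :: "real^3" where e0: "e0 \<noteq> 0" "orthogonal v e0"
    by (rule orthogonal_to_vector_exists[of v]) simp_all
  define e where "e = e0 /\<^sub>R norm e0"
  have e: "e \<bullet> e = 1" "e \<bullet> v = 0"
    using e0 by (simp_all add: e_def dot_square_norm power2_eq_square orthogonal_def inner_commute)
  note frame = orthonormal_frame_3[OF vv e]
  show ?thesis by (rule that[OF e(1) frame(1,2) e(2) frame(3,4)])
qed

text \<open>The arc is centred at the bisector of the unit vectors \<open>U\<close> and
  \<open>W\<close> along \<open>X\<close> and \<open>Y\<close>. For a unit vector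
  \<open>a U + b W\<close>, lying in the arc means \<open>a + b \<ge> 1\<close>, while unit length
  says \<open>(a + b)\<^sup>2 = 1 + 2 a b (1 - k)\<close> with \<open>k\<close> the cosine of the
  full angle. So the arc condition is a sign condition on \<open>a b\<close>.\<close>

lemma planar_cone_arc:
  fixes X Y e f :: "'a::real_inner"
  assumes e: "e \<bullet> e = 1" "f \<bullet> f = 1" "e \<bullet> f = 0"
    and X: "X = x1 *\<^sub>R e + x2 *\<^sub>R f" and Y: "Y = y1 *\<^sub>R e + y2 *\<^sub>R f"
    and nd: "x1 * y2 - x2 * y1 \<noteq> 0"
  obtains h \<mu> where "0 < h" "h \<le> pi / 2" "0 \<le> \<mu>" "\<mu> < 2 * pi"
    "2 * h = arccos (X \<bullet> Y / (norm X * norm Y))"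
    "\<And>\<psi> a b. 0 \<le> a \<Longrightarrow> 0 \<le> b \<Longrightarrow> cos \<psi> *\<^sub>R e + sin \<psi> *\<^sub>R f = a *\<^sub>R X + b *\<^sub>R Y \<Longrightarrow> cos h \<le> cos (\<psi> - \<mu>)"
    "\<And>\<psi>. cos h < cos (\<psi> - \<mu>) \<Longrightarrow> \<exists>a>0. \<exists>b>0. cos \<psi> *\<^sub>R e + sin \<psi> *\<^sub>R f = a *\<^sub>R X + b *\<^sub>R Y"
proof -
  have X0: "X \<noteq> 0" and Y0: "Y \<noteq> 0"
  proof -
    have "X \<bullet> e = x1" "X \<bullet> f = x2" "Y \<bullet> e = y1" "Y \<bullet> f = y2"
      using e by (simp_all add: X Y inner_add_left inner_commute[of f e])
    with nd show "X \<noteq> 0" "Y \<noteq> 0" by auto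
  qed
  define p1 p2 q1 q2 where "p1 = x1 / norm X" and "p2 = x2 / norm X" and "q1 = y1 / norm Y" and "q2 = y2 / norm Y"
  define U W where "U = X /\<^sub>R norm X" and "W = Y /\<^sub>R norm Y"
  have U: "U = p1 *\<^sub>R e + p2 *\<^sub>R f" and W: "W = q1 *\<^sub>R e + q2 *\<^sub>R f"
    by (simp_all add: U_def W_def X Y p1_def p2_def q1_def q2_def algebra_simps divide_inverse)
  have UX: "X = norm X *\<^sub>R U" "Y = norm Y *\<^sub>R W" using X0 Y0 by (simp_all add: U_def W_def)
  have ip: "(a *\<^sub>R e + b *\<^sub>R f) \<bullet> (c *\<^sub>R e + d *\<^sub>R f) = a * c + b * d" for a b c d
    using e by (simp add: inner_add_left inner_add_right inner_commute algebra_simps)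
  have p: "p1\<^sup>2 + p2\<^sup>2 = 1"
  proof -
    have "U \<bullet> U = 1" using X0 by (simp add: U_def dot_square_norm power2_eq_square)
    then show ?thesis by (simp add: U ip power2_eq_square)
  qed
  have q: "q1\<^sup>2 + q2\<^sup>2 = 1"
  proof -
    have "W \<bullet> W = 1" using Y0 by (simp add: W_def dot_square_norm power2_eq_square)
    then show ?thesis by (simp add: W ip power2_eq_square)
  qed
  define k where "k = p1 * q1 + p2 * q2"
  define D where "D = p1 * q2 - p2 * q1"
  have kUW: "k = X \<bullet> Y / (norm X * norm Y)"
  proof -
    have "k = U \<bullet> W" by (simp add: k_def U W ip)
    then show ?thesis by (simp add: U_def W_def divide_inverse)
  qed
  have D0: "D \<noteq> 0"
    using nd X0 Y0 by (simp add: D_def p1_def p2_def q1_def q2_def field_simps)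
  have Dk: "D\<^sup>2 = 1 - k\<^sup>2"
  proof -
    have "D\<^sup>2 + k\<^sup>2 = (p1\<^sup>2 + p2\<^sup>2) * (q1\<^sup>2 + q2\<^sup>2)"
      by (simp add: D_def k_def power2_eq_square algebra_simps)
    then show ?thesis using p q by simp
  qed
  have k2: "k\<^sup>2 < 1" using D0 Dk by (smt (verit) zero_less_power2)
  then have k: "-1 < k" "k < 1" by (simp_all add: abs_square_less_1 abs_less_iff)
  define h where "h = arccos k / 2"
  have arc: "0 < arccos k" "arccos k < pi" using k arccos_lt_bounded by auto
  have ck: "cos (2 * h) = k" using k by (simp add: h_def)
  then have ch: "2 * (cos h)\<^sup>2 = 1 + k" by (simp add: cos_double_cos)
  have hb: "0 < h" "h < pi / 2" using arc by (simp_all add: h_def)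
  then have chpos: "0 < cos h" by (intro cos_gt_zero_pi) auto
  \<comment> \<open>\<open>R\<close> is the length of \<open>U + W\<close>, so that dividing by it
    gives the unit bisector with angle \<open>\<mu>\<close>.\<close>
  define R where "R = 2 * cos h"
  have Rpos: "R > 0" and R2: "R\<^sup>2 = 2 * (1 + k)" using chpos ch by (simp_all add: R_def power2_eq_square)
  have "((p1 + q1) / R)\<^sup>2 + ((p2 + q2) / R)\<^sup>2 = (p1\<^sup>2 + p2\<^sup>2 + (q1\<^sup>2 + q2\<^sup>2) + 2 * k) / R\<^sup>2"
    by (simp add: k_def power2_eq_square add_divide_distrib[symmetric] algebra_simps)
  also have "\<dots> = 1" using p q R2 Rpos k by (simp add: field_simps)
  finally obtain \<mu> where mu: "0 \<le> \<mu>" "\<mu> < 2 * pi" "(p1 + q1) / R = cos \<mu>" "(p2 + q2) / R = sin \<mu>"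
    using sincos_total_2pi by metis
  have key: "R * cos (\<psi> - \<mu>) = (a + b) * (1 + k)" and sq: "(a + b)\<^sup>2 = 1 + 2 * (a * b) * (1 - k)"
    if "cos \<psi> *\<^sub>R e + sin \<psi> *\<^sub>R f = a *\<^sub>R U + b *\<^sub>R W" for \<psi> a b
  proof -
    have "(cos \<psi> *\<^sub>R e + sin \<psi> *\<^sub>R f) \<bullet> (c *\<^sub>R e + d *\<^sub>R f) = ((a * p1 + b * q1) *\<^sub>R e + (a * p2 + b * q2) *\<^sub>R f) \<bullet> (c *\<^sub>R e + d *\<^sub>R f)" for c d
      unfolding that U W by (simp add: algebra_simps)
    then have "cos \<psi> * c + sin \<psi> * d = (a * p1 + b * q1) * c + (a * p2 + b * q2) * d" for c d
      unfolding ip .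
    from this[of 1 0] this[of 0 1] have cs: "cos \<psi> = a * p1 + b * q1" "sin \<psi> = a * p2 + b * q2" by simp_all
    have "R * cos (\<psi> - \<mu>) = cos \<psi> * (R * cos \<mu>) + sin \<psi> * (R * sin \<mu>)"
      by (simp add: cos_diff algebra_simps)
    also have "\<dots> = (a * p1 + b * q1) * (p1 + q1) + (a * p2 + b * q2) * (p2 + q2)"
      unfolding mu(3,4)[symmetric] cs using Rpos by simp
    also have "\<dots> = a * (p1\<^sup>2 + p2\<^sup>2) + b * (q1\<^sup>2 + q2\<^sup>2) + (a + b) * k"
      by (simp add: k_def power2_eq_square algebra_simps)
    finally show "R * cos (\<psi> - \<mu>) = (a + b) * (1 + k)" using p q by (simp add: algebra_simps)
    have "1 = (cos \<psi>)\<^sup>2 + (sin \<psi>)\<^sup>2" by simp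
    also have "\<dots> = a\<^sup>2 * (p1\<^sup>2 + p2\<^sup>2) + b\<^sup>2 * (q1\<^sup>2 + q2\<^sup>2) + 2 * (a * b) * k"
      unfolding cs by (simp add: k_def power2_eq_square algebra_simps)
    finally show "(a + b)\<^sup>2 = 1 + 2 * (a * b) * (1 - k)" unfolding p q by (simp add: power2_eq_square algebra_simps)
  qed
  have cmp: "cos h \<le> cos (\<psi> - \<mu>) \<longleftrightarrow> 1 \<le> a + b" "cos h < cos (\<psi> - \<mu>) \<longleftrightarrow> 1 < a + b"
    if "cos \<psi> *\<^sub>R e + sin \<psi> *\<^sub>R f = a *\<^sub>R U + b *\<^sub>R W" for \<psi> a b
  proof -
    have "R * cos h = 1 * (1 + k)" using ch by (simp add: R_def power2_eq_square)
    with key[OF that] have "R * cos h \<le> R * cos (\<psi> - \<mu>) \<longleftrightarrow> 1 * (1 + k) \<le> (a + b) * (1 + k)"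
      "R * cos h < R * cos (\<psi> - \<mu>) \<longleftrightarrow> 1 * (1 + k) < (a + b) * (1 + k)" by simp_all
    then show "cos h \<le> cos (\<psi> - \<mu>) \<longleftrightarrow> 1 \<le> a + b" "cos h < cos (\<psi> - \<mu>) \<longleftrightarrow> 1 < a + b"
      unfolding mult_le_cancel_left_pos[OF Rpos] mult_less_cancel_left_pos[OF Rpos] using k by simp_all
  qed
  show ?thesis
  proof (rule that[of h \<mu>])
    show "2 * h = arccos (X \<bullet> Y / (norm X * norm Y))" by (simp add: h_def kUW)
    fix \<psi> a b assume ab: "0 \<le> a" "0 \<le> b" and eq: "cos \<psi> *\<^sub>R e + sin \<psi> *\<^sub>R f = a *\<^sub>R X + b *\<^sub>R Y"
    define a' b' where "a' = a * norm X" and "b' = b * norm Y"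
    have eq': "cos \<psi> *\<^sub>R e + sin \<psi> *\<^sub>R f = a' *\<^sub>R U + b' *\<^sub>R W"
      unfolding eq a'_def b'_def using UX by (metis scaleR_scaleR)
    have ab': "0 \<le> a'" "0 \<le> b'" using ab by (simp_all add: a'_def b'_def)
    have "(a' + b')\<^sup>2 \<ge> 1\<^sup>2" using sq[OF eq'] ab' k by simp
    then have "1 \<le> a' + b'" using ab' by (metis abs_le_square_iff abs_of_nonneg add_nonneg_nonneg zero_le_one)
    then show "cos h \<le> cos (\<psi> - \<mu>)" using cmp(1)[OF eq'] by simp
  next
    fix \<psi> assume lt: "cos h < cos (\<psi> - \<mu>)"
    \<comment> \<open>Cramer's rule for the coordinates with respect to \<open>U\<close> and
      \<open>W\<close>.\<close>
    define a b where "a = (cos \<psi> * q2 - sin \<psi> * q1) / D" and "b = (p1 * sin \<psi> - p2 * cos \<psi>) / D"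
    have 1: "a * p1 + b * q1 = cos \<psi>" "a * p2 + b * q2 = sin \<psi>"
    proof -
      have "(cos \<psi> * q2 - sin \<psi> * q1) * p1 + (p1 * sin \<psi> - p2 * cos \<psi>) * q1 = cos \<psi> * D"
        "(cos \<psi> * q2 - sin \<psi> * q1) * p2 + (p1 * sin \<psi> - p2 * cos \<psi>) * q2 = sin \<psi> * D"
        by (simp_all add: D_def algebra_simps)
      then show "a * p1 + b * q1 = cos \<psi>" "a * p2 + b * q2 = sin \<psi>"
        using D0 by (simp_all add: a_def b_def field_simps)
    qed
    have eq: "cos \<psi> *\<^sub>R e + sin \<psi> *\<^sub>R f = a *\<^sub>R U + b *\<^sub>R W"
      unfolding 1[symmetric] U W by (simp add: algebra_simps)
    have gt: "1 < a + b" using cmp(2)[OF eq] lt by simp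
    then have "1\<^sup>2 < (a + b)\<^sup>2" by (intro power_strict_mono) auto
    then have "0 < (a * b) * (1 - k)" using sq[OF eq] by simp
    then have "0 < a * b" using k by (simp add: zero_less_mult_iff)
    then have "0 < a" "0 < b" using gt by (auto simp: zero_less_mult_iff)
    then show "\<exists>a>0. \<exists>b>0. cos \<psi> *\<^sub>R e + sin \<psi> *\<^sub>R f = a *\<^sub>R X + b *\<^sub>R Y"
      using X0 Y0 unfolding eq U_def W_def
      by (intro exI[of _ "a / norm X"] exI[of _ "b / norm Y"] conjI) (simp_all add: divide_inverse)
  qed (use hb mu in auto)
qed

section \<open>Triangulations inscribed in the sphere\<close>

text \<open>Subtracting \<open>c\<close> times the sphere equation of \<open>y\<close> from that of
  \<open>x\<close> leaves \<open>c (c - 1)\<close> times a positive number.\<close>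

lemma collinear_in_sphere:
  fixes v x y :: "'a::real_inner"
  assumes "norm v = 1" "norm x = 1" "norm y = 1" "y \<noteq> v" "x - v = c *\<^sub>R (y - v)"
  shows "x = v \<or> x = y"
proof -
  define d where "d = y - v"
  have x: "x = v + c *\<^sub>R d" and y: "y = v + d" using assms(5) by (simp_all add: d_def algebra_simps)
  have 1: "v \<bullet> v = 1" "x \<bullet> x = 1" "y \<bullet> y = 1" using assms by (simp_all add: norm_eq_1)
  have "2 * (v \<bullet> d) + d \<bullet> d = 0"
    using 1(1,3) by (simp add: y inner_add_left inner_add_right inner_commute)
  moreover have "2 * c * (v \<bullet> d) + c\<^sup>2 * (d \<bullet> d) = 0"
    using 1(1,2) by (simp add: x inner_add_left inner_add_right inner_commute power2_eq_square)
  moreover have "c * (c - 1) * (d \<bullet> d) = (2 * c * (v \<bullet> d) + c\<^sup>2 * (d \<bullet> d)) - c * (2 * (v \<bullet> d) + d \<bullet> d)"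
    by (simp add: power2_eq_square algebra_simps)
  ultimately have "c * (c - 1) * (d \<bullet> d) = 0" by simp
  moreover have "d \<noteq> 0" using assms(4) by (simp add: d_def)
  ultimately have "c = 0 \<or> c = 1" by simp
  then show ?thesis by (auto simp: x y)
qed

text \<open>The inner sum visits the two remaining vertices of a triangle in both orders, hence the factor 1/2.\<close>

definition corner :: "'a::real_inner \<Rightarrow> 'a set \<Rightarrow> real" where
  "corner v T = (\<Sum>x\<in>T - {v}. \<Sum>y\<in>T - {v, x}. sang v x y) / 2"

lemma corner_triple:
  assumes "v \<noteq> x" "v \<noteq> y" "x \<noteq> y"
  shows "corner v {v, x, y} = sang v x y"
proof -
  have "{v, x, y} - {v} = {x, y}" "{v, x, y} - {v, x} = {y}" "{v, x, y} - {v, y} = {x}"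
    using assms by auto
  then show ?thesis using assms by (simp add: corner_def sang_commute[of v y x])
qed

text \<open>The facet normals are scaled such that the plane of \<open>T\<close> is \<open>n T \<bullet> x = 1\<close>; in particular the origin
  is an interior point.\<close>

locale inscribed_triangulation =
  fixes V :: "(real^3) set" and \<T> :: "(real^3) set set" and n :: "(real^3) set \<Rightarrow> real^3"
  assumes finite_V: "finite V"
    and norm_V: "v \<in> V \<Longrightarrow> norm v = 1"
    and subset_V: "T \<in> \<T> \<Longrightarrow> T \<subseteq> V"
    and card_3: "T \<in> \<T> \<Longrightarrow> card T = 3"
    and normal_on: "T \<in> \<T> \<Longrightarrow> v \<in> T \<Longrightarrow> n T \<bullet> v = 1"
    and normal_off: "T \<in> \<T> \<Longrightarrow> v \<in> V \<Longrightarrow> v \<notin> T \<Longrightarrow> n T \<bullet> v < 1"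
    and in_hull: "(\<And>T. T \<in> \<T> \<Longrightarrow> n T \<bullet> x \<le> 1) \<Longrightarrow> x \<in> convex hull V"
begin

section \<open>The facets around a vertex\<close>

lemma finite_T: "finite \<T>"
  using finite_V subset_V by (meson PowI finite_Pow_iff finite_subset subsetI)

lemma normal_le: "T \<in> \<T> \<Longrightarrow> v \<in> V \<Longrightarrow> n T \<bullet> v \<le> 1"
  using normal_on normal_off by force

lemma norm_hull_le:
  assumes "x \<in> convex hull V" shows "norm x \<le> 1"
proof -
  have "convex hull V \<subseteq> cball 0 1"
    by (rule hull_minimal) (auto simp: norm_V)
  with assms show ?thesis by auto
qed

text \<open>In a convex representation of \<open>x\<close> the nonnegative terms
  \<open>u v * (1 - n T \<bullet> v)\<close> add up to 0, so every vertex off \<open>T\<close> has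
  weight 0.\<close>

lemma facet_point:
  assumes T: "T \<in> \<T>" and x: "x \<in> convex hull V" and eq: "n T \<bullet> x = 1"
  shows "x \<in> convex hull T"
proof -
  from x obtain u where u: "\<And>v. v \<in> V \<Longrightarrow> 0 \<le> u v" "sum u V = 1" "(\<Sum>v\<in>V. u v *\<^sub>R v) = x"
    unfolding convex_hull_finite[OF finite_V] by auto
  have "(\<Sum>v\<in>V. u v * (1 - n T \<bullet> v)) = sum u V - n T \<bullet> (\<Sum>v\<in>V. u v *\<^sub>R v)"
    by (simp add: algebra_simps sum_subtractf inner_sum_right)
  also have "\<dots> = 0" by (simp add: u eq)
  finally have s0: "(\<Sum>v\<in>V. u v * (1 - n T \<bullet> v)) = 0" .
  have "\<forall>v\<in>V. u v * (1 - n T \<bullet> v) = 0"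
    using sum_nonneg_eq_0_iff[OF finite_V, of "\<lambda>v. u v * (1 - n T \<bullet> v)"] s0 u(1) normal_le[OF T]
    by simp
  then have z: "u v = 0" if "v \<in> V - T" for v
    using that normal_off[OF T, of v] by force
  have "sum u T = sum u V" "(\<Sum>v\<in>T. u v *\<^sub>R v) = (\<Sum>v\<in>V. u v *\<^sub>R v)"
    by (intro sum.mono_neutral_left finite_V subset_V[OF T]; use z in simp)+
  then show ?thesis
    using u subset_V[OF T] finite_subset[OF subset_V[OF T] finite_V]
    by (auto simp: convex_hull_finite intro!: exI[of _ u])
qed

lemma tripleE:
  assumes "T \<in> \<T>" "v \<in> T"
  obtains x y where "T = {v, x, y}" "v \<noteq> x" "v \<noteq> y" "x \<noteq> y"
proof -
  from card_3[OF assms(1)] obtain a b c where "T = {a, b, c}" "a \<noteq> b" "a \<noteq> c" "b \<noteq> c"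
    by (auto simp: card_3_iff)
  moreover from this assms(2) have "v = a \<or> v = b \<or> v = c" by simp
  ultimately show ?thesis using that[of b c] that[of a c] that[of a b] by (auto simp: insert_commute)
qed

text \<open>Applying the normal gives \<open>a + b + c = 0\<close>, so a dependency would make the
  three points collinear, which the sphere forbids.\<close>

lemma triple_independent:
  assumes "{v, x, y} \<in> \<T>" "v \<noteq> x" "v \<noteq> y" "x \<noteq> y"
    and "a *\<^sub>R v + b *\<^sub>R x + c *\<^sub>R y = 0"
  shows "b = 0 \<and> c = 0"
proof -
  let ?T = "{v, x, y}"
  have n: "n ?T \<bullet> v = 1" "n ?T \<bullet> x = 1" "n ?T \<bullet> y = 1"
    by (auto intro: normal_on[OF assms(1)])
  have nm: "norm v = 1" "norm x = 1" "norm y = 1" using subset_V[OF assms(1)] norm_V by auto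
  have "n ?T \<bullet> (a *\<^sub>R v + b *\<^sub>R x + c *\<^sub>R y) = a + b + c"
    by (simp add: inner_add_right n)
  then have a: "a = - b - c" using assms(5) by simp
  have eq: "b *\<^sub>R (x - v) = (- c) *\<^sub>R (y - v)"
    using assms(5) unfolding a by (simp add: algebra_simps)
  have "b = 0"
  proof (rule ccontr)
    assume b: "b \<noteq> 0"
    have "x - v = (- c / b) *\<^sub>R (y - v)"
      using arg_cong[OF eq, of "\<lambda>z. (1 / b) *\<^sub>R z"] b by simp
    then have "x = v \<or> x = y" using collinear_in_sphere nm assms(3) by metis
    with assms show False by auto
  qed
  with eq assms(3) show ?thesis by auto
qed

lemma small_step:
  obtains \<delta> where "0 < \<delta>" "0 < 1 + \<delta> * M"
    "\<And>T. T \<in> \<T> \<Longrightarrow> v \<in> V \<Longrightarrow> v \<notin> T \<Longrightarrow> n T \<bullet> (v + \<delta> *\<^sub>R w) < 1 + \<delta> * M"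
proof -
  have "\<forall>\<^sub>F \<delta> in at_right 0. 0 < (\<delta>::real)" by (simp add: eventually_at_right_less)
  moreover have "((\<lambda>\<delta>. 1 + \<delta> * M) \<longlongrightarrow> 1 + 0 * M) (at_right 0)"
    by (intro tendsto_intros)
  then have "\<forall>\<^sub>F \<delta> in at_right 0. 0 < 1 + \<delta> * M"
    by (rule order_tendstoD) simp
  moreover have "\<forall>\<^sub>F \<delta> in at_right 0. \<forall>T\<in>\<T>. v \<in> V \<longrightarrow> v \<notin> T \<longrightarrow> 0 < 1 + \<delta> * M - n T \<bullet> (v + \<delta> *\<^sub>R w)"
  proof (intro eventually_ball_finite finite_T ballI)
    fix T assume T: "T \<in> \<T>"
    have "((\<lambda>\<delta>. 1 + \<delta> * M - n T \<bullet> (v + \<delta> *\<^sub>R w)) \<longlongrightarrow> 1 + 0 * M - n T \<bullet> (v + 0 *\<^sub>R w)) (at_right 0)"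
      by (intro tendsto_intros)
    then have "\<forall>\<^sub>F \<delta> in at_right 0. 0 < 1 + \<delta> * M - n T \<bullet> (v + \<delta> *\<^sub>R w)" if "v \<in> V" "v \<notin> T"
      by (rule order_tendstoD) (use normal_off[OF T] that in simp)
    then show "\<forall>\<^sub>F \<delta> in at_right 0. v \<in> V \<longrightarrow> v \<notin> T \<longrightarrow> 0 < 1 + \<delta> * M - n T \<bullet> (v + \<delta> *\<^sub>R w)"
      by (cases "v \<in> V \<and> v \<notin> T") auto
  qed
  ultimately have "\<forall>\<^sub>F \<delta> in at_right 0. 0 < \<delta> \<and> 0 < 1 + \<delta> * M \<and>
    (\<forall>T\<in>\<T>. v \<in> V \<longrightarrow> v \<notin> T \<longrightarrow> 0 < 1 + \<delta> * M - n T \<bullet> (v + \<delta> *\<^sub>R w))"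
    by eventually_elim auto
  then obtain \<delta> where "0 < \<delta> \<and> 0 < 1 + \<delta> * M \<and>
    (\<forall>T\<in>\<T>. v \<in> V \<longrightarrow> v \<notin> T \<longrightarrow> 0 < 1 + \<delta> * M - n T \<bullet> (v + \<delta> *\<^sub>R w))"
    using eventually_happens' trivial_limit_at_right_real by blast
  then show ?thesis using that[of \<delta>] by auto
qed

text \<open>The cone of the polytope at \<open>v\<close> is determined by the facets at
  \<open>v\<close>: their functionals grow at rate at most \<open>M\<close> along \<open>w\<close>,
  all others have slack at \<open>v\<close>. Dividing by \<open>1 + \<delta> M\<close> pulls the
  point back below all facet planes.\<close>

lemma step_in_hull:
  assumes "v \<in> V" "\<And>T. T \<in> \<T> \<Longrightarrow> v \<in> T \<Longrightarrow> n T \<bullet> w \<le> M"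
  obtains \<delta> where "0 < \<delta>" "0 < 1 + \<delta> * M" "(1 / (1 + \<delta> * M)) *\<^sub>R (v + \<delta> *\<^sub>R w) \<in> convex hull V"
proof -
  obtain \<delta> where d: "0 < \<delta>" "0 < 1 + \<delta> * M"
    "\<And>T. T \<in> \<T> \<Longrightarrow> v \<in> V \<Longrightarrow> v \<notin> T \<Longrightarrow> n T \<bullet> (v + \<delta> *\<^sub>R w) < 1 + \<delta> * M"
    using small_step by blast
  have "(1 / (1 + \<delta> * M)) *\<^sub>R (v + \<delta> *\<^sub>R w) \<in> convex hull V"
  proof (rule in_hull)
    fix T assume T: "T \<in> \<T>"
    have "n T \<bullet> (v + \<delta> *\<^sub>R w) \<le> 1 + \<delta> * M"
    proof (cases "v \<in> T")
      case True
      then show ?thesis using assms(2)[OF T True] normal_on[OF T True] d(1) by (simp add: inner_add_right)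
    next
      case False
      then show ?thesis using d(3)[OF T assms(1) False] by simp
    qed
    then show "n T \<bullet> ((1 / (1 + \<delta> * M)) *\<^sub>R (v + \<delta> *\<^sub>R w)) \<le> 1"
      using d(2) by (simp add: divide_simps)
  qed
  with d that show ?thesis by blast
qed

text \<open>Without a facet at \<open>v\<close> one could move outwards along \<open>v\<close>
  itself, leaving the unit ball but not the hull.\<close>

lemma star_nonempty:
  assumes "v \<in> V" obtains T where "T \<in> \<T>" "v \<in> T"
proof (rule ccontr)
  assume "\<not> thesis"
  then have "\<And>T. T \<in> \<T> \<Longrightarrow> v \<in> T \<Longrightarrow> n T \<bullet> v \<le> 0" using that by blast
  then obtain \<delta> where d: "0 < \<delta>" "(1 / (1 + \<delta> * 0)) *\<^sub>R (v + \<delta> *\<^sub>R v) \<in> convex hull V"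
    using step_in_hull[OF assms] by blast
  have "v + \<delta> *\<^sub>R v = (1 + \<delta>) *\<^sub>R v" by (simp add: algebra_simps)
  then have "norm (v + \<delta> *\<^sub>R v) = 1 + \<delta>" using d norm_V[OF assms] by simp
  then show False using norm_hull_le[OF d(2)] d(1) by simp
qed

text \<open>With the growth rate of a maximising facet as \<open>M\<close>, the rescaled point lands
  exactly on the plane of that facet, hence in the triangle, and its barycentric coordinates are the
  required coefficients.\<close>

lemma star_cone:
  assumes T: "{v, x, y} \<in> \<T>" and max: "\<And>T. T \<in> \<T> \<Longrightarrow> v \<in> T \<Longrightarrow> n T \<bullet> w \<le> n {v, x, y} \<bullet> w"
  obtains a b where "0 \<le> a" "0 \<le> b" "w - (n {v, x, y} \<bullet> w) *\<^sub>R v = a *\<^sub>R (x - v) + b *\<^sub>R (y - v)"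
proof -
  let ?T = "{v, x, y}" let ?M = "n ?T \<bullet> w"
  have v: "v \<in> V" using subset_V[OF T] by auto
  obtain \<delta> where d: "0 < \<delta>" "0 < 1 + \<delta> * ?M"
    and p: "(1 / (1 + \<delta> * ?M)) *\<^sub>R (v + \<delta> *\<^sub>R w) \<in> convex hull V" (is "?p \<in> _")
    using step_in_hull[OF v max] by blast
  have "n ?T \<bullet> ?p = 1"
    using d(2) normal_on[OF T, of v] by (simp add: inner_add_right)
  with facet_point[OF T p] have "?p \<in> convex hull {v, x, y}" by simp
  then obtain a b where ab: "0 \<le> a" "0 \<le> b" "?p = v + a *\<^sub>R (x - v) + b *\<^sub>R (y - v)"
    unfolding convex_hull_3_alt by auto
  define c where "c = 1 + \<delta> * ?M"
  have "v + \<delta> *\<^sub>R w = c *\<^sub>R ?p" using d(2) by (simp add: c_def)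
  also have "\<dots> = c *\<^sub>R v + (c * a) *\<^sub>R (x - v) + (c * b) *\<^sub>R (y - v)"
    unfolding ab(3) by (simp add: algebra_simps)
  finally have "\<delta> *\<^sub>R w - (\<delta> * ?M) *\<^sub>R v = (c * a) *\<^sub>R (x - v) + (c * b) *\<^sub>R (y - v)"
    by (simp add: c_def algebra_simps)
  from arg_cong[OF this, of "\<lambda>z. (1 / \<delta>) *\<^sub>R z"]
  have "w - ?M *\<^sub>R v = (c * a / \<delta>) *\<^sub>R (x - v) + (c * b / \<delta>) *\<^sub>R (y - v)"
    using d(1) by (simp add: scaleR_add_right scaleR_diff_right)
  then show ?thesis using that[of "c * a / \<delta>" "c * b / \<delta>"] ab d by (simp add: c_def)
qed

lemma perp_inner: "v \<in> V \<Longrightarrow> perp v x \<bullet> v = 0"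
  using norm_V[of v] by (simp add: perp_def inner_diff_left norm_eq_1)

text \<open>The facet at \<open>v\<close> whose normal is largest on \<open>w\<close> is the one
  whose projected cone contains \<open>w\<close>.\<close>

lemma cones_cover:
  assumes v: "v \<in> V" and w: "w \<bullet> v = 0"
  obtains x y a b where "{v, x, y} \<in> \<T>" "v \<noteq> x" "v \<noteq> y" "x \<noteq> y" "0 \<le> a" "0 \<le> b"
    "w = a *\<^sub>R perp v x + b *\<^sub>R perp v y"
proof -
  define S where "S = {T \<in> \<T>. v \<in> T}"
  have S: "finite S" "S \<noteq> {}" using finite_T star_nonempty[OF v] by (auto simp: S_def)
  then have "Max ((\<lambda>T. n T \<bullet> w) ` S) \<in> (\<lambda>T. n T \<bullet> w) ` S" by (intro Max_in) auto
  then obtain T where T: "T \<in> S" "n T \<bullet> w = Max ((\<lambda>T. n T \<bullet> w) ` S)" by force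
  have T_max: "n T' \<bullet> w \<le> n T \<bullet> w" if "T' \<in> S" for T'
    unfolding T(2) using S that by (intro Max_ge) auto
  have TS: "T \<in> \<T>" "v \<in> T" using T(1) by (auto simp: S_def)
  obtain x y where xy: "T = {v, x, y}" "v \<noteq> x" "v \<noteq> y" "x \<noteq> y" by (rule tripleE[OF TS])
  then obtain a b where ab: "0 \<le> a" "0 \<le> b" "w - (n {v, x, y} \<bullet> w) *\<^sub>R v = a *\<^sub>R (x - v) + b *\<^sub>R (y - v)"
    using T(1) T_max star_cone[of v x y w] by (auto simp: S_def)
  have vv: "v \<bullet> v = 1" using norm_V[OF v] by (simp add: norm_eq_1)
  have "perp v (w - (n {v, x, y} \<bullet> w) *\<^sub>R v) = w"
    using w vv by (simp add: perp_def inner_diff_left)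
  moreover have "perp v (a *\<^sub>R (x - v) + b *\<^sub>R (y - v)) = a *\<^sub>R perp v x + b *\<^sub>R perp v y"
    using vv by (simp add: perp_def inner_diff_left inner_add_left algebra_simps)
  ultimately have "w = a *\<^sub>R perp v x + b *\<^sub>R perp v y" using ab by simp
  then show ?thesis using that[of x y a b] xy T ab by (auto simp: S_def)
qed

text \<open>A common direction gives an equation between combinations of \<open>x, y\<close> and of
  \<open>x', y'\<close> modulo \<open>v\<close>. Evaluating it with both normals squeezes
  \<open>a + b\<close> between equal values, so \<open>x\<close> and \<open>y\<close> lie on the
  plane of the second facet.\<close>

lemma cones_disjoint:
  assumes T: "{v, x, y} \<in> \<T>" "card {v, x, y} = 3" and T': "{v, x', y'} \<in> \<T>"
    and pos: "0 < a" "0 < b" "0 < a'" "0 < b'"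
    and eq: "a *\<^sub>R perp v x + b *\<^sub>R perp v y = a' *\<^sub>R perp v x' + b' *\<^sub>R perp v y'"
  shows "{v, x, y} = {v, x', y'}"
proof -
  let ?T = "{v, x, y}" and ?T' = "{v, x', y'}"
  obtain c where c: "a *\<^sub>R x + b *\<^sub>R y = a' *\<^sub>R x' + b' *\<^sub>R y' + c *\<^sub>R v"
  proof
    show "a *\<^sub>R x + b *\<^sub>R y = a' *\<^sub>R x' + b' *\<^sub>R y' + (a * (x \<bullet> v) + b * (y \<bullet> v) - a' * (x' \<bullet> v) - b' * (y' \<bullet> v)) *\<^sub>R v"
      using eq by (simp add: perp_def algebra_simps)
  qed
  have sub: "x \<in> V" "y \<in> V" "x' \<in> V" "y' \<in> V" using subset_V T T' by auto
  have on: "n ?T \<bullet> v = 1" "n ?T \<bullet> x = 1" "n ?T \<bullet> y = 1" "n ?T' \<bullet> v = 1" "n ?T' \<bullet> x' = 1" "n ?T' \<bullet> y' = 1"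
    using normal_on T T' by auto
  have le: "n ?T \<bullet> x' \<le> 1" "n ?T \<bullet> y' \<le> 1" "n ?T' \<bullet> x \<le> 1" "n ?T' \<bullet> y \<le> 1"
    using normal_le T T' sub by auto
  have 1: "a + b = a' * (n ?T \<bullet> x') + b' * (n ?T \<bullet> y') + c"
    using arg_cong[OF c, of "\<lambda>z. n ?T \<bullet> z"] on by (simp add: inner_add_right)
  have 2: "a * (n ?T' \<bullet> x) + b * (n ?T' \<bullet> y) = a' + b' + c"
    using arg_cong[OF c, of "\<lambda>z. n ?T' \<bullet> z"] on by (simp add: inner_add_right)
  have l: "a' * (n ?T \<bullet> x') \<le> a' * 1" "b' * (n ?T \<bullet> y') \<le> b' * 1" "a * (n ?T' \<bullet> x) \<le> a * 1" "b * (n ?T' \<bullet> y) \<le> b * 1"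
    using le pos by (simp_all only: mult_le_cancel_left_pos)
  then have "a * (n ?T' \<bullet> x) = a" "b * (n ?T' \<bullet> y) = b" using 1 2 by linarith+
  then have "n ?T' \<bullet> x = 1" "n ?T' \<bullet> y = 1" using pos by auto
  then have "x \<in> ?T'" "y \<in> ?T'" using normal_off[OF T'(1)] sub by (metis less_irrefl)+
  then have "?T \<subseteq> ?T'" by auto
  then show ?thesis using card_3[OF T'(1)] T(2) by (metis card_subset_eq card.infinite zero_neq_numeral)
qed

lemma triple_det:
  assumes T: "{v, x, y} \<in> \<T>" "v \<noteq> x" "v \<noteq> y" "x \<noteq> y"
    and X: "perp v x = x1 *\<^sub>R e + x2 *\<^sub>R f" and Y: "perp v y = y1 *\<^sub>R e + y2 *\<^sub>R f"
  shows "x1 * y2 - x2 * y1 \<noteq> 0"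
proof
  assume 0: "x1 * y2 - x2 * y1 = 0"
  have ind: "b = 0 \<and> c = 0" if "b *\<^sub>R perp v x + c *\<^sub>R perp v y = 0" for b c
    using that triple_independent[OF T, of "- b * (x \<bullet> v) - c * (y \<bullet> v)" b c]
    by (simp add: perp_def algebra_simps)
  have "y2 *\<^sub>R perp v x + (- x2) *\<^sub>R perp v y = (x1 * y2 - x2 * y1) *\<^sub>R e"
    "y1 *\<^sub>R perp v x + (- x1) *\<^sub>R perp v y = - (x1 * y2 - x2 * y1) *\<^sub>R f"
    unfolding X Y by (simp_all add: algebra_simps)
  with 0 have "x1 = 0" "x2 = 0" using ind[of y2 "- x2"] ind[of y1 "- x1"] by auto
  then have "perp v x = 0" using X by simp
  then show False using ind[of 1 0] by simp
qed

text \<open>Parametrise the directions orthogonal to \<open>v\<close> by an angle \<open>\<psi>\<close>. The closed projected cones of the facets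
  at \<open>v\<close> cover all directions and the open ones are disjoint, and the two arcs of \<open>\<psi>\<close> belonging to a
  facet have the same measure, namely its angle at \<open>v\<close>.\<close>

theorem corner_sum:
  assumes v: "v \<in> V"
  shows "(\<Sum>T | T \<in> \<T> \<and> v \<in> T. corner v T) = 2 * pi"
proof -
  define S where "S = {T \<in> \<T>. v \<in> T}"
  have finS: "finite S" using finite_T by (simp add: S_def)
  obtain e f where ef: "e \<bullet> e = 1" "f \<bullet> f = 1" "e \<bullet> f = 0" "e \<bullet> v = 0" "f \<bullet> v = 0"
    "\<And>x. x \<bullet> v = 0 \<Longrightarrow> x = (x \<bullet> e) *\<^sub>R e + (x \<bullet> f) *\<^sub>R f"
    using orthonormal_complement_3[OF norm_V[OF v]] by metis
  define W where "W = (\<lambda>\<psi>. cos \<psi> *\<^sub>R e + sin \<psi> *\<^sub>R f)"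
  have W_eq: "cos \<psi> *\<^sub>R e + sin \<psi> *\<^sub>R f = W \<psi>" for \<psi> by (simp add: W_def)
  \<comment> \<open>The first inclusion is quantified over all labellings of the other two vertices,
    because \<open>h\<close> and \<open>\<mu>\<close> are chosen as functions of the facet as a
    set.\<close>
  define arc where "arc = (\<lambda>T h \<mu>. 0 < h \<and> h \<le> pi / 2 \<and> 0 \<le> \<mu> \<and> \<mu> < 2 * pi \<and> 2 * h = corner v T \<and>
    (\<forall>\<psi> x y a b. T = {v, x, y} \<longrightarrow> v \<noteq> x \<longrightarrow> v \<noteq> y \<longrightarrow> x \<noteq> y \<longrightarrow> 0 \<le> a \<longrightarrow> 0 \<le> b \<longrightarrow>
      W \<psi> = a *\<^sub>R perp v x + b *\<^sub>R perp v y \<longrightarrow> cos h \<le> cos (\<psi> - \<mu>)) \<and>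
    (\<forall>\<psi>. cos h < cos (\<psi> - \<mu>) \<longrightarrow> (\<exists>x y a b. T = {v, x, y} \<and> 0 < a \<and> 0 < b \<and>
      W \<psi> = a *\<^sub>R perp v x + b *\<^sub>R perp v y)))"
  have "\<exists>h \<mu>. arc T h \<mu>" if "T \<in> S" for T
  proof -
    have TS: "T \<in> \<T>" "v \<in> T" using \<open>T \<in> S\<close> by (auto simp: S_def)
    obtain x y where xy: "T = {v, x, y}" "v \<noteq> x" "v \<noteq> y" "x \<noteq> y" by (rule tripleE[OF TS])
    have T: "{v, x, y} \<in> \<T>" using \<open>T \<in> S\<close> xy by (simp add: S_def)
    note X = ef(6)[OF perp_inner[OF v, of x]] and Y = ef(6)[OF perp_inner[OF v, of y]]
    obtain h \<mu> where hm: "0 < h" "h \<le> pi / 2" "0 \<le> \<mu>" "\<mu> < 2 * pi"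
      "2 * h = sang v x y"
      "\<And>\<psi> a b. 0 \<le> a \<Longrightarrow> 0 \<le> b \<Longrightarrow> W \<psi> = a *\<^sub>R perp v x + b *\<^sub>R perp v y \<Longrightarrow> cos h \<le> cos (\<psi> - \<mu>)"
      "\<And>\<psi>. cos h < cos (\<psi> - \<mu>) \<Longrightarrow> \<exists>a>0. \<exists>b>0. W \<psi> = a *\<^sub>R perp v x + b *\<^sub>R perp v y"
      by (rule planar_cone_arc[OF ef(1-3) X Y triple_det[OF T xy(2-4) X Y], folded sang_def, unfolded W_eq])
        (rule that)
    have "cos h \<le> cos (\<psi> - \<mu>)" if "T = {v, x', y'}" "v \<noteq> x'" "v \<noteq> y'" "x' \<noteq> y'" "0 \<le> a" "0 \<le> b"
      "W \<psi> = a *\<^sub>R perp v x' + b *\<^sub>R perp v y'" for \<psi> x' y' a b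
    proof -
      have "{x', y'} = T - {v}" "{x, y} = T - {v}" using that(1-4) xy(2-4) unfolding xy(1) by auto
      then have "{x', y'} = {x, y}" by simp
      then have "(x' = x \<and> y' = y) \<or> (x' = y \<and> y' = x)" by (auto simp: doubleton_eq_iff)
      then show ?thesis using hm(6)[of a b \<psi>] hm(6)[of b a \<psi>] that(5-7) by (auto simp: add.commute)
    qed
    moreover have "\<exists>x y a b. T = {v, x, y} \<and> 0 < a \<and> 0 < b \<and> W \<psi> = a *\<^sub>R perp v x + b *\<^sub>R perp v y"
      if "cos h < cos (\<psi> - \<mu>)" for \<psi>
      using hm(7)[OF that] xy(1) by blast
    moreover have "2 * h = corner v T" unfolding xy(1) corner_triple[OF xy(2-4)] by (rule hm(5))
    ultimately have "arc T h \<mu>" unfolding arc_def using hm(1-4) by (intro conjI allI impI) assumption+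
    then show ?thesis by blast
  qed
  then obtain h \<mu> where arc: "\<And>T. T \<in> S \<Longrightarrow> arc T (h T) (\<mu> T)" by metis
  have hm: "0 < h T \<and> h T \<le> pi / 2 \<and> 0 \<le> \<mu> T \<and> \<mu> T < 2 * pi \<and> 2 * h T = corner v T" if "T \<in> S" for T
    using arc[OF that] unfolding arc_def by blast
  have closed: "cos (h T) \<le> cos (\<psi> - \<mu> T)"
    if "T \<in> S" "T = {v, x, y}" "v \<noteq> x" "v \<noteq> y" "x \<noteq> y" "0 \<le> a" "0 \<le> b"
      "W \<psi> = a *\<^sub>R perp v x + b *\<^sub>R perp v y" for T \<psi> x y a b
    using arc[OF that(1)] that(2-) unfolding arc_def by blast
  have opn: "\<exists>x y a b. T = {v, x, y} \<and> 0 < a \<and> 0 < b \<and> W \<psi> = a *\<^sub>R perp v x + b *\<^sub>R perp v y"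
    if "T \<in> S" "cos (h T) < cos (\<psi> - \<mu> T)" for T \<psi>
    using arc[OF that(1)] that(2-) unfolding arc_def by blast
  define C where "C = (\<lambda>T. {0..2*pi} \<inter> {\<psi>. cos (\<psi> - \<mu> T) \<ge> cos (h T)})"
  define O' where "O' = (\<lambda>T. {0..2*pi} \<inter> {\<psi>. cos (\<psi> - \<mu> T) > cos (h T)})"
  have "closed {\<psi>. cos (\<psi> - \<mu> T) \<ge> cos (h T)}" "open {\<psi>. cos (\<psi> - \<mu> T) > cos (h T)}" for T
    by (intro closed_Collect_le open_Collect_less continuous_intros)+
  then have meas: "C T \<in> lmeasurable" "O' T \<in> lmeasurable" for T
    unfolding C_def O'_def
    by (auto intro!: fmeasurable_Int_fmeasurable intro: borel_open borel_closed)
  have "2 * pi \<le> (\<Sum>T\<in>S. corner v T)"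
  proof -
    have "{0..2*pi} \<subseteq> (\<Union>T\<in>S. C T)"
    proof
      fix \<psi> assume \<psi>: "\<psi> \<in> {0..2*pi}"
      have "W \<psi> \<bullet> v = 0" using ef by (simp add: W_def inner_add_left)
      then obtain x y a b where "{v, x, y} \<in> \<T>" "v \<noteq> x" "v \<noteq> y" "x \<noteq> y" "0 \<le> a" "0 \<le> b"
        "W \<psi> = a *\<^sub>R perp v x + b *\<^sub>R perp v y"
        using cones_cover[OF v] by blast
      then show "\<psi> \<in> (\<Union>T\<in>S. C T)" using \<psi> closed[of "{v, x, y}" x y a b \<psi>]
        by (auto simp: C_def S_def intro!: bexI[of _ "{v, x, y}"])
    qed
    then have "measure lebesgue {0..2*pi} \<le> measure lebesgue (\<Union>T\<in>S. C T)"
      by (intro measure_mono_fmeasurable fmeasurable.finite_UN finS meas) auto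
    also have "\<dots> \<le> (\<Sum>T\<in>S. measure lebesgue (C T))"
      by (intro measure_UNION_le finS fmeasurableD meas)
    also have "\<dots> \<le> (\<Sum>T\<in>S. corner v T)"
    proof (rule sum_mono)
      fix T assume "T \<in> S"
      from hm[OF this] show "measure lebesgue (C T) \<le> corner v T"
        using measure_closed_arc[of "h T" "\<mu> T"] by (simp add: C_def)
    qed
    finally show ?thesis by simp
  qed
  moreover have "(\<Sum>T\<in>S. corner v T) \<le> 2 * pi"
  proof -
    have disj: "disjoint_family_on O' S"
      unfolding disjoint_family_on_def
    proof (intro ballI impI)
      fix T T' assume TT: "T \<in> S" "T' \<in> S" "T \<noteq> T'"
      show "O' T \<inter> O' T' = {}"
      proof (rule ccontr)
        assume "O' T \<inter> O' T' \<noteq> {}"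
        then obtain \<psi> where lt: "cos (h T) < cos (\<psi> - \<mu> T)" "cos (h T') < cos (\<psi> - \<mu> T')" by (auto simp: O'_def)
        obtain x y a b where *: "T = {v, x, y}" "0 < a" "0 < b" "W \<psi> = a *\<^sub>R perp v x + b *\<^sub>R perp v y"
          using opn[OF TT(1) lt(1)] by blast
        obtain x' y' a' b' where **: "T' = {v, x', y'}" "0 < a'" "0 < b'" "W \<psi> = a' *\<^sub>R perp v x' + b' *\<^sub>R perp v y'"
          using opn[OF TT(2) lt(2)] by blast
        have "{v, x, y} = {v, x', y'}"
          by (rule cones_disjoint[of v x y x' y' a b a' b'])
            (use TT(1,2) card_3[of T] * ** in \<open>simp_all add: S_def\<close>)
        with TT(3) *(1) **(1) show False by simp
      qed
    qed
    have "(\<Sum>T\<in>S. corner v T) \<le> (\<Sum>T\<in>S. measure lebesgue (O' T))"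
    proof (rule sum_mono)
      fix T assume "T \<in> S"
      from hm[OF this] show "corner v T \<le> measure lebesgue (O' T)"
        using measure_open_arc[of "h T" "\<mu> T"] by (simp add: O'_def)
    qed
    also have "\<dots> = measure lebesgue (\<Union>T\<in>S. O' T)"
      using fmeasurableD[OF meas(2)] fmeasurableD2[OF meas(2), folded infinity_ennreal_def]
      by (intro measure_finite_Union[symmetric] finS disj) blast+
    also have "\<dots> \<le> measure lebesgue {0..2*pi}"
      by (intro measure_mono_fmeasurable sets.finite_UN finS fmeasurableD meas) (auto simp: O'_def)
    finally show ?thesis by simp
  qed
  ultimately show ?thesis by (simp add: S_def)
qed

end

section \<open>Euler's relation\<close>

lemma ex_generic_direction:
  fixes D :: "(real^3) set"
  assumes "finite D" "0 \<notin> D"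
  obtains u where "\<And>d. d \<in> D \<Longrightarrow> u \<bullet> d \<noteq> 0"
proof -
  have "negligible (\<Union>d\<in>D. {u. d \<bullet> u = 0})"
    using assms by (intro negligible_Union) (auto intro!: negligible_hyperplane)
  then have "(\<Union>d\<in>D. {u. d \<bullet> u = 0}) \<noteq> UNIV"
    using non_negligible_UNIV by metis
  then obtain u where "u \<notin> (\<Union>d\<in>D. {u. d \<bullet> u = 0})" by blast
  then show ?thesis using that[of u] by (auto simp: inner_commute)
qed

lemma three_dependent_in_plane:
  fixes u :: "real^3"
  assumes "u \<noteq> 0" "u \<bullet> w1 = 0" "u \<bullet> w2 = 0" "u \<bullet> w3 = 0"
    and "w1 \<noteq> w2" "w1 \<noteq> w3" "w2 \<noteq> w3"
  obtains a b c where "a *\<^sub>R w1 + b *\<^sub>R w2 + c *\<^sub>R w3 = 0" "a \<noteq> 0 \<or> b \<noteq> 0 \<or> c \<noteq> 0"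
proof -
  have "dim {x. u \<bullet> x = 0} = 2" using dim_hyperplane[OF assms(1)] by simp
  moreover have "{w1, w2, w3} \<subseteq> {x. u \<bullet> x = 0}" using assms by auto
  moreover have "card {w1, w2, w3} = 3" using assms by auto
  ultimately have "dependent {w1, w2, w3}"
    using independent_card_le_dim[of "{w1, w2, w3}" "{x. u \<bullet> x = 0}"] by fastforce
  then obtain f where "(\<Sum>v\<in>{w1, w2, w3}. f v *\<^sub>R v) = 0" "\<exists>v\<in>{w1, w2, w3}. f v \<noteq> 0"
    using dependent_finite[of "{w1, w2, w3}"] by blast
  then show ?thesis using that[of "f w1" "f w2" "f w3"] assms(5-7) by (auto simp: add.assoc)
qed

text \<open>Each equation makes two of the numbers vanish together or have opposite signs, but three
  numbers cannot have pairwise opposite signs.\<close>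

lemma opposite_signs_contradiction:
  fixes a b c :: real
  assumes "a \<noteq> 0 \<or> b \<noteq> 0 \<or> c \<noteq> 0"
    and "b * p + c * q = 0" "a * r + c * s = 0" "a * t + b * w = 0"
    and "p < 0" "q < 0" "r < 0" "s < 0" "t < 0" "w < 0"
  shows False
proof -
  have *: "x * y < 0 \<or> (x = 0 \<and> y = 0)" if "x * i + y * j = 0" "i < 0" "j < 0" for x y i j :: real
    using that by (smt (verit, best) mult_neg_neg mult_pos_neg mult_eq_0_iff mult_less_0_iff)
  from *[OF assms(2,5,6)] *[OF assms(3,7,8)] *[OF assms(4,9,10)] assms(1)
  show False by (auto simp: mult_less_0_iff)
qed

context inscribed_triangulation
begin

text \<open>If no other vertex has the height of \<open>v\<close>, these are the triangles at
  \<open>v\<close> which the plane orthogonal to \<open>u\<close> through \<open>v\<close> cuts in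
  more than the point \<open>v\<close>.\<close>

definition middle :: "real^3 \<Rightarrow> real^3 \<Rightarrow> (real^3) set \<Rightarrow> bool" where
  "middle u v T \<longleftrightarrow> (\<exists>x y. T = {v, x, y} \<and> u \<bullet> x < u \<bullet> v \<and> u \<bullet> v < u \<bullet> y)"

text \<open>Otherwise a short segment with \<open>v\<close> in its interior would lie in the hull
  and thus in the unit ball, whose boundary contains no segment.\<close>

lemma pointed:
  assumes v: "v \<in> V" and w: "\<And>T. T \<in> \<T> \<Longrightarrow> v \<in> T \<Longrightarrow> n T \<bullet> w = 0"
  shows "w = 0"
proof -
  obtain \<delta> where d: "0 < \<delta>" "0 < 1 + \<delta> * 0" "(1 / (1 + \<delta> * 0)) *\<^sub>R (v + \<delta> *\<^sub>R w) \<in> convex hull V"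
    by (rule step_in_hull[OF v, of w 0]) (use w in auto)
  obtain \<epsilon> where e: "0 < \<epsilon>" "0 < 1 + \<epsilon> * 0" "(1 / (1 + \<epsilon> * 0)) *\<^sub>R (v + \<epsilon> *\<^sub>R (- w)) \<in> convex hull V"
    by (rule step_in_hull[OF v, of "- w" 0]) (use w in auto)
  have vv: "v \<bullet> v = 1" using norm_V[OF v] by (simp add: norm_eq_1)
  have "(v + \<delta> *\<^sub>R w) \<bullet> (v + \<delta> *\<^sub>R w) \<le> 1" "(v - \<epsilon> *\<^sub>R w) \<bullet> (v - \<epsilon> *\<^sub>R w) \<le> 1"
    using norm_hull_le[OF d(3)] norm_hull_le[OF e(3)]
    by (simp_all add: power2_norm_eq_inner[symmetric] power_le_one)
  then have "\<delta> * (2 * (v \<bullet> w) + \<delta> * (w \<bullet> w)) \<le> 0" "\<epsilon> * (- 2 * (v \<bullet> w) + \<epsilon> * (w \<bullet> w)) \<le> 0"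
    by (simp_all add: inner_add_left inner_add_right inner_diff_left inner_diff_right inner_commute vv algebra_simps)
  then have "2 * (v \<bullet> w) + \<delta> * (w \<bullet> w) \<le> 0" "- 2 * (v \<bullet> w) + \<epsilon> * (w \<bullet> w) \<le> 0"
    using d(1) e(1) by (simp_all add: mult_le_0_iff)
  then have "(\<delta> + \<epsilon>) * (w \<bullet> w) \<le> 0" by (simp add: algebra_simps)
  then have "w \<bullet> w \<le> 0" using d(1) e(1) by (simp add: mult_le_0_iff)
  then show ?thesis by (metis inner_eq_zero_iff inner_ge_zero order_antisym)
qed

text \<open>Among the horizontal directions, those with \<open>u\<close>-component 0,
  \<open>w0\<close> points into the interior. Moving it along \<open>w1\<close> until the first
  facet plane is met gives, by \<open>star_cone\<close>, a nonnegative combination of two edges at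
  \<open>v\<close>. It is horizontal and nonzero while no edge at \<open>v\<close> is horizontal, so
  one edge goes up and the other down.\<close>

lemma middle_exit:
  assumes v: "v \<in> V" and gen: "\<And>x. x \<in> V \<Longrightarrow> x \<noteq> v \<Longrightarrow> u \<bullet> x \<noteq> u \<bullet> v"
    and w0: "\<And>T. T \<in> \<T> \<Longrightarrow> v \<in> T \<Longrightarrow> n T \<bullet> w0 < 0" "u \<bullet> w0 = 0" "u \<bullet> w1 = 0"
    and ex: "T0 \<in> \<T>" "v \<in> T0" "0 < n T0 \<bullet> w1"
    and nz: "\<And>s. w0 + s *\<^sub>R w1 \<noteq> 0"
  obtains T where "T \<in> \<T>" "middle u v T" "0 < n T \<bullet> w1"
proof -
  define S where "S = {T \<in> \<T>. v \<in> T \<and> 0 < n T \<bullet> w1}"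
  define r where "r = (\<lambda>T. - (n T \<bullet> w0) / (n T \<bullet> w1))"
  have S: "finite S" "S \<noteq> {}" using finite_T ex by (auto simp: S_def)
  then have "Min (r ` S) \<in> r ` S" by (intro Min_in) auto
  then obtain T where T: "T \<in> S" "r T = Min (r ` S)" by force
  have min: "r T \<le> r T'" if "T' \<in> S" for T' unfolding T(2) using S that by (intro Min_le) auto
  have TT: "T \<in> \<T>" "v \<in> T" and pos: "0 < n T \<bullet> w1" using T(1) by (auto simp: S_def)
  define s where "s = r T"
  have s: "0 < s" using w0(1)[OF TT] pos by (simp add: s_def r_def divide_neg_pos)
  define w where "w = w0 + s *\<^sub>R w1"
  have wT: "n T \<bullet> w = 0" using pos by (simp add: w_def s_def r_def inner_add_right inner_diff_right)
  have wle: "n T' \<bullet> w \<le> 0" if T': "T' \<in> \<T>" "v \<in> T'" for T'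
  proof (cases "0 < n T' \<bullet> w1")
    case True
    then have "s \<le> r T'" using min T' by (auto simp: S_def s_def)
    then show ?thesis using True by (simp add: w_def r_def inner_add_right field_simps)
  next
    case False
    then have "s * (n T' \<bullet> w1) \<le> 0" using s by (simp add: mult_le_0_iff)
    then show ?thesis using w0(1)[OF T'] by (simp add: w_def inner_add_right)
  qed
  obtain x y where xy: "T = {v, x, y}" "v \<noteq> x" "v \<noteq> y" "x \<noteq> y" by (rule tripleE[OF TT])
  have T': "{v, x, y} \<in> \<T>" using TT xy by simp
  have "n T' \<bullet> w \<le> n {v, x, y} \<bullet> w" if "T' \<in> \<T>" "v \<in> T'" for T'
    using wle[OF that] wT xy(1) by simp
  then obtain a b where ab: "0 \<le> a" "0 \<le> b" "w - (n {v, x, y} \<bullet> w) *\<^sub>R v = a *\<^sub>R (x - v) + b *\<^sub>R (y - v)"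
    using star_cone[OF T', of w] by blast
  then have w: "w = a *\<^sub>R (x - v) + b *\<^sub>R (y - v)" using wT xy(1) by simp
  have "u \<bullet> w = 0" using w0 by (simp add: w_def inner_add_right)
  then have uw: "a * (u \<bullet> x - u \<bullet> v) + b * (u \<bullet> y - u \<bullet> v) = 0"
    unfolding w by (simp add: inner_add_right inner_diff_right)
  have "w \<noteq> 0" unfolding w_def by (rule nz)
  then have "a \<noteq> 0 \<or> b \<noteq> 0" unfolding w by auto
  have g: "u \<bullet> x \<noteq> u \<bullet> v" "u \<bullet> y \<noteq> u \<bullet> v" using gen subset_V[OF T'] xy by auto
  have "0 < a" "0 < b" using \<open>a \<noteq> 0 \<or> b \<noteq> 0\<close> uw g ab by (auto simp: less_le)
  then have "(u \<bullet> x < u \<bullet> v \<and> u \<bullet> v < u \<bullet> y) \<or> (u \<bullet> y < u \<bullet> v \<and> u \<bullet> v < u \<bullet> x)"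
    using uw g by (smt (verit) mult_pos_pos mult_pos_neg)
  moreover have "T = {v, y, x}" using xy by auto
  ultimately have "middle u v T" unfolding middle_def using xy(1) by blast
  then show ?thesis using that TT(1) pos by blast
qed

lemma two_middle:
  assumes v: "v \<in> V" and gen: "\<And>x. x \<in> V \<Longrightarrow> x \<noteq> v \<Longrightarrow> u \<bullet> x \<noteq> u \<bullet> v"
    and a: "a \<in> V" "u \<bullet> a < u \<bullet> v" and b: "b \<in> V" "u \<bullet> v < u \<bullet> b"
  obtains T T' where "T \<in> \<T>" "T' \<in> \<T>" "T \<noteq> T'" "middle u v T" "middle u v T'"
proof -
  define S where "S = {T \<in> \<T>. v \<in> T}"
  have S: "finite S" using finite_T by (simp add: S_def)
  \<comment> \<open>The direction \<open>- v\<close> to the centre is below every facet plane at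
    \<open>v\<close>; adding a multiple of an edge towards a higher or a lower vertex makes it
    horizontal without spoiling this.\<close>
  obtain c s where c: "c \<in> V" "0 \<le> s" "u \<bullet> (- v + s *\<^sub>R (c - v)) = 0"
  proof (cases "0 \<le> u \<bullet> v")
    case True
    then show ?thesis using b that[of b "(u \<bullet> v) / (u \<bullet> b - u \<bullet> v)"] by (simp add: inner_diff_right)
  next
    case False
    then show ?thesis using a that[of a "(u \<bullet> v) / (u \<bullet> a - u \<bullet> v)"] by (simp add: inner_diff_right divide_nonpos_neg)
  qed
  define w0 where "w0 = - v + s *\<^sub>R (c - v)"
  have w0: "n T \<bullet> w0 < 0" if T: "T \<in> \<T>" "v \<in> T" for T
  proof -
    have "s * (n T \<bullet> c - 1) \<le> 0" using normal_le[OF T(1) c(1)] c(2) by (simp add: mult_le_0_iff)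
    then show ?thesis using normal_on[OF T] by (simp add: w0_def inner_add_right inner_diff_right)
  qed
  \<comment> \<open>On a \<open>w1\<close> orthogonal to the sum \<open>m\<close>, the normals at
    \<open>v\<close> cannot all be nonpositive unless all vanish, which \<open>pointed\<close>
    excludes. So both \<open>w1\<close> and \<open>- w1\<close> run into a facet, and
    \<open>m \<bullet> w0 < 0\<close> keeps the moving direction away from 0.\<close>
  define m where "m = (\<Sum>T\<in>S. n T)"
  obtain T1 where T1: "T1 \<in> \<T>" "v \<in> T1" by (rule star_nonempty[OF v])
  have mw0: "m \<bullet> w0 < 0"
    unfolding m_def inner_sum_left using sum_strict_mono[OF S, of "\<lambda>T. n T \<bullet> w0" "\<lambda>_. 0"] T1 w0
    by (auto simp: S_def)
  have "dim {u, m} < DIM(real^3)"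
    using dim_le_card'[of "{u, m}"] card_insert_le_m1[of 2 "{m}" u] by simp
  then obtain w1 where w1: "w1 \<noteq> 0" "\<And>y. y \<in> span {u, m} \<Longrightarrow> orthogonal w1 y"
    using orthogonal_to_subspace_exists[of "{u, m}"] by blast
  have uw1: "u \<bullet> w1 = 0" "m \<bullet> w1 = 0"
    using w1(2)[of u] w1(2)[of m] by (simp_all add: span_base orthogonal_def inner_commute)
  have nz: "w0 + t *\<^sub>R w1 \<noteq> 0" for t
  proof
    assume "w0 + t *\<^sub>R w1 = 0"
    from arg_cong[OF this, of "\<lambda>z. m \<bullet> z"] show False using mw0 uw1 by (simp add: inner_add_right)
  qed
  have both: "\<exists>T\<in>S. 0 < n T \<bullet> z" if z: "m \<bullet> z = 0" "z \<noteq> 0" for z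
  proof (rule ccontr)
    assume neg: "\<not> ?thesis"
    have "(\<Sum>T\<in>S. - (n T \<bullet> z)) = 0" using z(1) by (simp add: m_def inner_sum_left sum_negf)
    then have "\<forall>T\<in>S. - (n T \<bullet> z) = 0" using sum_nonneg_eq_0_iff[OF S, of "\<lambda>T. - (n T \<bullet> z)"] neg by force
    then have "z = 0" using pointed[OF v, of z] by (auto simp: S_def)
    with z show False by simp
  qed
  obtain T0 where T0: "T0 \<in> \<T>" "v \<in> T0" "0 < n T0 \<bullet> w1" using both[OF uw1(2) w1(1)] by (auto simp: S_def)
  obtain T0' where T0': "T0' \<in> \<T>" "v \<in> T0'" "0 < n T0' \<bullet> (- w1)" using both[of "- w1"] uw1(2) w1(1) by (auto simp: S_def)
  have nz': "w0 + t *\<^sub>R (- w1) \<noteq> 0" for t using nz[of "- t"] by simp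
  have u0: "u \<bullet> w0 = 0" using c by (simp add: w0_def)
  obtain T where T: "T \<in> \<T>" "middle u v T" "0 < n T \<bullet> w1"
    by (rule middle_exit[OF v gen w0 u0 uw1(1) T0 nz])
  have uw1': "u \<bullet> (- w1) = 0" using uw1 by simp
  obtain T' where T': "T' \<in> \<T>" "middle u v T'" "0 < n T' \<bullet> (- w1)"
    by (rule middle_exit[OF v gen w0 u0 uw1' T0' nz'])
  have "T \<noteq> T'" using T(3) T'(3) by auto
  then show ?thesis using that T T' by blast
qed

text \<open>\<open>w\<close> points towards the point of the opposite edge at the height of
  \<open>v\<close>. Another facet at \<open>v\<close> cannot contain both ends of that edge, so
  \<open>w\<close> is strictly below its plane.\<close>

lemma middle_direction:
  assumes "T \<in> \<T>" "middle u v T"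
  obtains w where "u \<bullet> w = 0" "n T \<bullet> w = 0" "\<And>T'. T' \<in> \<T> \<Longrightarrow> v \<in> T' \<Longrightarrow> T' \<noteq> T \<Longrightarrow> n T' \<bullet> w < 0"
proof -
  obtain x y where xy: "T = {v, x, y}" "u \<bullet> x < u \<bullet> v" "u \<bullet> v < u \<bullet> y"
    using assms(2) by (auto simp: middle_def)
  define w where "w = (u \<bullet> y - u \<bullet> v) *\<^sub>R (x - v) + (u \<bullet> v - u \<bullet> x) *\<^sub>R (y - v)"
  have "u \<bullet> w = 0" by (simp add: w_def inner_add_right inner_diff_right algebra_simps)
  moreover have "n T \<bullet> w = 0"
    using normal_on[OF assms(1)] xy(1) by (simp add: w_def inner_add_right inner_diff_right)
  moreover have "n T' \<bullet> w < 0" if T': "T' \<in> \<T>" "v \<in> T'" "T' \<noteq> T" for T'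
  proof -
    have V: "x \<in> V" "y \<in> V" using subset_V[OF assms(1)] xy(1) by auto
    have nv: "n T' \<bullet> v = 1" using normal_on T' by blast
    have "x \<notin> T' \<or> y \<notin> T'"
    proof (rule ccontr)
      assume "\<not> ?thesis"
      then have "T \<subseteq> T'" using T'(2) xy(1) by auto
      then have "T = T'" using card_3[OF T'(1)] card_3[OF assms(1)]
        by (metis card_subset_eq card.infinite zero_neq_numeral)
      with T'(3) show False by simp
    qed
    then have "n T' \<bullet> x < 1 \<or> n T' \<bullet> y < 1" using normal_off[OF T'(1)] V by blast
    moreover have "n T' \<bullet> x \<le> 1" "n T' \<bullet> y \<le> 1" using normal_le[OF T'(1)] V by auto
    moreover have "n T' \<bullet> w = (u \<bullet> y - u \<bullet> v) * (n T' \<bullet> x - 1) + (u \<bullet> v - u \<bullet> x) * (n T' \<bullet> y - 1)"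
      by (simp add: w_def inner_add_right inner_diff_right nv)
    ultimately show ?thesis using xy(2,3)
      by (smt (verit) mult_pos_neg mult_nonneg_nonpos)
  qed
  ultimately show ?thesis using that by blast
qed

text \<open>The horizontal slice at \<open>v\<close> is a planar cone and has at most two sides:
  three directions from \<open>middle_direction\<close> are dependent in the plane orthogonal to
  \<open>u\<close>, and the three normals turn the dependency into an impossible sign
  pattern.\<close>

lemma card_middle_le:
  assumes "u \<noteq> 0"
  shows "card {T \<in> \<T>. middle u v T} \<le> 2"
proof (rule ccontr)
  assume "\<not> ?thesis"
  then have "3 \<le> card {T \<in> \<T>. middle u v T}" by simp
  then obtain X where "X \<subseteq> {T \<in> \<T>. middle u v T}" "card X = 3"
    by (meson obtain_subset_with_card_n)
  then obtain T1 T2 T3 where T: "T1 \<noteq> T2" "T1 \<noteq> T3" "T2 \<noteq> T3" "T1 \<in> \<T>" "T2 \<in> \<T>" "T3 \<in> \<T>"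
    "middle u v T1" "middle u v T2" "middle u v T3"
    by (auto simp: card_3_iff)
  have vT: "v \<in> T1" "v \<in> T2" "v \<in> T3" using T(7-9) by (auto simp: middle_def)
  obtain w1 where w1': "u \<bullet> w1 = 0" "n T1 \<bullet> w1 = 0" "\<And>T'. T' \<in> \<T> \<Longrightarrow> v \<in> T' \<Longrightarrow> T' \<noteq> T1 \<Longrightarrow> n T' \<bullet> w1 < 0"
    using middle_direction[OF T(4,7)] by blast
  have w1: "u \<bullet> w1 = 0" "n T1 \<bullet> w1 = 0" "n T2 \<bullet> w1 < 0" "n T3 \<bullet> w1 < 0"
    using w1'(1,2) w1'(3)[of T2] w1'(3)[of T3] T vT by auto
  obtain w2 where w2': "u \<bullet> w2 = 0" "n T2 \<bullet> w2 = 0" "\<And>T'. T' \<in> \<T> \<Longrightarrow> v \<in> T' \<Longrightarrow> T' \<noteq> T2 \<Longrightarrow> n T' \<bullet> w2 < 0"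
    using middle_direction[OF T(5,8)] by blast
  have w2: "u \<bullet> w2 = 0" "n T2 \<bullet> w2 = 0" "n T1 \<bullet> w2 < 0" "n T3 \<bullet> w2 < 0"
    using w2'(1,2) w2'(3)[of T1] w2'(3)[of T3] T vT by auto
  obtain w3 where w3': "u \<bullet> w3 = 0" "n T3 \<bullet> w3 = 0" "\<And>T'. T' \<in> \<T> \<Longrightarrow> v \<in> T' \<Longrightarrow> T' \<noteq> T3 \<Longrightarrow> n T' \<bullet> w3 < 0"
    using middle_direction[OF T(6,9)] by blast
  have w3: "u \<bullet> w3 = 0" "n T3 \<bullet> w3 = 0" "n T1 \<bullet> w3 < 0" "n T2 \<bullet> w3 < 0"
    using w3'(1,2) w3'(3)[of T1] w3'(3)[of T2] T vT by auto
  have ne: "w1 \<noteq> w2" "w1 \<noteq> w3" "w2 \<noteq> w3" using w1 w2 w3 by auto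
  obtain a b c where abc: "a *\<^sub>R w1 + b *\<^sub>R w2 + c *\<^sub>R w3 = 0" "a \<noteq> 0 \<or> b \<noteq> 0 \<or> c \<noteq> 0"
    by (rule three_dependent_in_plane[OF assms w1(1) w2(1) w3(1) ne]) (rule that)
  have "b * (n T1 \<bullet> w2) + c * (n T1 \<bullet> w3) = 0" "a * (n T2 \<bullet> w1) + c * (n T2 \<bullet> w3) = 0"
    "a * (n T3 \<bullet> w1) + b * (n T3 \<bullet> w2) = 0"
    using arg_cong[OF abc(1), of "\<lambda>z. n T1 \<bullet> z"] arg_cong[OF abc(1), of "\<lambda>z. n T2 \<bullet> z"]
      arg_cong[OF abc(1), of "\<lambda>z. n T3 \<bullet> z"] w1 w2 w3 by (simp_all add: inner_add_right)
  from opposite_signs_contradiction[OF abc(2) this w2(3) w3(3) w1(3) w3(4) w1(4) w2(4)]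
  show False .
qed

lemma unique_middle:
  assumes T: "T \<in> \<T>" and inj: "inj_on (\<lambda>x. u \<bullet> x) V"
  shows "card {v \<in> V. middle u v T} = 1"
proof -
  obtain a b c where abc: "T = {a, b, c}" "a \<noteq> b" "a \<noteq> c" "b \<noteq> c" using card_3[OF T] by (auto simp: card_3_iff)
  have V: "a \<in> V" "b \<in> V" "c \<in> V" using subset_V[OF T] abc by auto
  have ne: "u \<bullet> a \<noteq> u \<bullet> b" "u \<bullet> a \<noteq> u \<bullet> c" "u \<bullet> b \<noteq> u \<bullet> c"
    using inj_onD[OF inj] V abc by blast+
  have *: "{v \<in> V. middle u v {p, q, r}} = {q}"
    if "u \<bullet> p < u \<bullet> q" "u \<bullet> q < u \<bullet> r" "q \<in> V" for p q r
  proof -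
    have "middle u q {p, q, r}" unfolding middle_def using that by (intro exI[of _ p] exI[of _ r]) auto
    moreover have "v = q" if "middle u v {p, q, r}" for v
    proof -
      from that obtain x y where xy: "{p, q, r} = {v, x, y}" "u \<bullet> x < u \<bullet> v" "u \<bullet> v < u \<bullet> y"
        by (auto simp: middle_def)
      then have "v \<in> {p, q, r}" "x \<in> {p, q, r}" "y \<in> {p, q, r}" by auto
      then show ?thesis using xy(2,3) \<open>u \<bullet> p < u \<bullet> q\<close> \<open>u \<bullet> q < u \<bullet> r\<close> by auto
    qed
    ultimately show ?thesis using that by auto
  qed
  consider "u \<bullet> a < u \<bullet> b" "u \<bullet> b < u \<bullet> c" | "u \<bullet> a < u \<bullet> c" "u \<bullet> c < u \<bullet> b" | "u \<bullet> b < u \<bullet> a" "u \<bullet> a < u \<bullet> c"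
    | "u \<bullet> b < u \<bullet> c" "u \<bullet> c < u \<bullet> a" | "u \<bullet> c < u \<bullet> a" "u \<bullet> a < u \<bullet> b" | "u \<bullet> c < u \<bullet> b" "u \<bullet> b < u \<bullet> a"
    using ne by linarith
  then have "\<exists>p q r. T = {p, q, r} \<and> u \<bullet> p < u \<bullet> q \<and> u \<bullet> q < u \<bullet> r \<and> q \<in> V"
  proof cases
    case 1
    then show ?thesis using V abc(1) by (intro exI[of _ a] exI[of _ b] exI[of _ c]) auto
  next
    case 2
    then show ?thesis using V abc(1) by (intro exI[of _ a] exI[of _ c] exI[of _ b]) auto
  next
    case 3
    then show ?thesis using V abc(1) by (intro exI[of _ b] exI[of _ a] exI[of _ c]) auto
  next
    case 4
    then show ?thesis using V abc(1) by (intro exI[of _ b] exI[of _ c] exI[of _ a]) auto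
  next
    case 5
    then show ?thesis using V abc(1) by (intro exI[of _ c] exI[of _ a] exI[of _ b]) auto
  next
    case 6
    then show ?thesis using V abc(1) by (intro exI[of _ c] exI[of _ b] exI[of _ a]) auto
  qed
  then obtain p q r where "T = {p, q, r}" "u \<bullet> p < u \<bullet> q" "u \<bullet> q < u \<bullet> r" "q \<in> V" by blast
  then show ?thesis using *[of p q r] by simp
qed

lemma T_nonempty: "V \<noteq> {} \<Longrightarrow> \<T> \<noteq> {}"
  using star_nonempty by blast

text \<open>Sweep with a generic linear functional: every triangle has exactly one middle vertex, and every
  vertex other than the top and the bottom one is the middle vertex of exactly two triangles.\<close>

theorem card_facets:
  assumes "V \<noteq> {}"
  shows "card \<T> + 4 = 2 * card V"
proof -
  have "finite ((\<lambda>(x, y). x - y) ` (V \<times> V) - {0})" using finite_V by auto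
  then obtain u where u: "\<And>d. d \<in> (\<lambda>(x, y). x - y) ` (V \<times> V) - {0} \<Longrightarrow> u \<bullet> d \<noteq> 0"
    using ex_generic_direction[of "(\<lambda>(x, y). x - y) ` (V \<times> V) - {0}"] by blast
  have inj: "inj_on (\<lambda>x. u \<bullet> x) V"
  proof (rule inj_onI, rule ccontr)
    fix x y assume "x \<in> V" "y \<in> V" "u \<bullet> x = u \<bullet> y" "x \<noteq> y"
    then show False using u[of "x - y"] by (force simp: inner_diff_right)
  qed
  obtain T where T: "T \<in> \<T>" using T_nonempty[OF assms] by blast
  obtain p q where pq: "p \<in> V" "q \<in> V" "p \<noteq> q"
    using card_3[OF T] subset_V[OF T] by (auto simp: card_3_iff)
  then have u0: "u \<noteq> 0" using inj_onD[OF inj, of p q] by auto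
  have "Max ((\<lambda>x. u \<bullet> x) ` V) \<in> (\<lambda>x. u \<bullet> x) ` V" "Min ((\<lambda>x. u \<bullet> x) ` V) \<in> (\<lambda>x. u \<bullet> x) ` V"
    using finite_V assms by (auto intro!: Max_in Min_in simp del: Max_in Min_in)
  then obtain t b where t: "t \<in> V" "u \<bullet> t = Max ((\<lambda>x. u \<bullet> x) ` V)" and b: "b \<in> V" "u \<bullet> b = Min ((\<lambda>x. u \<bullet> x) ` V)"
    by force
  have ext: "u \<bullet> b \<le> u \<bullet> x" "u \<bullet> x \<le> u \<bullet> t" if "x \<in> V" for x
    unfolding t(2) b(2) using finite_V that by (auto intro!: Max_ge Min_le)
  have "b \<noteq> t" using ext[OF pq(1)] ext[OF pq(2)] inj_onD[OF inj _ pq(1,2)] pq(3) by force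
  have count: "card {T \<in> \<T>. middle u v T} = (if v = t \<or> v = b then 0 else 2)" if v: "v \<in> V" for v
  proof (cases "v = t \<or> v = b")
    case True
    have "\<not> middle u v T" if T: "T \<in> \<T>" for T
    proof
      assume "middle u v T"
      then obtain x y where xy: "T = {v, x, y}" "u \<bullet> x < u \<bullet> v" "u \<bullet> v < u \<bullet> y" by (auto simp: middle_def)
      then have "x \<in> V" "y \<in> V" using subset_V[OF T] by auto
      then show False using True ext[of x] ext[of y] xy(2,3) by auto
    qed
    then have none: "{T \<in> \<T>. middle u v T} = {}" by blast
    show ?thesis unfolding none using True by simp
  next
    case False
    have "u \<bullet> b < u \<bullet> v" "u \<bullet> v < u \<bullet> t"
      using ext[OF v] False inj_onD[OF inj _ v b(1)] inj_onD[OF inj _ v t(1)] by force+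
    moreover have "u \<bullet> x \<noteq> u \<bullet> v" if "x \<in> V" "x \<noteq> v" for x
      using inj_onD[OF inj _ that(1) v] that by blast
    ultimately obtain T T' where "T \<in> \<T>" "T' \<in> \<T>" "T \<noteq> T'" "middle u v T" "middle u v T'"
      using two_middle[OF v _ b(1) _ t(1), of u] by blast
    then have "card {T, T'} \<le> card {T \<in> \<T>. middle u v T}"
      using finite_T by (intro card_mono) auto
    then show ?thesis using card_middle_le[OF u0, of v] \<open>T \<noteq> T'\<close> False by simp
  qed
  have "card \<T> = (\<Sum>T\<in>\<T>. card {v \<in> V. middle u v T})"
    using unique_middle[OF _ inj] by simp
  also have "\<dots> = (\<Sum>v\<in>V. card {T \<in> \<T>. middle u v T})"
    by (rule sum_multicount_gen) (use finite_V finite_T in auto)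
  also have "\<dots> = (\<Sum>v\<in>V. if v = t \<or> v = b then 0 else 2)"
    by (intro sum.cong refl count)
  also have "\<dots> = (\<Sum>v\<in>V - {t, b}. 2)"
    by (rule sum.mono_neutral_cong_right) (use finite_V in auto)
  also have "\<dots> = 2 * card (V - {t, b})" by simp
  also have "card (V - {t, b}) = card V - 2"
    using t(1) b(1) \<open>b \<noteq> t\<close> by (simp add: card_Diff_subset)
  finally have "card \<T> = 2 * (card V - 2)" .
  moreover have "card {t, b} \<le> card V" using t b finite_V by (intro card_mono) auto
  ultimately show ?thesis using \<open>b \<noteq> t\<close> by simp
qed

end

section \<open>Trigonometry of an isosceles facet\<close>

lemma sang_unit:
  assumes "norm v = 1" "norm x = 1" "norm y = 1"
  shows "sang v x y = arccos ((x \<bullet> y - (x \<bullet> v) * (y \<bullet> v)) / (sqrt (1 - (x \<bullet> v)\<^sup>2) * sqrt (1 - (y \<bullet> v)\<^sup>2)))"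
proof -
  have vv: "v \<bullet> v = 1" "x \<bullet> x = 1" "y \<bullet> y = 1" using assms by (simp_all add: norm_eq_1)
  have "perp v x \<bullet> perp v y = x \<bullet> y - (x \<bullet> v) * (y \<bullet> v)"
    using vv by (simp add: perp_def inner_diff_left inner_diff_right inner_commute)
  moreover have "norm (perp v x) = sqrt (1 - (x \<bullet> v)\<^sup>2)" "norm (perp v y) = sqrt (1 - (y \<bullet> v)\<^sup>2)"
    using vv by (simp_all add: norm_eq_sqrt_inner perp_def inner_diff_left inner_diff_right inner_commute power2_eq_square)
  ultimately show ?thesis by (simp add: sang_def)
qed

text \<open>Here \<open>t\<close> is the inner product of the apex with a base vertex and
  \<open>g\<close> that of the two base vertices. The Gram determinant of the three vertices is
  \<open>(1 - g) (1 + g - 2 t\<^sup>2)\<close>, so the assumptions express non-degeneracy.\<close>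

context
  fixes t g \<alpha> \<beta> :: real
  assumes t: "t\<^sup>2 < 1" and g: "g\<^sup>2 < 1" and G: "0 < 1 + g - 2 * t\<^sup>2"
    and \<alpha>: "\<alpha> = arccos ((g - t\<^sup>2) / (1 - t\<^sup>2))"
    and \<beta>: "\<beta> = arccos (t * (1 - g) / (sqrt (1 - t\<^sup>2) * sqrt (1 - g\<^sup>2)))"
begin

lemma g_bounds: "-1 < g" "g < 1"
  using g by (simp_all add: abs_square_less_1 abs_less_iff)

lemma cos_apex: "-1 < (g - t\<^sup>2) / (1 - t\<^sup>2)" "(g - t\<^sup>2) / (1 - t\<^sup>2) < 1"
  using t G g_bounds by (simp_all add: divide_simps)

lemma apex_range: "0 < \<alpha>" "\<alpha> < pi"
  using arccos_lt_bounded[OF cos_apex] by (simp_all add: \<alpha>)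

lemma g_eq_apex: "g = t\<^sup>2 + (1 - t\<^sup>2) * cos \<alpha>"
  using cos_apex t by (simp add: \<alpha>)

lemma half_apex:
  "sin (\<alpha> / 2) = sqrt (1 - g) / (sqrt 2 * sqrt (1 - t\<^sup>2))"
  "cos (\<alpha> / 2) = sqrt (1 + g - 2 * t\<^sup>2) / (sqrt 2 * sqrt (1 - t\<^sup>2))"
proof -
  have c: "cos \<alpha> = (g - t\<^sup>2) / (1 - t\<^sup>2)" using cos_apex by (simp add: \<alpha>)
  have pos: "0 < sin (\<alpha> / 2)" "0 < cos (\<alpha> / 2)"
    using apex_range by (auto intro!: sin_gt_zero cos_gt_zero)
  moreover have "(sin (\<alpha> / 2))\<^sup>2 = (1 - cos \<alpha>) / 2" using cos_double_sin[of "\<alpha> / 2"] by simp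
  moreover have "(cos (\<alpha> / 2))\<^sup>2 = (1 + cos \<alpha>) / 2" using cos_double_cos[of "\<alpha> / 2"] by simp
  ultimately have "(sin (\<alpha> / 2))\<^sup>2 = (1 - g) / (2 * (1 - t\<^sup>2))" "(cos (\<alpha> / 2))\<^sup>2 = (1 + g - 2 * t\<^sup>2) / (2 * (1 - t\<^sup>2))"
    using t unfolding c by (simp_all add: divide_simps) (simp_all add: algebra_simps)
  with pos show "sin (\<alpha> / 2) = sqrt (1 - g) / (sqrt 2 * sqrt (1 - t\<^sup>2))"
    "cos (\<alpha> / 2) = sqrt (1 + g - 2 * t\<^sup>2) / (sqrt 2 * sqrt (1 - t\<^sup>2))"
    by (metis less_imp_le real_sqrt_divide real_sqrt_mult real_sqrt_unique)+
qed

lemma base_trig: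
  "cos \<beta> = t * sqrt (1 - g) / (sqrt (1 - t\<^sup>2) * sqrt (1 + g))"
  "sin \<beta> = sqrt (1 + g - 2 * t\<^sup>2) / (sqrt (1 - t\<^sup>2) * sqrt (1 + g))"
proof -
  define q where "q = t * sqrt (1 - g) / (sqrt (1 - t\<^sup>2) * sqrt (1 + g))"
  have "1 - g = (sqrt (1 - g))\<^sup>2" using g_bounds by simp
  moreover have "sqrt (1 - g\<^sup>2) = sqrt (1 - g) * sqrt (1 + g)"
    by (simp add: real_sqrt_mult[symmetric] power2_eq_square algebra_simps)
  ultimately have eq: "t * (1 - g) / (sqrt (1 - t\<^sup>2) * sqrt (1 - g\<^sup>2)) = q"
    using g_bounds t unfolding q_def by (simp add: divide_simps power2_eq_square)
  have q2: "1 - q\<^sup>2 = (1 + g - 2 * t\<^sup>2) / ((1 - t\<^sup>2) * (1 + g))"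
  proof -
    have "q\<^sup>2 = t\<^sup>2 * (1 - g) / ((1 - t\<^sup>2) * (1 + g))"
      using g_bounds t by (simp add: q_def power_divide power_mult_distrib)
    moreover have "(1 - t\<^sup>2) * (1 + g) \<noteq> 0" using g_bounds t by simp
    ultimately have "1 - q\<^sup>2 = ((1 - t\<^sup>2) * (1 + g) - t\<^sup>2 * (1 - g)) / ((1 - t\<^sup>2) * (1 + g))"
      by (simp add: diff_divide_distrib)
    also have "(1 - t\<^sup>2) * (1 + g) - t\<^sup>2 * (1 - g) = 1 + g - 2 * t\<^sup>2" by (simp add: algebra_simps)
    finally show ?thesis .
  qed
  moreover have "0 < (1 + g - 2 * t\<^sup>2) / ((1 - t\<^sup>2) * (1 + g))"
    using g_bounds t G by simp
  ultimately have "q\<^sup>2 < 1" by linarith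
  then have qb: "-1 \<le> q" "q \<le> 1" by (simp_all add: abs_square_less_1 abs_less_iff)
  then show "cos \<beta> = t * sqrt (1 - g) / (sqrt (1 - t\<^sup>2) * sqrt (1 + g))"
    unfolding \<beta> eq by (simp add: q_def)
  have "sin \<beta> = sqrt (1 - q\<^sup>2)" unfolding \<beta> eq using qb by (rule sin_arccos)
  then show "sin \<beta> = sqrt (1 + g - 2 * t\<^sup>2) / (sqrt (1 - t\<^sup>2) * sqrt (1 + g))"
    unfolding q2 by (simp add: real_sqrt_divide real_sqrt_mult)
qed

text \<open>The axis of symmetry cuts the spherical triangle into two right-angled ones with
  hypotenuse of cosine \<open>t\<close>; this is Napier's rule cos c = cot A cot B cleared of
  denominators.\<close>

lemma napier: "t * sin (\<alpha> / 2) * sin \<beta> = cos (\<alpha> / 2) * cos \<beta>"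
  unfolding half_apex base_trig by simp

text \<open>Here \<open>\<delta>\<close> is \<open>\<pi> (V - 4) / (2 (V - 2))\<close>, since \<open>\<alpha> + 2\<beta> = \<pi> V / (V - 2)\<close>.\<close>

lemma tan_relation:
  assumes "\<alpha> + 2 * \<beta> = 2 * (pi - \<delta>)" and "cos \<delta> > 0"
  shows "t * tan (\<alpha> / 2) * (tan \<delta> + tan (\<alpha> / 2)) = tan \<delta> * tan (\<alpha> / 2) - 1"
proof -
  define u where "u = \<alpha> / 2"
  have b: "\<beta> = pi - (\<delta> + u)" using assms(1) by (simp add: u_def)
  have cu: "cos u > 0" using apex_range by (auto intro!: cos_gt_zero simp: u_def)
  have "t * sin u * sin (\<delta> + u) = - cos u * cos (\<delta> + u)"
    using napier unfolding b u_def[symmetric] by (simp add: sin_diff cos_diff)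
  then have "t * sin u * (sin \<delta> * cos u + cos \<delta> * sin u) = cos u * (sin \<delta> * sin u - cos \<delta> * cos u)"
    by (simp add: sin_add cos_add algebra_simps)
  moreover define a b where "a = tan \<delta>" and "b = tan u"
  then have "sin \<delta> = a * cos \<delta>" "sin u = b * cos u" using cu assms(2) by (simp_all add: tan_def)
  ultimately have "(t * b * (a + b)) * (cos \<delta> * (cos u)\<^sup>2) = (a * b - 1) * (cos \<delta> * (cos u)\<^sup>2)"
    by (simp add: power2_eq_square algebra_simps)
  then show ?thesis using cu assms(2) by (simp add: a_def b_def u_def)
qed

lemma tan_half_apex_pos: "tan (\<alpha> / 2) > 0"
  using apex_range by (intro tan_gt_zero) auto

lemma g_eq_tan: "g * (1 + (tan (\<alpha> / 2))\<^sup>2) = t\<^sup>2 * (1 + (tan (\<alpha> / 2))\<^sup>2) + (1 - t\<^sup>2) * (1 - (tan (\<alpha> / 2))\<^sup>2)"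
proof -
  define u where "u = \<alpha> / 2"
  have cu: "cos u > 0" using apex_range by (auto intro!: cos_gt_zero simp: u_def)
  have "cos \<alpha> = (cos u)\<^sup>2 - (sin u)\<^sup>2" using cos_double[of u] by (simp add: u_def)
  then have "cos \<alpha> * (1 + (tan u)\<^sup>2) = 1 - (tan u)\<^sup>2"
    using cu sin_cos_squared_add[of u] unfolding tan_def
    by (simp add: field_simps power2_eq_square)
  moreover have "g * (1 + (tan u)\<^sup>2) = t\<^sup>2 * (1 + (tan u)\<^sup>2) + (1 - t\<^sup>2) * (cos \<alpha> * (1 + (tan u)\<^sup>2))"
    by (subst g_eq_apex) (simp add: algebra_simps)
  ultimately show ?thesis by (simp add: u_def)
qed

end

text \<open>By the tangent relation \<open>1 - t\<close> and \<open>1 + t\<close> are rational in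
  \<open>\<tau>\<close> with denominator \<open>N\<close>, and the formula for \<open>g\<close>
  makes both factors of the area multiples of \<open>1 - t\<close> over \<open>p\<close>. Everything
  stays multiplied out, and the surplus power of \<open>\<tau>\<close> is cancelled at the
  end.\<close>

lemma area_in_tan:
  fixes t g \<tau> K :: real
  assumes "0 < \<tau>" "0 \<le> K" and g: "g * (1 + \<tau>\<^sup>2) = t\<^sup>2 * (1 + \<tau>\<^sup>2) + (1 - t\<^sup>2) * (1 - \<tau>\<^sup>2)"
    and t: "t * \<tau> * (K + \<tau>) = K * \<tau> - 1"
  shows "(1 - g) * (3 - 4 * t + g) / 4 * (\<tau> * (K + \<tau>) ^ 4) = (\<tau>\<^sup>2 + 2 * K * \<tau> - 1) * (\<tau> ^ 3 + 3 * \<tau> + 2 * K)"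
proof -
  define N where "N = \<tau> * (K + \<tau>)"
  define p where "p = 1 + \<tau>\<^sup>2"
  have p0: "p \<noteq> 0" by (simp add: p_def power2_eq_square add_nonneg_eq_0_iff)
  have tN: "t * N = K * \<tau> - 1" using t by (simp add: N_def)
  have 1: "(1 - t) * N = p" and 2: "(1 + t) * N = \<tau>\<^sup>2 + 2 * K * \<tau> - 1"
    using tN by (simp_all add: p_def N_def power2_eq_square algebra_simps)
  have 3: "p * (1 - g) = 2 * \<tau>\<^sup>2 * ((1 - t) * (1 + t))"
    using g by (simp add: p_def power2_eq_square algebra_simps)
  have 4: "p * (3 - 4 * t + g) = 2 * (1 - t) * (2 + \<tau>\<^sup>2 - t * \<tau>\<^sup>2)"
    using g by (simp add: p_def power2_eq_square algebra_simps)
  have 5: "(2 + \<tau>\<^sup>2 - t * \<tau>\<^sup>2) * N = \<tau> * (\<tau> ^ 3 + 3 * \<tau> + 2 * K)"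
  proof -
    have "(2 + \<tau>\<^sup>2 - t * \<tau>\<^sup>2) * N = 2 * N + \<tau>\<^sup>2 * ((1 - t) * N)" by (simp add: algebra_simps)
    then show ?thesis unfolding 1 by (simp add: p_def N_def power2_eq_square power3_eq_cube algebra_simps)
  qed
  have "p\<^sup>2 * ((1 - g) * (3 - 4 * t + g) * N ^ 4) = (p * (1 - g)) * (p * (3 - 4 * t + g)) * N ^ 4"
    by (simp add: power2_eq_square)
  also have "\<dots> = 4 * \<tau>\<^sup>2 * ((1 - t) * N)\<^sup>2 * ((1 + t) * N) * ((2 + \<tau>\<^sup>2 - t * \<tau>\<^sup>2) * N)"
    unfolding 3 4 by (simp add: power2_eq_square power4_eq_xxxx)
  also have "\<dots> = p\<^sup>2 * (4 * \<tau> ^ 3 * ((\<tau>\<^sup>2 + 2 * K * \<tau> - 1) * (\<tau> ^ 3 + 3 * \<tau> + 2 * K)))"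
    unfolding 1 2 5 by (simp add: power2_eq_square power3_eq_cube)
  finally have "(1 - g) * (3 - 4 * t + g) * N ^ 4 = 4 * \<tau> ^ 3 * ((\<tau>\<^sup>2 + 2 * K * \<tau> - 1) * (\<tau> ^ 3 + 3 * \<tau> + 2 * K))"
    using p0 by simp
  moreover have "N ^ 4 = \<tau> ^ 3 * (\<tau> * (K + \<tau>) ^ 4)"
    by (simp add: N_def power_mult_distrib power3_eq_cube power4_eq_xxxx)
  ultimately have "\<tau> ^ 3 * ((1 - g) * (3 - 4 * t + g) * (\<tau> * (K + \<tau>) ^ 4)) = \<tau> ^ 3 * (4 * ((\<tau>\<^sup>2 + 2 * K * \<tau> - 1) * (\<tau> ^ 3 + 3 * \<tau> + 2 * K)))"
    by (simp add: algebra_simps)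
  then have "(1 - g) * (3 - 4 * t + g) * (\<tau> * (K + \<tau>) ^ 4) = 4 * ((\<tau>\<^sup>2 + 2 * K * \<tau> - 1) * (\<tau> ^ 3 + 3 * \<tau> + 2 * K))"
    using assms(1) by simp
  then show ?thesis by simp
qed

text \<open>\<open>1 - 2 * t + g\<close> is the inner product of the two legs seen from the apex, so
  the hypothesis says that the flat apex angle is not obtuse; base angles of an isosceles triangle
  are acute anyway. The difference factors into \<open>1 - t\<close> and
  \<open>1 - t * \<tau>\<^sup>2\<close>.\<close>

lemma acute_in_tan:
  fixes t g \<tau> K :: real
  assumes "0 < \<tau>" "0 \<le> K" and g: "g * (1 + \<tau>\<^sup>2) = t\<^sup>2 * (1 + \<tau>\<^sup>2) + (1 - t\<^sup>2) * (1 - \<tau>\<^sup>2)"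
    and t: "t * \<tau> * (K + \<tau>) = K * \<tau> - 1" "t < 1" and acute: "2 * t \<le> 1 + g"
  shows "K * \<tau>\<^sup>2 - 2 * \<tau> - K \<le> 0"
proof -
  have "0 \<le> (1 + g - 2 * t) * (1 + \<tau>\<^sup>2)" using acute by simp
  also have "\<dots> = 2 * ((1 - t) * (1 - t * \<tau>\<^sup>2))"
    using g by (simp add: power2_eq_square algebra_simps)
  finally have "0 \<le> (1 - t) * (1 - t * \<tau>\<^sup>2)" by linarith
  then have "0 \<le> 1 - t * \<tau>\<^sup>2" using t(2) by (simp add: zero_le_mult_iff)
  then have "0 \<le> (1 - t * \<tau>\<^sup>2) * (K + \<tau>)" using assms by simp
  also have "\<dots> = K + \<tau> - \<tau> * (t * \<tau> * (K + \<tau>))" by (simp add: power2_eq_square algebra_simps)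
  finally show ?thesis unfolding t(1) by (simp add: power2_eq_square algebra_simps)
qed

section \<open>Trigonometric constants of the regular pentagon\<close>

lemma sqrt5_bounds: "(2236067 / 1000000) < sqrt 5" "sqrt 5 < (2236068 / 1000000)"
  by (rule real_less_rsqrt, simp add: power2_eq_square) (rule real_less_lsqrt, simp_all add: power2_eq_square)

lemma cos_pi_div_5: "cos (pi / 5) = (1 + sqrt 5) / 4"
proof -
  define c s where "c = cos (pi / 5)" and "s = sin (pi / 5)"
  have c0: "c > 0" and s0: "s > 0" by (auto simp: c_def s_def intro!: cos_gt_zero sin_gt_zero)
  have cs: "s\<^sup>2 = 1 - c\<^sup>2" by (simp add: c_def s_def sin_squared_eq)
  \<comment> \<open>At \<pi>/5 the sines of the double and the triple angle agree; dividing by the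
    sine leaves a quadratic equation for the cosine.\<close>
  have "sin (2 * (pi / 5)) = sin (pi - 2 * (pi / 5))" by (simp only: sin_pi_minus)
  also have "pi - 2 * (pi / 5) = 2 * (pi / 5) + pi / 5" by simp
  finally have "2 * s * c = 2 * s * c * c + (1 - 2 * s\<^sup>2) * s"
    unfolding sin_add sin_double cos_double_sin by (simp add: c_def s_def)
  then have "s * (4 * c\<^sup>2 - 2 * c - 1) = 0"
    unfolding cs by (simp add: power2_eq_square algebra_simps)
  then have "4 * c\<^sup>2 - 2 * c - 1 = 0" using s0 by simp
  then have "(4 * c - 1)\<^sup>2 = (sqrt 5)\<^sup>2" by (simp add: power2_eq_square algebra_simps)
  then have "4 * c - 1 = sqrt 5 \<or> 4 * c - 1 = - sqrt 5" by (simp only: power2_eq_iff)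
  moreover have "4 * c - 1 \<noteq> - sqrt 5" using c0 sqrt5_bounds by linarith
  ultimately show ?thesis by (simp add: c_def)
qed

lemma cos_2pi_div_5: "cos (2 * pi / 5) = (sqrt 5 - 1) / 4"
proof -
  have "cos (2 * (pi / 5)) = 2 * ((1 + sqrt 5) / 4)\<^sup>2 - 1" unfolding cos_double_cos cos_pi_div_5 ..
  also have "\<dots> = (sqrt 5 - 1) / 4" by (simp add: power2_eq_square field_simps)
  finally show ?thesis by simp
qed

lemma sin_3pi_div_10: "sin (3 * pi / 10) = cos (pi / 5)" and cos_3pi_div_10: "cos (3 * pi / 10) = sin (pi / 5)"
proof -
  have "pi / 2 - 3 * pi / 10 = pi / 5" by simp
  then show "sin (3 * pi / 10) = cos (pi / 5)" "cos (3 * pi / 10) = sin (pi / 5)"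
    by (simp_all only: sin_cos_eq[of "3 * pi / 10"] cos_sin_eq[of "3 * pi / 10"] of_real_eq_id id_apply)
qed

text \<open>The value of \<open>K\<close> for seven vertices is the cotangent of half of 72 degrees,
  so \<open>K * \<tau> = 1\<close> will mean apex angle 72 degrees.\<close>

lemma tan_3pi_div_10: "tan (3 * pi / 10) * tan (pi / 5) = 1" "0 < tan (3 * pi / 10)"
  "(tan (3 * pi / 10))\<^sup>2 = 1 + 2 * sqrt 5 / 5"
proof -
  have pos: "cos (pi / 5) > 0" "sin (pi / 5) > 0" by (auto intro!: cos_gt_zero sin_gt_zero)
  then show "tan (3 * pi / 10) * tan (pi / 5) = 1" "0 < tan (3 * pi / 10)"
    by (simp_all add: tan_def sin_3pi_div_10 cos_3pi_div_10)
  have c: "(cos (pi / 5))\<^sup>2 = (3 + sqrt 5) / 8" unfolding cos_pi_div_5 by (simp add: power2_eq_square field_simps)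
  have s: "(sin (pi / 5))\<^sup>2 = (5 - sqrt 5) / 8" unfolding sin_squared_eq c by (simp add: field_simps)
  have "(tan (3 * pi / 10))\<^sup>2 = (cos (pi / 5))\<^sup>2 / (sin (pi / 5))\<^sup>2"
    by (simp add: tan_def sin_3pi_div_10 cos_3pi_div_10 power_divide)
  also have "\<dots> = 1 + 2 * sqrt 5 / 5"
    unfolding c s using sqrt5_bounds by (simp add: field_simps)
  finally show "(tan (3 * pi / 10))\<^sup>2 = 1 + 2 * sqrt 5 / 5" .
qed

text \<open>The four cases V = 4, 5, 6, 7 of the bound: \<open>A\<close> is the squared area of a facet as computed in
  \<open>area_in_tan\<close>, with \<open>K = tan 0, tan (\<pi>/6), tan (\<pi>/4), tan (3\<pi>/10)\<close>. Without acuteness the bound fails for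
  large \<open>\<tau>\<close>, where the triangle degenerates to half a lune.\<close>

lemma area_bound_4:
  fixes \<tau> A :: real
  assumes "0 < \<tau>" and A: "A * (\<tau> * (0 + \<tau>) ^ 4) = (\<tau>\<^sup>2 + 2 * 0 * \<tau> - 1) * (\<tau> ^ 3 + 3 * \<tau> + 2 * 0)"
  shows "A < 3"
proof -
  have "\<tau> * (A * \<tau> ^ 4) = \<tau> * ((\<tau>\<^sup>2 - 1) * (\<tau>\<^sup>2 + 3))"
    using A by (simp add: power2_eq_square power3_eq_cube power4_eq_xxxx algebra_simps)
  then have *: "A * \<tau> ^ 4 = (\<tau>\<^sup>2 - 1) * (\<tau>\<^sup>2 + 3)" using assms(1) by simp
  have "3 * \<tau> ^ 4 - (\<tau>\<^sup>2 - 1) * (\<tau>\<^sup>2 + 3) = (\<tau>\<^sup>2 - 1)\<^sup>2 + \<tau> ^ 4 + 2"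
    by (simp add: power2_eq_square power4_eq_xxxx algebra_simps)
  moreover have "(\<tau>\<^sup>2 - 1)\<^sup>2 + \<tau> ^ 4 + 2 > 0" by (simp add: add_nonneg_pos)
  ultimately have "A * \<tau> ^ 4 < 3 * \<tau> ^ 4" unfolding * by linarith
  then show ?thesis using assms(1) by simp
qed

lemma area_bound_5:
  fixes \<tau> K A :: real
  assumes "0 < \<tau>" "0 < K" and K: "K\<^sup>2 = 1 / 3"
    and A: "A * (\<tau> * (K + \<tau>) ^ 4) = (\<tau>\<^sup>2 + 2 * K * \<tau> - 1) * (\<tau> ^ 3 + 3 * \<tau> + 2 * K)"
  shows "A < 158 / 100"
proof -
  have "K ^ 3 = K * K\<^sup>2" "K ^ 4 = K\<^sup>2 * K\<^sup>2"
    by (simp_all add: power2_eq_square power3_eq_cube power4_eq_xxxx)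
  then have K3: "K ^ 3 = K / 3" "K ^ 4 = 1 / 9" unfolding K by simp_all
  have "K < 6 / 10" using K assms(2) by (intro power_less_imp_less_base[of K 2]) (auto simp: power2_eq_square)
  then have "0 \<le> (6 / 10 - K) * \<tau>\<^sup>2" by simp
  then have f1: "0 \<le> 6 / 10 * \<tau>\<^sup>2 - K * \<tau>\<^sup>2" by (simp add: left_diff_distrib)
  have "0 \<le> \<tau> * (5 * \<tau> - 6)\<^sup>2" using assms(1) by simp
  then have f2: "0 \<le> 25 * \<tau> ^ 3 - 60 * \<tau>\<^sup>2 + 36 * \<tau>" by (simp add: power2_eq_square power3_eq_cube algebra_simps)
  have "0 \<le> K * (20 * \<tau>\<^sup>2 - 3)\<^sup>2" using assms(2) by simp
  then have f3: "0 \<le> 400 * (K * \<tau> ^ 4) - 120 * (K * \<tau>\<^sup>2) + 9 * K" by (simp add: power2_eq_square power4_eq_xxxx algebra_simps)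
  have f4: "0 < \<tau> ^ 5" "0 < K * \<tau> ^ 4" "0 < K * \<tau>\<^sup>2" using assms by simp_all
  have "\<tau> * (K + \<tau>) ^ 4 = \<tau> ^ 5 + 4 * (K * \<tau> ^ 4) + 6 * K\<^sup>2 * \<tau> ^ 3 + 4 * K ^ 3 * \<tau>\<^sup>2 + K ^ 4 * \<tau>"
    by (simp add: power2_eq_square power3_eq_cube power4_eq_xxxx eval_nat_numeral algebra_simps)
  then have e1: "\<tau> * (K + \<tau>) ^ 4 = \<tau> ^ 5 + 4 * (K * \<tau> ^ 4) + 2 * \<tau> ^ 3 + 4 / 3 * (K * \<tau>\<^sup>2) + \<tau> / 9"
    unfolding K K3 by simp
  have "(\<tau>\<^sup>2 + 2 * K * \<tau> - 1) * (\<tau> ^ 3 + 3 * \<tau> + 2 * K)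
      = \<tau> ^ 5 + 2 * (K * \<tau> ^ 4) + 2 * \<tau> ^ 3 + 8 * (K * \<tau>\<^sup>2) + (4 * K\<^sup>2 - 3) * \<tau> - 2 * K"
    by (simp add: power2_eq_square power3_eq_cube power4_eq_xxxx eval_nat_numeral algebra_simps)
  then have e2: "A * (\<tau> * (K + \<tau>) ^ 4) = \<tau> ^ 5 + 2 * (K * \<tau> ^ 4) + 2 * \<tau> ^ 3 + 8 * (K * \<tau>\<^sup>2) - 5 / 3 * \<tau> - 2 * K"
    unfolding K A by simp
  have "A * (\<tau> * (K + \<tau>) ^ 4) < 158 / 100 * (\<tau> * (K + \<tau>) ^ 4)"
  proof -
    \<comment> \<open>With the monomials as independent variables the claim is linear; the squares
      above were selected to supply the missing relations between the monomials.\<close>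
    have "p5 + 2 * q4 + 2 * p3 + 8 * q2 - 5 / 3 * \<tau> - 2 * K < 158 / 100 * (p5 + 4 * q4 + 2 * p3 + 4 / 3 * q2 + \<tau> / 9)"
      if "0 \<le> 6 / 10 * p2 - q2" "0 \<le> 25 * p3 - 60 * p2 + 36 * \<tau>" "0 \<le> 400 * q4 - 120 * q2 + 9 * K"
        "0 < p5" "0 < q4" "0 < q2" for p2 p3 p5 q2 q4 :: real
      using that assms(1,2) by argo
    from this[OF f1 f2 f3 f4] show ?thesis unfolding e2 unfolding e1 .
  qed
  then show ?thesis using assms(1,2) by (simp add: mult_less_cancel_right_pos)
qed

lemma area_bound_6:
  fixes \<tau> A :: real
  assumes "0 < \<tau>" and acute: "1 * \<tau>\<^sup>2 - 2 * \<tau> - 1 \<le> 0"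
    and A: "A * (\<tau> * (1 + \<tau>) ^ 4) = (\<tau>\<^sup>2 + 2 * 1 * \<tau> - 1) * (\<tau> ^ 3 + 3 * \<tau> + 2 * 1)"
  shows "A < 893 / 1000"
proof -
  \<comment> \<open>Acuteness means \<open>\<tau> \<le> 1 + sqrt 2\<close>; a rational bound
    slightly above that is enough.\<close>
  have up: "\<tau> \<le> 5 / 2"
  proof (rule ccontr)
    assume "\<not> ?thesis"
    then have "5 / 2 * (1 / 2) < \<tau> * (\<tau> - 2)" by (intro mult_strict_mono) auto
    then show False using acute by (simp add: power2_eq_square algebra_simps)
  qed
  have "0 \<le> \<tau> ^ 4 * (5 - 2 * \<tau>)" using assms(1) up by simp
  then have f1: "0 \<le> 5 * \<tau> ^ 4 - 2 * \<tau> ^ 5" by (simp add: power4_eq_xxxx eval_nat_numeral algebra_simps)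
  have "0 \<le> \<tau> * (10 * \<tau> - 7)\<^sup>2" using assms(1) by simp
  then have f2: "0 \<le> 100 * \<tau> ^ 3 - 140 * \<tau>\<^sup>2 + 49 * \<tau>" by (simp add: power2_eq_square power3_eq_cube algebra_simps)
  have "0 \<le> (2 * \<tau>\<^sup>2 - 1)\<^sup>2" by simp
  then have f3: "0 \<le> 4 * \<tau> ^ 4 - 4 * \<tau>\<^sup>2 + 1" by (simp add: power2_eq_square power4_eq_xxxx algebra_simps)
  have "0 \<le> (20 * \<tau> - 11)\<^sup>2" by simp
  then have f4: "0 \<le> 400 * \<tau>\<^sup>2 - 440 * \<tau> + 121" by (simp add: power2_eq_square algebra_simps)
  have f5: "0 < \<tau> ^ 4" using assms(1) by simp
  have e1: "\<tau> * (1 + \<tau>) ^ 4 = \<tau> ^ 5 + 4 * \<tau> ^ 4 + 6 * \<tau> ^ 3 + 4 * \<tau>\<^sup>2 + \<tau>"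
    by (simp add: power2_eq_square power3_eq_cube power4_eq_xxxx eval_nat_numeral algebra_simps)
  have e2: "A * (\<tau> * (1 + \<tau>) ^ 4) = \<tau> ^ 5 + 2 * \<tau> ^ 4 + 2 * \<tau> ^ 3 + 8 * \<tau>\<^sup>2 + \<tau> - 2"
    unfolding A by (simp add: power2_eq_square power3_eq_cube power4_eq_xxxx eval_nat_numeral algebra_simps)
  have "A * (\<tau> * (1 + \<tau>) ^ 4) < 893 / 1000 * (\<tau> * (1 + \<tau>) ^ 4)"
  proof -
    have "p5 + 2 * p4 + 2 * p3 + 8 * p2 + \<tau> - 2 < 893 / 1000 * (p5 + 4 * p4 + 6 * p3 + 4 * p2 + \<tau>)"
      if "0 \<le> 5 * p4 - 2 * p5" "0 \<le> 100 * p3 - 140 * p2 + 49 * \<tau>" "0 \<le> 4 * p4 - 4 * p2 + 1"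
        "0 \<le> 400 * p2 - 440 * \<tau> + 121" "0 < p4" for p2 p3 p4 p5 :: real
      using that up by argo
    from this[OF f1 f2 f3 f4 f5] show ?thesis unfolding e2 unfolding e1 .
  qed
  then show ?thesis using assms(1) by (simp add: mult_less_cancel_right_pos)
qed

lemma area_bound_7:
  fixes \<tau> K A :: real
  assumes "0 < \<tau>" "0 < K" and K: "K\<^sup>2 = 1 + 2 * sqrt 5 / 5"
    and \<tau>: "K * \<tau> \<le> 1 \<or> K \<le> \<tau>" and acute: "K * \<tau>\<^sup>2 - 2 * \<tau> - K \<le> 0"
    and A: "A * (\<tau> * (K + \<tau>) ^ 4) = (\<tau>\<^sup>2 + 2 * K * \<tau> - 1) * (\<tau> ^ 3 + 3 * \<tau> + 2 * K)"
  shows "A \<le> (25 - 3 * sqrt 5) / 32 \<and> (A = (25 - 3 * sqrt 5) / 32 \<longrightarrow> K * \<tau> = 1)"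
proof -
  \<comment> \<open>In terms of \<open>\<sigma> = K * \<tau>\<close> only the square
    \<open>k\<close> of \<open>K\<close> remains, so all coefficients lie in the field generated by
    \<open>sqrt 5\<close>. The extremal value becomes \<open>\<sigma> = 1\<close> and the second
    range begins at \<open>\<sigma> = k\<close>. The constant \<open>c\<close> is the squared bound
    divided by 100, for ten facets.\<close>
  define r k c \<sigma> where "r = sqrt 5" and "k = K\<^sup>2" and "c = (25 - 3 * sqrt 5) / 32" and "\<sigma> = K * \<tau>"
  have r: "(2236067 / 1000000) < r" "r < (2236068 / 1000000)" "r * r = 5" using sqrt5_bounds by (simp_all add: r_def)
  have rr: "r * (r * x) = 5 * x" for x using r(3) by (simp add: mult.assoc[symmetric])
  have kr: "k = 1 + 2 * r / 5" by (simp add: k_def K r_def)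
  have cr: "c = (25 - 3 * r) / 32" by (simp add: c_def r_def)
  have \<sigma>0: "0 < \<sigma>" using assms by (simp add: \<sigma>_def)
  have A\<sigma>: "A * (\<sigma> * (k + \<sigma>) ^ 4) = (\<sigma>\<^sup>2 + 2 * k * \<sigma> - k) * (\<sigma> ^ 3 + 3 * k * \<sigma> + 2 * k\<^sup>2)"
  proof -
    have 1: "\<sigma> * (k + \<sigma>) ^ 4 = K ^ 5 * (\<tau> * (K + \<tau>) ^ 4)"
    proof -
      have "k + \<sigma> = K * (K + \<tau>)" by (simp add: k_def \<sigma>_def power2_eq_square algebra_simps)
      then show ?thesis by (simp add: \<sigma>_def power_mult_distrib eval_nat_numeral)
    qed
    have 2: "\<sigma>\<^sup>2 + 2 * k * \<sigma> - k = K\<^sup>2 * (\<tau>\<^sup>2 + 2 * K * \<tau> - 1)"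
      by (simp add: k_def \<sigma>_def power2_eq_square algebra_simps)
    have 3: "\<sigma> ^ 3 + 3 * k * \<sigma> + 2 * k\<^sup>2 = K ^ 3 * (\<tau> ^ 3 + 3 * \<tau> + 2 * K)"
      by (simp add: k_def \<sigma>_def power2_eq_square power3_eq_cube algebra_simps)
    have "A * (K ^ 5 * (\<tau> * (K + \<tau>) ^ 4)) = K ^ 5 * (A * (\<tau> * (K + \<tau>) ^ 4))" by simp
    also have "\<dots> = K\<^sup>2 * (\<tau>\<^sup>2 + 2 * K * \<tau> - 1) * (K ^ 3 * (\<tau> ^ 3 + 3 * \<tau> + 2 * K))"
      unfolding A by (simp add: eval_nat_numeral)
    finally show ?thesis unfolding 1 2 3 .
  qed
  have k2: "k\<^sup>2 = 9 / 5 + 4 / 5 * r"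
    using r(3) by (simp add: kr power2_eq_square algebra_simps)
  have k3: "k ^ 3 = k * k\<^sup>2" and k4: "k ^ 4 = k\<^sup>2 * k\<^sup>2" by (simp_all add: power2_eq_square power3_eq_cube power4_eq_xxxx)
  have "k ^ 3 = (1 + 2 * r / 5) * (9 / 5 + 4 / 5 * r)" unfolding k3 k2 by (simp only: kr)
  then have k3': "k ^ 3 = 17 / 5 + 38 / 25 * r" using r(3) by (simp add: algebra_simps)
  have k4': "k ^ 4 = 161 / 25 + 72 / 25 * r" unfolding k4 k2 using r(3) by (simp add: algebra_simps)
  have ck: "c * k = (19 + 7 * r) / 32" unfolding kr cr using r(3) rr by (simp add: field_simps)
  have ck2: "c * k\<^sup>2 = 33 / 32 + 73 / 160 * r" unfolding k2 cr using r(3) rr by (simp add: field_simps)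
  have ck3: "c * k ^ 3 = 311 / 160 + 139 / 160 * r" unfolding k3' cr using r(3) rr by (simp add: field_simps)
  have ck4: "c * k ^ 4 = 589 / 160 + 1317 / 800 * r" unfolding k4' cr using r(3) rr by (simp add: field_simps)
  \<comment> \<open>The difference to the bound has the root \<open>\<sigma> = 1\<close>;
    \<open>R\<close> is the quotient after dividing by \<open>1 - \<sigma>\<close>. It is positive
    up to 1 and negative on the second range, so the product is nonnegative on both.\<close>
  define R0 R1 R2 R3 R4 where "R0 = 34 / 5 + 76 / 25 * r" and "R1 = 73 / 32 + 161 / 160 * r"
    and "R2 = - (139 / 32 + 307 / 160 * r)" and "R3 = - (5 / 32 - 3 / 160 * r)" and "R4 = (7 + 3 * r) / 32"
  define R where "R = R0 + R1 * \<sigma> + R2 * \<sigma>\<^sup>2 + R3 * \<sigma> ^ 3 + R4 * \<sigma> ^ 4"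
  have "(c - A) * (\<sigma> * (k + \<sigma>) ^ 4) = c * (\<sigma> * (k + \<sigma>) ^ 4) - (\<sigma>\<^sup>2 + 2 * k * \<sigma> - k) * (\<sigma> ^ 3 + 3 * k * \<sigma> + 2 * k\<^sup>2)"
    unfolding A\<sigma>[symmetric] by (simp add: algebra_simps)
  also have "\<dots> = (c - 1) * \<sigma> ^ 5 + (4 * (c * k) - 2 * k) * \<sigma> ^ 4 + (6 * (c * k\<^sup>2) - 2 * k) * \<sigma> ^ 3
      + (4 * (c * k ^ 3) - 8 * k\<^sup>2) * \<sigma>\<^sup>2 + (c * k ^ 4 - 4 * k ^ 3 + 3 * k\<^sup>2) * \<sigma> + 2 * k ^ 3"
    by (simp add: power2_eq_square power3_eq_cube power4_eq_xxxx eval_nat_numeral algebra_simps)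
  also have "\<dots> = - R4 * \<sigma> ^ 5 + (R4 - R3) * \<sigma> ^ 4 + (R3 - R2) * \<sigma> ^ 3 + (R2 - R1) * \<sigma>\<^sup>2 + (R1 - R0) * \<sigma> + R0"
  proof -
    have "c - 1 = - R4" "4 * (c * k) - 2 * k = R4 - R3" "6 * (c * k\<^sup>2) - 2 * k = R3 - R2" "4 * (c * k ^ 3) - 8 * k\<^sup>2 = R2 - R1"
      "c * k ^ 4 - 4 * k ^ 3 + 3 * k\<^sup>2 = R1 - R0" "2 * k ^ 3 = R0"
      unfolding ck ck2 ck3 ck4 k3' k2 unfolding kr cr R0_def R1_def R2_def R3_def R4_def using r(3) by (simp_all add: field_simps)
    then show ?thesis by (simp only:)
  qed
  also have "\<dots> = (1 - \<sigma>) * R"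
    unfolding R_def by (simp add: power2_eq_square power3_eq_cube power4_eq_xxxx eval_nat_numeral algebra_simps)
  finally have main: "(c - A) * (\<sigma> * (k + \<sigma>) ^ 4) = (1 - \<sigma>) * R" .
  have k0: "(18944 / 10000) < k" using r by (simp add: kr)
  have pos: "0 < \<sigma> * (k + \<sigma>) ^ 4" using \<sigma>0 k0 by simp
  have coeff: "(13597 / 1000) < R0" "R0 < (13598 / 1000)" "(4531 / 1000) < R1" "R1 < (4532 / 1000)" "- (8635 / 1000) < R2" "R2 < - (8634 / 1000)"
    "- (12 / 100) < R3" "R3 < 0" "(4283 / 10000) < R4" "R4 < (4284 / 10000)"
    using r by (simp_all add: R0_def R1_def R2_def R3_def R4_def)
  from \<tau> have "\<sigma> \<le> 1 \<or> k \<le> \<sigma>"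
    using assms(2) by (auto simp: \<sigma>_def k_def power2_eq_square)
  then have "A \<le> c \<and> (A = c \<longrightarrow> \<sigma> = 1)"
  proof
    assume "\<sigma> \<le> 1"
    then have s: "\<sigma>\<^sup>2 \<le> 1" "\<sigma> ^ 3 \<le> 1" using \<sigma>0 by (simp_all add: power_le_one)
    have "R2 * 1 \<le> R2 * \<sigma>\<^sup>2" "R3 * 1 \<le> R3 * \<sigma> ^ 3"
      using s coeff by (intro mult_left_mono_neg; simp)+
    moreover have "0 \<le> R1 * \<sigma>" "0 \<le> R4 * \<sigma> ^ 4" using \<sigma>0 coeff by auto
    ultimately have "0 < R" unfolding R_def using coeff by linarith
    then have "0 \<le> (c - A) * (\<sigma> * (k + \<sigma>) ^ 4)" unfolding main using \<open>\<sigma> \<le> 1\<close> by simp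
    then have "A \<le> c" using pos by (simp add: zero_le_mult_iff)
    moreover have "\<sigma> = 1" if "A = c" using main that \<open>0 < R\<close> by simp
    ultimately show ?thesis by blast
  next
    assume "k \<le> \<sigma>"
    have "\<sigma>\<^sup>2 - 2 * \<sigma> - k = K * (K * \<tau>\<^sup>2 - 2 * \<tau> - K)"
      by (simp add: \<sigma>_def k_def power2_eq_square algebra_simps)
    also have "\<dots> \<le> 0" using acute assms(2) by (simp add: mult_le_0_iff)
    finally have q: "\<sigma> * (\<sigma> - 2) \<le> k" by (simp add: power2_eq_square algebra_simps)
    \<comment> \<open>The exact limit from acuteness is \<open>1 + sqrt (1 + k)\<close>, about
      2.7013.\<close>
    have up: "\<sigma> \<le> (271 / 100)"
    proof (rule ccontr)
      assume "\<not> ?thesis"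
      then have "(271 / 100) * (71 / 100) < \<sigma> * (\<sigma> - 2)" by (intro mult_strict_mono) auto
      then show False using q r by (simp add: kr)
    qed
    have lo: "(189 / 100) \<le> \<sigma>" using \<open>k \<le> \<sigma>\<close> k0 by simp
    \<comment> \<open>A chord lies above the parabola: on \<open>[1.89, 2.71]\<close> this replaces
      the square by a linear function, and squaring once more reduces the fourth power.\<close>
    have "0 \<le> (\<sigma> - (189 / 100)) * ((271 / 100) - \<sigma>)" using up lo by simp
    then have s2: "\<sigma>\<^sup>2 \<le> (46 / 10) * \<sigma> - (51219 / 10000)" by (simp add: power2_eq_square algebra_simps)
    have "\<sigma> ^ 4 = (\<sigma>\<^sup>2)\<^sup>2" by simp
    also have "\<dots> \<le> ((46 / 10) * \<sigma> - (51219 / 10000))\<^sup>2" using s2 by (intro power_mono) auto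
    also have "\<dots> = (2116 / 100) * \<sigma>\<^sup>2 - (4712148 / 100000) * \<sigma> + (2623385961 / 100000000)" by (simp add: power2_eq_square algebra_simps)
    finally have s4: "\<sigma> ^ 4 \<le> (2116 / 100) * \<sigma>\<^sup>2 - (4712148 / 100000) * \<sigma> + (2623385961 / 100000000)" .
    have "R \<le> (13598 / 1000) + (4532 / 1000) * \<sigma> - (8634 / 1000) * \<sigma>\<^sup>2 + (4284 / 10000) * \<sigma> ^ 4"
    proof -
      have "R1 * \<sigma> \<le> (4532 / 1000) * \<sigma>" "R2 * \<sigma>\<^sup>2 \<le> (- (8634 / 1000)) * \<sigma>\<^sup>2" "R3 * \<sigma> ^ 3 \<le> 0 * \<sigma> ^ 3" "R4 * \<sigma> ^ 4 \<le> (4284 / 10000) * \<sigma> ^ 4"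
        using coeff \<sigma>0 by (intro mult_right_mono; simp)+
      then show ?thesis unfolding R_def using coeff by linarith
    qed
    also have "\<dots> < 0" using s2 s4 lo up by linarith
    finally have "R < 0" .
    then have "0 < (c - A) * (\<sigma> * (k + \<sigma>) ^ 4)" unfolding main using lo by (simp add: zero_less_mult_iff)
    then have "A < c" using pos by (simp add: zero_less_mult_iff)
    then show ?thesis by simp
  qed
  then show ?thesis by (simp add: c_def \<sigma>_def)
qed

section \<open>Area bounds for inscribed triangulations with congruent isosceles facets\<close>

locale isosceles_triangulation = inscribed_triangulation +
  fixes t g :: real
  assumes isosceles: "T \<in> \<T> \<Longrightarrow> \<exists>x y z. T = {x, y, z} \<and> x \<bullet> y = t \<and> x \<bullet> z = t \<and> y \<bullet> z = g"
    and acute: "2 * t \<le> 1 + g"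
    and V_nonempty: "V \<noteq> {}"
begin

definition apex_angle :: real where
  "apex_angle = arccos ((g - t\<^sup>2) / (1 - t\<^sup>2))"

definition base_angle :: real where
  "base_angle = arccos (t * (1 - g) / (sqrt (1 - t\<^sup>2) * sqrt (1 - g\<^sup>2)))"

lemma isoscelesE:
  assumes "T \<in> \<T>"
  obtains x y z where "T = {x, y, z}" "x \<bullet> y = t" "x \<bullet> z = t" "y \<bullet> z = g"
    "x \<noteq> y" "x \<noteq> z" "y \<noteq> z" "norm x = 1" "norm y = 1" "norm z = 1"
proof -
  obtain x y z where *: "T = {x, y, z}" "x \<bullet> y = t" "x \<bullet> z = t" "y \<bullet> z = g"
    using isosceles[OF assms] by blast
  have "x \<noteq> y" "x \<noteq> z" "y \<noteq> z" using card_3[OF assms] unfolding *(1) by (auto simp: card_insert_if split: if_splits)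
  moreover have "norm x = 1" "norm y = 1" "norm z = 1" using subset_V[OF assms] norm_V unfolding *(1) by auto
  ultimately show ?thesis using that * by blast
qed

lemma gram_bounds: "t\<^sup>2 < 1" "g\<^sup>2 < 1" "0 < 1 + g - 2 * t\<^sup>2"
proof -
  obtain T where T: "T \<in> \<T>" using T_nonempty V_nonempty by blast
  obtain x y z where *: "T = {x, y, z}" "x \<bullet> y = t" "x \<bullet> z = t" "y \<bullet> z = g"
    "x \<noteq> y" "x \<noteq> z" "y \<noteq> z" "norm x = 1" "norm y = 1" "norm z = 1" using isoscelesE[OF T] by metis
  have u: "x \<bullet> x = 1" "y \<bullet> y = 1" "z \<bullet> z = 1" using * by (simp_all add: norm_eq_1)
  have ind: "b = 0 \<and> c = 0" if "a *\<^sub>R x + b *\<^sub>R y + c *\<^sub>R z = 0" for a b c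
    using triple_independent[of x y z a b c] T * that by simp
  have pos: "0 < (a *\<^sub>R x + b *\<^sub>R y + c *\<^sub>R z) \<bullet> (a *\<^sub>R x + b *\<^sub>R y + c *\<^sub>R z)" if "b \<noteq> 0 \<or> c \<noteq> 0" for a b c
    using ind[of a b c] that by auto
  have e: "(a *\<^sub>R x + b *\<^sub>R y + c *\<^sub>R z) \<bullet> (a *\<^sub>R x + b *\<^sub>R y + c *\<^sub>R z)
      = a\<^sup>2 + b\<^sup>2 + c\<^sup>2 + 2 * (a * b * t) + 2 * (a * c * t) + 2 * (b * c * g)" for a b c
    using u * by (simp add: inner_add_left inner_add_right inner_commute power2_eq_square algebra_simps)
  \<comment> \<open>The test vectors are \<open>y - t x\<close>, \<open>y - g z\<close> and
    \<open>y + z - 2 t x\<close>, the components of \<open>y\<close>, \<open>y\<close> and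
    \<open>y + z\<close> orthogonal to \<open>x\<close>, \<open>z\<close> and
    \<open>x\<close>.\<close>
  from pos[of 1 0 "- t"] show "t\<^sup>2 < 1" unfolding e by (simp add: power2_eq_square)
  from pos[of 1 "- g" 0] show "g\<^sup>2 < 1" unfolding e by (simp add: power2_eq_square)
  from pos[of 1 1 "- 2 * t"] show "0 < 1 + g - 2 * t\<^sup>2" unfolding e by (simp add: power2_eq_square algebra_simps)
qed

lemmas trig = gram_bounds apex_angle_def base_angle_def

lemma corner_isosceles:
  assumes "{x, y, z} \<in> \<T>" "x \<bullet> y = t" "x \<bullet> z = t" "y \<bullet> z = g"
  shows "corner x {x, y, z} = apex_angle" "corner y {x, y, z} = base_angle" "corner z {x, y, z} = base_angle"
proof -
  have ne: "x \<noteq> y" "x \<noteq> z" "y \<noteq> z" using card_3[OF assms(1)] by (auto simp: card_insert_if split: if_splits)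
  have nm: "norm x = 1" "norm y = 1" "norm z = 1" using subset_V[OF assms(1)] norm_V by auto
  have i: "y \<bullet> x = t" "z \<bullet> x = t" "z \<bullet> y = g" using assms by (simp_all add: inner_commute)
  have p: "{x, y, z} = {y, x, z}" "{x, y, z} = {z, x, y}" by auto
  show "corner x {x, y, z} = apex_angle"
    unfolding corner_triple[OF ne] sang_unit[OF nm] apex_angle_def assms i
    using gram_bounds(1) by (simp add: power2_eq_square[symmetric])
  show "corner y {x, y, z} = base_angle"
    unfolding p(1) corner_triple[OF ne(1)[symmetric] ne(3,2)] sang_unit[OF nm(2,1,3)] base_angle_def assms i
    by (simp add: algebra_simps)
  show "corner z {x, y, z} = base_angle"
    unfolding p(2) corner_triple[OF ne(2)[symmetric] ne(3)[symmetric] ne(1)] sang_unit[OF nm(3,1,2)] base_angle_def assms i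
    by (simp add: algebra_simps)
qed

text \<open>The corners are summed once by facets and once by vertices, where each vertex
  contributes a full turn.\<close>

lemma angle_sum: "card \<T> * (apex_angle + 2 * base_angle) = 2 * pi * card V"
proof -
  have T: "(\<Sum>v\<in>T. corner v T) = apex_angle + 2 * base_angle" if T: "T \<in> \<T>" for T
  proof -
    obtain x y z where *: "T = {x, y, z}" "x \<bullet> y = t" "x \<bullet> z = t" "y \<bullet> z = g"
      "x \<noteq> y" "x \<noteq> z" "y \<noteq> z" using isoscelesE[OF T] by metis
    show ?thesis using corner_isosceles[of x y z] * T by simp
  qed
  have "card \<T> * (apex_angle + 2 * base_angle) = (\<Sum>T\<in>\<T>. \<Sum>v\<in>T. corner v T)" using T by simp
  also have "\<dots> = (\<Sum>T\<in>\<T>. \<Sum>v | v \<in> V \<and> v \<in> T. corner v T)"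
    by (intro sum.cong refl) (use subset_V in auto)
  also have "\<dots> = (\<Sum>v\<in>V. \<Sum>T | T \<in> \<T> \<and> v \<in> T. corner v T)"
    by (rule sum.swap_restrict[OF finite_T finite_V])
  also have "\<dots> = (\<Sum>v\<in>V. 2 * pi)" by (intro sum.cong refl corner_sum)
  finally show ?thesis by simp
qed

text \<open>Half of base times median: \<open>1 - g\<close> is half the squared base and
  \<open>3 - 4 * t + g\<close> twice the squared median from the apex.\<close>

definition facet_area :: real where
  "facet_area = sqrt ((1 - g) * (3 - 4 * t + g)) / 2"

lemma facet_area_sq: "facet_area\<^sup>2 = (1 - g) * (3 - 4 * t + g) / 4"
proof -
  have "g < 1" "t < 1" using gram_bounds by (simp_all add: abs_square_less_1 abs_less_iff)
  then have "0 \<le> (1 - g) * (3 - 4 * t + g)" using acute by (intro mult_nonneg_nonneg) auto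
  then show ?thesis by (simp add: facet_area_def power_divide)
qed

lemma facet_area_nonneg: "0 \<le> facet_area"
proof -
  have "g < 1" "t < 1" using gram_bounds by (simp_all add: abs_square_less_1 abs_less_iff)
  then have "0 \<le> (1 - g) * (3 - 4 * t + g)" using acute by (intro mult_nonneg_nonneg) auto
  then show ?thesis by (simp add: facet_area_def)
qed

lemma area_equation:
  assumes "apex_angle + 2 * base_angle = 2 * (pi - \<delta>)" and "0 < cos \<delta>" "0 \<le> tan \<delta>"
  defines "\<tau> \<equiv> tan (apex_angle / 2)"
  shows "0 < \<tau>" "t * \<tau> * (tan \<delta> + \<tau>) = tan \<delta> * \<tau> - 1" "tan \<delta> * \<tau>\<^sup>2 - 2 * \<tau> - tan \<delta> \<le> 0"
    "facet_area\<^sup>2 * (\<tau> * (tan \<delta> + \<tau>) ^ 4) = (\<tau>\<^sup>2 + 2 * tan \<delta> * \<tau> - 1) * (\<tau> ^ 3 + 3 * \<tau> + 2 * tan \<delta>)"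
proof -
  have "t < 1" using gram_bounds by (simp add: abs_square_less_1 abs_less_iff)
  show pos: "0 < \<tau>" unfolding \<tau>_def by (rule tan_half_apex_pos[OF trig])
  show rel: "t * \<tau> * (tan \<delta> + \<tau>) = tan \<delta> * \<tau> - 1" unfolding \<tau>_def by (rule tan_relation[OF trig assms(1,2)])
  have g: "g * (1 + \<tau>\<^sup>2) = t\<^sup>2 * (1 + \<tau>\<^sup>2) + (1 - t\<^sup>2) * (1 - \<tau>\<^sup>2)"
    unfolding \<tau>_def by (rule g_eq_tan[OF trig])
  show "tan \<delta> * \<tau>\<^sup>2 - 2 * \<tau> - tan \<delta> \<le> 0"
    by (rule acute_in_tan[OF pos assms(3) g rel \<open>t < 1\<close> acute])
  show "facet_area\<^sup>2 * (\<tau> * (tan \<delta> + \<tau>) ^ 4) = (\<tau>\<^sup>2 + 2 * tan \<delta> * \<tau> - 1) * (\<tau> ^ 3 + 3 * \<tau> + 2 * tan \<delta>)"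
    unfolding facet_area_sq by (rule area_in_tan[OF pos assms(3) g rel])
qed

text \<open>Degrees of at most 4 would allow only 28 of the 30 incidences between ten triangles and
  seven vertices.\<close>

lemma ex_large_degree:
  assumes "card V = 7"
  obtains v where "v \<in> V" "5 \<le> card {T \<in> \<T>. v \<in> T}"
proof (rule ccontr)
  assume neg: "\<not> thesis"
  have "card \<T> = 10" using card_facets[OF V_nonempty] assms by simp
  then have "30 = (\<Sum>T\<in>\<T>. card T)" using card_3 by simp
  also have "\<dots> = (\<Sum>T\<in>\<T>. card {v \<in> V. v \<in> T})"
    by (intro sum.cong refl arg_cong[of _ _ card]) (use subset_V in auto)
  also have "\<dots> = (\<Sum>v\<in>V. card {T \<in> \<T>. v \<in> T})"
    by (rule sum_multicount_gen) (use finite_V finite_T in auto)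
  also have "\<dots> \<le> (\<Sum>v\<in>V. 4)" by (rule sum_mono) (use neg that in force)
  finally show False using assms by simp
qed

lemma corner_cases: "T \<in> \<T> \<Longrightarrow> v \<in> T \<Longrightarrow> corner v T = apex_angle \<or> corner v T = base_angle"
proof -
  assume T: "T \<in> \<T>" and v: "v \<in> T"
  obtain x y z where *: "T = {x, y, z}" "x \<bullet> y = t" "x \<bullet> z = t" "y \<bullet> z = g" using isoscelesE[OF T] by metis
  have "v = x \<or> v = y \<or> v = z" using v *(1) by simp
  then show "corner v T = apex_angle \<or> corner v T = base_angle"
    using corner_isosceles[OF T[unfolded *(1)] *(2-4)] unfolding *(1) by blast
qed

lemma area_bound_7_vertices:
  assumes "card V = 7"
  shows "facet_area\<^sup>2 \<le> (25 - 3 * sqrt 5) / 32"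
    "facet_area\<^sup>2 = (25 - 3 * sqrt 5) / 32 \<Longrightarrow> t = 0 \<and> g = (sqrt 5 - 1) / 4 \<and>
      (\<exists>v\<in>V. \<forall>T\<in>\<T>. v \<in> T \<longrightarrow> (\<exists>y z. T = {v, y, z} \<and> v \<bullet> y = 0 \<and> v \<bullet> z = 0 \<and> y \<bullet> z = g))"
proof -
  define \<delta> where "\<delta> = 3 * pi / 10"
  define K where "K = tan \<delta>"
  define \<tau> where "\<tau> = tan (apex_angle / 2)"
  have F: "card \<T> = 10" using card_facets[OF V_nonempty] assms by simp
  then have sum: "apex_angle + 2 * base_angle = 2 * (pi - \<delta>)" using angle_sum assms by (simp add: \<delta>_def)
  have cd: "0 < cos \<delta>" by (auto simp: \<delta>_def intro!: cos_gt_zero)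
  have K: "0 < K" "K\<^sup>2 = 1 + 2 * sqrt 5 / 5" "K * tan (pi / 5) = 1" using tan_3pi_div_10 by (simp_all add: K_def \<delta>_def)
  note eq = area_equation[OF sum cd, folded K_def \<tau>_def, OF less_imp_le[OF K(1)]]
  have ar: "0 < apex_angle" "apex_angle < pi" using apex_range[OF trig] by auto
  obtain v where v: "v \<in> V" "5 \<le> card {T \<in> \<T>. v \<in> T}" using ex_large_degree[OF assms] by metis
  have fin: "finite {T \<in> \<T>. v \<in> T}" using finite_T by simp
  have "\<exists>T\<in>\<T>. v \<in> T \<and> corner v T \<le> 2 * pi / 5"
  proof (rule ccontr)
    assume neg: "\<not> ?thesis"
    have "2 * pi \<le> (\<Sum>T | T \<in> \<T> \<and> v \<in> T. 2 * pi / 5)" using v(2) by simp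
    also have "\<dots> < (\<Sum>T | T \<in> \<T> \<and> v \<in> T. corner v T)"
      by (rule sum_strict_mono) (use fin v neg star_nonempty[OF v(1)] in \<open>auto simp: not_le\<close>)
    finally show False using corner_sum[OF v(1)] by simp
  qed
  then have "apex_angle \<le> 2 * pi / 5 \<or> base_angle \<le> 2 * pi / 5" using corner_cases by metis
  \<comment> \<open>A base angle of at most 72 degrees forces half the apex angle to be at least
    \<pi> - \<delta> - 2\<pi>/5 = \<delta>, whose tangent is \<open>K\<close>.\<close>
  then have \<tau>: "K * \<tau> \<le> 1 \<or> K \<le> \<tau>"
  proof
    assume "apex_angle \<le> 2 * pi / 5"
    then have "\<tau> \<le> tan (pi / 5)" unfolding \<tau>_def using ar by (subst tan_mono_le_eq) auto
    then have "K * \<tau> \<le> K * tan (pi / 5)" using K(1) by simp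
    then show ?thesis using K(3) by simp
  next
    assume "base_angle \<le> 2 * pi / 5"
    then have "K \<le> \<tau>" unfolding K_def \<tau>_def \<delta>_def using sum ar by (subst tan_mono_le_eq) (auto simp: \<delta>_def)
    then show ?thesis ..
  qed
  note bound = area_bound_7[OF eq(1) K(1,2) \<tau> eq(3,4)]
  then show "facet_area\<^sup>2 \<le> (25 - 3 * sqrt 5) / 32" by blast
  assume "facet_area\<^sup>2 = (25 - 3 * sqrt 5) / 32"
  with bound have K\<tau>: "K * \<tau> = 1" by blast
  then have "t * \<tau> * (K + \<tau>) = 0" using eq(2) by simp
  then have t: "t = 0" using eq(1) K(1) by simp
  have "\<tau> = tan (pi / 5)" using K\<tau> K(1,3) by (metis mult_cancel_left less_irrefl)
  then have "apex_angle / 2 = pi / 5" unfolding \<tau>_def using ar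
    using tan_mono_le_eq[of "apex_angle / 2" "pi / 5"] tan_mono_le_eq[of "pi / 5" "apex_angle / 2"] by simp
  then have ap: "apex_angle = 2 * pi / 5" by simp
  then have ba: "base_angle = pi / 2" using sum by (simp add: \<delta>_def)
  have g: "g = (sqrt 5 - 1) / 4"
    using g_eq_apex[OF trig] unfolding ap by (simp add: cos_2pi_div_5 t)
  \<comment> \<open>At equality the angles are 72 and 90 degrees; at least five of them fill a full
    turn at \<open>v\<close>, so none can be 90 degrees and \<open>v\<close> is the apex of all its
    facets.\<close>
  have all: "corner v T = apex_angle" if "T \<in> \<T>" "v \<in> T" for T
  proof (rule ccontr)
    assume ne: "corner v T \<noteq> apex_angle"
    then have "corner v T = pi / 2" using corner_cases[OF that] ba by simp
    then have lt: "2 * pi / 5 < corner v T" using pi_gt_zero by linarith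
    have "2 * pi \<le> (\<Sum>T | T \<in> \<T> \<and> v \<in> T. 2 * pi / 5)" using v(2) by simp
    also have "\<dots> < (\<Sum>T | T \<in> \<T> \<and> v \<in> T. corner v T)"
    proof (rule sum_strict_mono_ex1[OF fin])
      show "\<forall>T\<in>{T \<in> \<T>. v \<in> T}. 2 * pi / 5 \<le> corner v T"
      proof
        fix T assume "T \<in> {T \<in> \<T>. v \<in> T}"
        then have "corner v T = 2 * pi / 5 \<or> corner v T = pi / 2"
          using corner_cases[of T v] unfolding ap ba by simp
        then show "2 * pi / 5 \<le> corner v T" using pi_gt_zero by linarith
      qed
      show "\<exists>T\<in>{T \<in> \<T>. v \<in> T}. 2 * pi / 5 < corner v T" using lt that by blast
    qed
    finally show False using corner_sum[OF v(1)] by simp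
  qed
  have "\<exists>y z. T = {v, y, z} \<and> v \<bullet> y = 0 \<and> v \<bullet> z = 0 \<and> y \<bullet> z = g" if T: "T \<in> \<T>" "v \<in> T" for T
  proof -
    obtain x y z where *: "T = {x, y, z}" "x \<bullet> y = t" "x \<bullet> z = t" "y \<bullet> z = g" using isoscelesE[OF T(1)] by metis
    have "corner y T = base_angle" "corner z T = base_angle" using corner_isosceles[of x y z] T(1) * by auto
    moreover have "apex_angle \<noteq> base_angle" using ap ba pi_gt_zero by linarith
    ultimately have "v = x" using all[OF T] T(2) *(1) by auto
    then show ?thesis using * t by auto
  qed
  with t g v(1) show "t = 0 \<and> g = (sqrt 5 - 1) / 4 \<and>
      (\<exists>v\<in>V. \<forall>T\<in>\<T>. v \<in> T \<longrightarrow> (\<exists>y z. T = {v, y, z} \<and> v \<bullet> y = 0 \<and> v \<bullet> z = 0 \<and> y \<bullet> z = g))" by blast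
qed

lemma area_bound_few_vertices:
  assumes "card V < 7"
  shows "(card \<T> * facet_area)\<^sup>2 < 25 / 16 * (50 - 6 * sqrt 5)"
proof -
  \<comment> \<open>The right-hand side is 57.1618...; divided by the squared facet counts 16, 36
    and 64 it stays above the three constants 3, 158/100 and 893/1000 of the area bounds.\<close>
  have num: "57 < 25 / 16 * (50 - 6 * sqrt 5)" "57.16 < 25 / 16 * (50 - 6 * sqrt 5)" using sqrt5_bounds by simp_all
  obtain T where T: "T \<in> \<T>" using T_nonempty V_nonempty by blast
  have F: "card \<T> + 4 = 2 * card V" by (rule card_facets[OF V_nonempty])
  \<comment> \<open>Three vertices would require two facets, but carry only one triple.\<close>
  have "card V \<noteq> 3"
  proof
    assume 3: "card V = 3"
    have "T' = V" if "T' \<in> \<T>" for T' using card_subset_eq[OF finite_V subset_V[OF that]] card_3[OF that] 3 by simp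
    then have "\<T> \<subseteq> {V}" by auto
    then have "card \<T> \<le> 1" using card_mono[of "{V}" \<T>] by simp
    then show False using F 3 by simp
  qed
  moreover have "3 \<le> card V" using card_mono[OF finite_V subset_V[OF T]] card_3[OF T] by simp
  ultimately consider "card V = 4" | "card V = 5" | "card V = 6" using assms by linarith
  then show ?thesis
  proof cases
    case 1
    then have F4: "card \<T> = 4" using F by simp
    then have sum: "apex_angle + 2 * base_angle = 2 * (pi - 0)" using angle_sum 1 by simp
    have "facet_area\<^sup>2 < 3"
      by (rule area_bound_4[of "tan (apex_angle / 2)"]) (use area_equation[OF sum] in simp_all)
    then show ?thesis using num by (simp add: F4 power_mult_distrib)
  next
    case 2
    then have F6: "card \<T> = 6" using F by simp
    then have sum: "apex_angle + 2 * base_angle = 2 * (pi - pi / 6)" using angle_sum 2 by simp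
    have c: "0 < cos (pi / 6)" and k: "0 < tan (pi / 6)" by (simp_all add: cos_30 tan_30)
    have k2: "(tan (pi / 6))\<^sup>2 = 1 / 3" by (simp add: tan_30 power_divide)
    have "facet_area\<^sup>2 < 158 / 100"
      by (rule area_bound_5[OF _ k k2]) (use area_equation[OF sum c less_imp_le[OF k]] in auto)
    then show ?thesis using num by (simp add: F6 power_mult_distrib)
  next
    case 3
    then have F8: "card \<T> = 8" using F by simp
    then have sum: "apex_angle + 2 * base_angle = 2 * (pi - pi / 4)" using angle_sum 3 by simp
    have c: "0 < cos (pi / 4)" and k: "tan (pi / 4) = 1" by (simp_all add: cos_45 tan_45)
    have "0 \<le> tan (pi / 4)" by (simp add: k)
    note eq = area_equation[OF sum c this, unfolded k]
    have "facet_area\<^sup>2 < 893 / 1000"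
      by (rule area_bound_6[OF eq(1,3,4)])
    then show ?thesis using num by (simp add: F8 power_mult_distrib)
  qed
qed

end

section \<open>From polytopes to triangulations\<close>

definition vertices :: "(real^3) set \<Rightarrow> (real^3) set" where
  "vertices F = {v. v extreme_point_of F}"

lemma vertices_triangle:
  assumes "\<not> collinear {a, b, c}"
  shows "vertices (convex hull {a, b, c}) = {a, b, c}" "card {a, b, c} = 3" "\<not> affine_dependent {a, b, c}"
proof -
  have "a \<noteq> b" "a \<noteq> c" "b \<noteq> c" using assms by (auto simp: insert_commute)
  then show "card {a, b, c} = 3" by simp
  show i: "\<not> affine_dependent {a, b, c}" using assms collinear_3_eq_affine_dependent by blast
  show "vertices (convex hull {a, b, c}) = {a, b, c}"
    by (auto simp: vertices_def extreme_point_of_convex_hull_affine_independent[OF i])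
qed

section \<open>Gram matrix and circumcentre of a facet\<close>

lemma orthogonal_plane_parallel:
  fixes c n u w :: "real^3"
  assumes "\<not> collinear {0, u, w}" "n \<bullet> n = 1" "n \<bullet> u = 0" "n \<bullet> w = 0" "c \<bullet> u = 0" "c \<bullet> w = 0"
  shows "c = (c \<bullet> n) *\<^sub>R n"
proof -
  define r where "r = c - (c \<bullet> n) *\<^sub>R n"
  define m where "m = cross3 u w"
  have m0: "m \<noteq> 0" using assms(1) by (simp add: m_def cross_eq_0)
  have r: "r \<bullet> u = 0" "r \<bullet> w = 0" "r \<bullet> n = 0"
    using assms by (simp_all add: r_def inner_diff_left)
  have rm: "cross3 r m = 0" and nm: "cross3 n m = 0" using r assms by (simp_all add: m_def Lagrange)
  have "cross3 n (cross3 n m) = (n \<bullet> m) *\<^sub>R n - (n \<bullet> n) *\<^sub>R m" by (rule Lagrange)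
  then have "m = (n \<bullet> m) *\<^sub>R n" using nm assms(2) by simp
  then have "r \<bullet> m = 0" using r(3) by (metis inner_scaleR_right mult_zero_right)
  then have "r = 0" using rm m0 norm_and_cross_eq_0[of r m] by blast
  then show ?thesis by (simp add: r_def)
qed

context
  fixes x y z n :: "real^3" and t g h :: real
  assumes unit: "norm x = 1" "norm y = 1" "norm z = 1"
    and gram: "x \<bullet> y = t" "x \<bullet> z = t" "y \<bullet> z = g"
    and ncol: "\<not> collinear {x, y, z}"
    and n: "n \<bullet> n = 1" "n \<bullet> x = h" "n \<bullet> y = h" "n \<bullet> z = h"
begin

text \<open>The last quantity is half the squared length of \<open>2 x - y - z\<close>, twice the
  median vector at the apex, and is positive by non-collinearity.\<close>

lemma gram_denominator: "0 < 1 - t" "0 < 1 - g" "0 < 3 - 4 * t + g"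
proof -
  have u: "x \<bullet> x = 1" "y \<bullet> y = 1" "z \<bullet> z = 1" using unit by (simp_all add: norm_eq_1)
  have ne: "x \<noteq> y" "y \<noteq> z" using ncol by auto
  then have "0 < (x - y) \<bullet> (x - y)" "0 < (y - z) \<bullet> (y - z)" by simp_all
  then show "0 < 1 - t" "0 < 1 - g"
    using u gram by (simp_all add: inner_diff_left inner_diff_right inner_commute)
  have "2 *\<^sub>R x - y - z \<noteq> 0"
  proof
    assume "2 *\<^sub>R x - y - z = 0"
    then have "2 *\<^sub>R (x - y) = z - y" by (simp add: scaleR_2 algebra_simps)
    then have "x - y = (1 / 2) *\<^sub>R (z - y)" by (metis scaleR_scaleR scaleR_one nonzero_divide_eq_eq zero_neq_numeral)
    then have "collinear {0, z - y, x - y}" unfolding collinear_lemma by blast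
    then have "collinear {z, y, x}" by (subst collinear_3) simp_all
    then show False using ncol by (simp add: insert_commute)
  qed
  then have "0 < (2 *\<^sub>R x - y - z) \<bullet> (2 *\<^sub>R x - y - z)" by simp
  also have "\<dots> = 6 - 8 * t + 2 * g"
    using u gram by (simp add: inner_diff_left inner_diff_right inner_commute)
  finally show "0 < 3 - 4 * t + g" by simp
qed

text \<open>The foot of the perpendicular from the origin is the circumcentre of the triangle; its
  barycentric coordinates are determined by the Gram matrix.\<close>

lemma circumcentre:
  defines "q \<equiv> (1 - t) / (3 - 4 * t + g)"
  shows "(1 - 2 * q) *\<^sub>R x + q *\<^sub>R y + q *\<^sub>R z = h *\<^sub>R n" "h\<^sup>2 = 1 - 2 * q * (1 - t)"
proof -
  define c where "c = (1 - 2 * q) *\<^sub>R x + q *\<^sub>R y + q *\<^sub>R z"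
  define \<kappa> where "\<kappa> = 1 - 2 * q * (1 - t)"
  have u: "x \<bullet> x = 1" "y \<bullet> y = 1" "z \<bullet> z = 1" using unit by (simp_all add: norm_eq_1)
  have q: "q * (3 - 4 * t + g) = 1 - t" using gram_denominator by (simp add: q_def)
  \<comment> \<open>The value of \<open>q\<close> is the one for which the inner products of
    \<open>c\<close> with the apex and with the base vertices coincide.\<close>
  have cx: "c \<bullet> x = \<kappa>" and cy: "c \<bullet> y = \<kappa>" and cz: "c \<bullet> z = \<kappa>"
    using u gram q by (simp_all add: c_def \<kappa>_def inner_add_left inner_commute algebra_simps)
  have nc: "n \<bullet> c = h" using n by (simp add: c_def inner_add_right algebra_simps)
  have "\<not> collinear {0, y - x, z - x}"
  proof
    assume "collinear {0, y - x, z - x}"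
    then have "collinear {y, x, z}" by (subst collinear_3) simp_all
    then show False using ncol by (simp add: insert_commute)
  qed
  then have "c = (c \<bullet> n) *\<^sub>R n"
    using n cx cy cz by (intro orthogonal_plane_parallel[of "y - x" "z - x"]) (simp_all add: inner_diff_right)
  then have ch: "c = h *\<^sub>R n" using nc by (simp add: inner_commute)
  then show "(1 - 2 * q) *\<^sub>R x + q *\<^sub>R y + q *\<^sub>R z = h *\<^sub>R n" by (simp add: c_def)
  have "c \<bullet> c = \<kappa>" using cx cy cz by (subst (2) c_def) (simp add: inner_add_right algebra_simps)
  moreover have "c \<bullet> c = h\<^sup>2" using n(1) unfolding ch by (simp add: power2_eq_square)
  ultimately show "h\<^sup>2 = 1 - 2 * q * (1 - t)" by (simp add: \<kappa>_def)
qed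

lemma tri_area_gram: "tri_area x y z = sqrt ((1 - g) * (3 - 4 * t + g)) / 2"
proof -
  have u: "x \<bullet> x = 1" "y \<bullet> y = 1" "z \<bullet> z = 1" using unit by (simp_all add: norm_eq_1)
  have "(dist x y)\<^sup>2 = 2 - 2 * t" "(dist x z)\<^sup>2 = 2 - 2 * t" "(dist y z)\<^sup>2 = 2 - 2 * g"
    using u gram by (simp_all add: dist_norm power2_norm_eq_inner inner_diff_left inner_diff_right inner_commute)
  moreover have "(2 - 2 * t) * (2 - 2 * t) - ((2 - 2 * t + (2 - 2 * t) - (2 - 2 * g)) / 2)\<^sup>2 = (1 - g) * (3 - 4 * t + g)"
    by (simp add: power2_eq_square field_simps)
  ultimately show ?thesis unfolding tri_area_def by simp
qed

end

text \<open>On the unit sphere inner products are functions of distances, so transporting one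
  reference facet by the congruences gives all facets the same \<open>t\<close> and
  \<open>g\<close>.\<close>

lemma isosceles_polytope_facets:
  assumes P: "P \<in> isosceles_polytopes N"
  obtains t g where "\<And>F. F facet_of P \<Longrightarrow> \<exists>x y z. \<not> collinear {x, y, z} \<and> F = convex hull {x, y, z} \<and>
    norm x = 1 \<and> norm y = 1 \<and> norm z = 1 \<and> x \<bullet> y = t \<and> x \<bullet> z = t \<and> y \<bullet> z = g"
proof -
  have poly: "polytope P" and dim: "aff_dim P = 3" and sph: "{v. v extreme_point_of P} \<subseteq> sphere 0 1"
    and cong: "\<And>F G. F facet_of P \<Longrightarrow> G facet_of P \<Longrightarrow> congruent_sets F G"
    and iso: "(\<forall>F. F facet_of P \<longrightarrow> isosceles_triangle F) \<or> (\<forall>F. F facet_of P \<longrightarrow> equilateral_triangle F)"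
    using P by (auto simp: isosceles_polytopes_def inscribed_polytopes_def)
  have iso': "isosceles_triangle F" if "F facet_of P" for F
    using iso that unfolding isosceles_triangle_def equilateral_triangle_def by blast
  have unit: "norm v = 1" if "F facet_of P" "v \<in> vertices F" for F v
  proof -
    have "v extreme_point_of P"
      using that extreme_point_of_face[OF facet_of_imp_face_of[OF that(1)]] by (simp add: vertices_def)
    with sph have "v \<in> sphere 0 1" by blast
    then show ?thesis by simp
  qed
  obtain F0 where F0: "F0 facet_of P" using polytope_facet_exists[OF poly] dim by auto
  obtain a b c where abc: "\<not> collinear {a, b, c}" "F0 = convex hull {a, b, c}" "dist a b = dist a c"
    using iso'[OF F0] by (auto simp: isosceles_triangle_def)
  have ip: "x \<bullet> y = 1 - (dist x y)\<^sup>2 / 2" if "norm x = 1" "norm y = 1" for x y :: "real^3"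
    using that by (simp add: dist_norm power2_norm_eq_inner inner_diff_left inner_diff_right inner_commute norm_eq_1 field_simps)
  show ?thesis
  proof (rule that[of "1 - (dist a b)\<^sup>2 / 2" "1 - (dist b c)\<^sup>2 / 2"])
    fix F assume F: "F facet_of P"
    obtain f where f: "\<And>x y. dist (f x) (f y) = dist x y" "f ` F0 = F"
      using cong[OF F0 F] by (auto simp: congruent_sets_def)
    have F': "F = convex hull {f a, f b, f c}" using isometry_image_triangle[of f a b c] f abc(2) by simp
    obtain a' b' c' where abc': "\<not> collinear {a', b', c'}" "F = convex hull {a', b', c'}"
      using iso'[OF F] by (auto simp: isosceles_triangle_def)
    \<comment> \<open>Extreme points of a hull are among its generators; counting three on each side
      shows that the isometry carries vertices to vertices.\<close>
    have "{a', b', c'} \<subseteq> {f a, f b, f c}"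
      using vertices_triangle(1)[OF abc'(1)] abc'(2) F' extreme_point_of_convex_hull[of _ "{f a, f b, f c}"]
      by (auto simp: vertices_def)
    moreover have "card {f a, f b, f c} \<le> 3" by (simp add: card_insert_if)
    ultimately have eq: "{a', b', c'} = {f a, f b, f c}"
      using vertices_triangle(2)[OF abc'(1)] by (intro card_seteq) auto
    then have nc: "\<not> collinear {f a, f b, f c}" using abc'(1) by simp
    have "norm (f a) = 1" "norm (f b) = 1" "norm (f c) = 1"
      using unit[OF F] vertices_triangle(1)[OF nc] F' by auto
    then show "\<exists>x y z. \<not> collinear {x, y, z} \<and> F = convex hull {x, y, z} \<and>
      norm x = 1 \<and> norm y = 1 \<and> norm z = 1 \<and> x \<bullet> y = 1 - (dist a b)\<^sup>2 / 2 \<and> x \<bullet> z = 1 - (dist a b)\<^sup>2 / 2 \<and> y \<bullet> z = 1 - (dist b c)\<^sup>2 / 2"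
      using nc F' ip f(1) abc(3) by metis
  qed
qed

section \<open>Facets, edges and supporting planes of a three-dimensional polytope\<close>

lemma facet_unit_normal:
  fixes P :: "(real^3) set"
  assumes "polytope P" "F facet_of P"
  obtains n h where "n \<bullet> n = 1" "P \<subseteq> {x. n \<bullet> x \<le> h}" "F = P \<inter> {x. n \<bullet> x = h}"
proof -
  obtain a b where ab: "a \<noteq> 0" "P \<subseteq> {x. a \<bullet> x \<le> b}" "F = P \<inter> {x. a \<bullet> x = b}"
    using facet_of_polyhedron[OF polytope_imp_polyhedron[OF assms(1)] assms(2)] by metis
  have s: "(a /\<^sub>R norm a) \<bullet> x = a \<bullet> x / norm a" for x by (simp add: divide_inverse)
  show ?thesis
  proof (rule that[of "a /\<^sub>R norm a" "b / norm a"])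
    show "(a /\<^sub>R norm a) \<bullet> (a /\<^sub>R norm a) = 1" using ab(1) by (simp add: dot_square_norm power2_eq_square)
    show "P \<subseteq> {x. (a /\<^sub>R norm a) \<bullet> x \<le> b / norm a}" "F = P \<inter> {x. (a /\<^sub>R norm a) \<bullet> x = b / norm a}"
      unfolding s using ab by (auto simp: divide_right_mono)
  qed
qed

text \<open>A proper face is the intersection of the facets containing it. The edge misses
  \<open>z\<close>, so one of those facets misses \<open>z\<close> as well.\<close>

lemma neighbour_facet:
  fixes P :: "(real^3) set"
  assumes "polytope P" "aff_dim P = 3" "F facet_of P" "F = convex hull {x, y, z}" "\<not> collinear {x, y, z}"
  obtains G where "G facet_of P" "G \<noteq> F" "x \<in> G" "y \<in> G"
proof -
  let ?E = "convex hull {x, y}"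
  have "?E face_of F"
    using face_of_convex_hull_affine_independent[OF vertices_triangle(3)[OF assms(5)]] assms(4)
    by (metis insert_mono empty_subsetI)
  then have E: "?E face_of P" using facet_of_imp_face_of[OF assms(3)] face_of_trans by blast
  have "aff_dim ?E \<le> 1"
    using aff_dim_le_card[of "{x, y}"] by (simp add: aff_dim_convex_hull card_insert_if split: if_splits)
  then have "?E \<noteq> P" using assms(2) by auto
  moreover have "?E \<noteq> {}" by simp
  ultimately have eq: "?E = \<Inter>{G. G facet_of P \<and> ?E \<subseteq> G}"
    using face_of_polyhedron[OF polytope_imp_polyhedron[OF assms(1)] E] by blast
  have "z \<notin> ?E"
  proof
    assume "z \<in> ?E"
    then have "z \<in> affine hull {x, y}" using convex_hull_subset_affine_hull by blast
    moreover have "x \<noteq> y" using assms(5) by auto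
    ultimately show False using assms(5) collinear_3_affine_hull by blast
  qed
  then obtain G where G: "G facet_of P" "?E \<subseteq> G" "z \<notin> G" using eq by blast
  moreover have "z \<in> F" "x \<in> ?E" "y \<in> ?E" using assms(4) by (auto simp: hull_inc)
  ultimately show ?thesis using that[of G] by auto
qed

lemma convex_hull_vertices:
  assumes "polytope P" shows "convex hull (vertices P) = P"
  using Krein_Milman_Minkowski[of P] assms polytope_imp_compact polytope_imp_convex by (auto simp: vertices_def)

lemma vertices_facet:
  assumes "F facet_of P" shows "vertices F = vertices P \<inter> F"
  using extreme_point_of_face[OF facet_of_imp_face_of[OF assms]] by (auto simp: vertices_def)

text \<open>The segment from an interior point to an outside point crosses the boundary in some
  facet; but its functional is strictly below the offset at the start and not above it at the
  end.\<close>

lemma in_polytope_of_facets: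
  fixes P :: "(real^3) set"
  assumes P: "polytope P" "aff_dim P = 3"
    and n: "\<And>F. F facet_of P \<Longrightarrow> F = P \<inter> {x. n F \<bullet> x = h F}" "\<And>F. F facet_of P \<Longrightarrow> P \<subseteq> {x. n F \<bullet> x \<le> h F}"
    and x: "\<And>F. F facet_of P \<Longrightarrow> n F \<bullet> x \<le> h F"
  shows "x \<in> P"
proof (rule ccontr)
  assume "x \<notin> P"
  have ri: "rel_interior P = interior P" using P(2) by (intro interior_rel_interior) simp
  have "interior P \<noteq> {}"
    using P rel_interior_eq_empty[of P] polytope_imp_convex[OF P(1)] unfolding ri by auto
  then obtain y where y: "y \<in> interior P" by blast
  have bd: "P - interior P = \<Union>{F. F facet_of P}"
    using rel_boundary_of_polyhedron[OF polytope_imp_polyhedron[OF P(1)]] unfolding ri .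
  have "closed_segment y x \<inter> frontier P \<noteq> {}"
  proof (rule connected_Int_frontier)
    have "y \<in> closed_segment y x \<inter> P" "x \<in> closed_segment y x - P" using y \<open>x \<notin> P\<close> interior_subset by auto
    then show "closed_segment y x \<inter> P \<noteq> {}" "closed_segment y x - P \<noteq> {}" by blast+
  qed simp
  then obtain z where z: "z \<in> closed_segment y x" "z \<in> frontier P" by blast
  have "z \<in> P - interior P"
    using z(2) polytope_imp_closed[OF P(1)] by (simp add: frontier_def)
  then obtain F where F: "F facet_of P" "z \<in> F" and zP: "z \<in> P" using bd by blast
  obtain s where s: "0 \<le> s" "s \<le> 1" "z = (1 - s) *\<^sub>R y + s *\<^sub>R x" using z(1) by (auto simp: closed_segment_def)
  have "s \<noteq> 1" using zP \<open>x \<notin> P\<close> s(3) by auto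
  have "y \<in> P" "y \<notin> F" using y bd F(1) interior_subset by blast+
  then have "n F \<bullet> y < h F" using n[OF F(1)] by force
  then have "(1 - s) * (n F \<bullet> y) < (1 - s) * h F" using s \<open>s \<noteq> 1\<close> by simp
  moreover have "s * (n F \<bullet> x) \<le> s * h F" using x[OF F(1)] s(1) by (rule mult_left_mono)
  ultimately have "n F \<bullet> z < h F" unfolding s(3) by (simp add: inner_add_right algebra_simps)
  moreover have "n F \<bullet> z = h F" using F(2) n(1)[OF F(1)] by blast
  ultimately show False by simp
qed

text \<open>The common distance \<open>d\<close> of the facet planes rescales all unit normals to
  the normalisation of the locale. The statement about edges is for the equality case, where the
  solid is rebuilt from facet to facet.\<close>

lemma isosceles_polytope_triangulation:
  assumes P: "P \<in> isosceles_polytopes N"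
  defines "\<T> \<equiv> vertices ` {F. F facet_of P}"
  obtains n t g where "isosceles_triangulation (vertices P) \<T> n t g"
    "surface_area P = real (card \<T>) * (sqrt ((1 - g) * (3 - 4 * t + g)) / 2)"
    "\<And>T x y. T \<in> \<T> \<Longrightarrow> x \<in> T \<Longrightarrow> y \<in> T \<Longrightarrow> x \<noteq> y \<Longrightarrow> \<exists>T'\<in>\<T>. T' \<noteq> T \<and> x \<in> T' \<and> y \<in> T'"
proof -
  have poly: "polytope P" and dim: "aff_dim P = 3" and sph: "{v. v extreme_point_of P} \<subseteq> sphere 0 1"
    using P by (auto simp: isosceles_polytopes_def inscribed_polytopes_def)
  obtain t g where D: "\<And>F. F facet_of P \<Longrightarrow> \<exists>x y z. \<not> collinear {x, y, z} \<and> F = convex hull {x, y, z} \<and>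
    norm x = 1 \<and> norm y = 1 \<and> norm z = 1 \<and> x \<bullet> y = t \<and> x \<bullet> z = t \<and> y \<bullet> z = g"
    using isosceles_polytope_facets[OF P] by blast
  have "\<exists>n h. n \<bullet> n = 1 \<and> P \<subseteq> {x. n \<bullet> x \<le> h} \<and> F = P \<inter> {x. n \<bullet> x = h}" if F: "F facet_of P" for F
    using facet_unit_normal[OF poly F] by metis
  then obtain n h where N: "\<And>F. F facet_of P \<Longrightarrow> n F \<bullet> n F = 1"
      "\<And>F. F facet_of P \<Longrightarrow> P \<subseteq> {x. n F \<bullet> x \<le> h F}" "\<And>F. F facet_of P \<Longrightarrow> F = P \<inter> {x. n F \<bullet> x = h F}"
    by metis
  define q where "q = (1 - t) / (3 - 4 * t + g)"
  have card3: "card (vertices F) = 3" if "F facet_of P" for F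
    using D[OF that] vertices_triangle by metis
  have hullF: "convex hull (vertices F) = F" if "F facet_of P" for F
    using D[OF that] vertices_triangle by metis
  have eqI: "F = G" if F: "F facet_of P" and G: "G facet_of P" and sub: "vertices F \<subseteq> G" for F G
  proof -
    have "vertices F \<subseteq> vertices G" using sub vertices_facet[OF F] vertices_facet[OF G] by blast
    then have "vertices F = vertices G"
      using card3[OF F] card3[OF G] by (metis card_subset_eq card.infinite zero_neq_numeral)
    then show ?thesis using hullF[OF F] hullF[OF G] by metis
  qed
  \<comment> \<open>An elimination rule bundling everything known about a single facet, since it is
    applied to a facet, to its neighbour and to a reference facet.\<close>
  have data: thesis
    if F: "F facet_of P" and *: "\<And>x y z. vertices F = {x, y, z} \<Longrightarrow> F = convex hull {x, y, z} \<Longrightarrow> \<not> collinear {x, y, z} \<Longrightarrow>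
      x \<in> F \<Longrightarrow> y \<in> F \<Longrightarrow> z \<in> F \<Longrightarrow> x \<bullet> y = t \<Longrightarrow> x \<bullet> z = t \<Longrightarrow> y \<bullet> z = g \<Longrightarrow> n F \<bullet> x = h F \<Longrightarrow> n F \<bullet> y = h F \<Longrightarrow> n F \<bullet> z = h F \<Longrightarrow>
      (1 - 2 * q) *\<^sub>R x + q *\<^sub>R y + q *\<^sub>R z = h F *\<^sub>R n F \<Longrightarrow> (h F)\<^sup>2 = 1 - 2 * q * (1 - t) \<Longrightarrow> 0 < q \<Longrightarrow> 0 < 3 - 4 * t + g \<Longrightarrow>
      0 < 1 - t \<Longrightarrow> planar_area F = sqrt ((1 - g) * (3 - 4 * t + g)) / 2 \<Longrightarrow> thesis" for F thesis
  proof -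
    obtain x y z where xyz: "\<not> collinear {x, y, z}" "F = convex hull {x, y, z}"
      "norm x = 1" "norm y = 1" "norm z = 1" "x \<bullet> y = t" "x \<bullet> z = t" "y \<bullet> z = g"
      using D[OF F] by metis
    have inF: "x \<in> F" "y \<in> F" "z \<in> F" unfolding xyz(2) by (simp_all add: hull_inc)
    have nh: "n F \<bullet> x = h F" "n F \<bullet> y = h F" "n F \<bullet> z = h F" using inF N(3)[OF F] by blast+
    note gd = gram_denominator[OF xyz(3-8) xyz(1) N(1)[OF F] nh]
    note cc = circumcentre[OF xyz(3-8) xyz(1) N(1)[OF F] nh, folded q_def]
    show ?thesis
    proof (rule *[of x y z])
      show "vertices F = {x, y, z}" unfolding xyz(2) by (rule vertices_triangle(1)[OF xyz(1)])
      show "0 < q" using gd by (simp add: q_def)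
      show "planar_area F = sqrt ((1 - g) * (3 - 4 * t + g)) / 2"
        unfolding xyz(2) planar_area_triangle[OF xyz(1)]
        by (rule tri_area_gram[OF xyz(3-8) xyz(1) N(1)[OF F] nh])
    qed (use xyz inF nh cc gd in auto)
  qed
  have below: "n G \<bullet> z < h G"
    if "F facet_of P" "G facet_of P" "G \<noteq> F" "vertices F = {x, y, z}" "x \<in> G" "y \<in> G" for F G x y z
  proof -
    have "z \<in> F" using vertices_facet[OF that(1)] that(4) by blast
    then have zP: "z \<in> P" using facet_of_imp_subset[OF that(1)] by blast
    have "z \<notin> G" using eqI[OF that(1,2)] that by auto
    then have "n G \<bullet> z \<noteq> h G" using zP N(3)[OF that(2)] by blast
    moreover have "n G \<bullet> z \<le> h G" using zP N(2)[OF that(2)] by blast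
    ultimately show ?thesis by simp
  qed
  have on: "n G \<bullet> x = h G" if "G facet_of P" "x \<in> G" for G x using N(3)[OF that(1)] that(2) by blast
  \<comment> \<open>The coefficient \<open>q\<close> of a base vertex in the circumcentre is positive; so the circumcentre of \<open>F\<close> lies
    strictly below the plane of the neighbour across a leg, and vice versa.\<close>
  have hpos: "0 < h F" if F: "F facet_of P" for F
  proof (rule data[OF F])
    fix x y z assume vF: "vertices F = {x, y, z}" and hF: "F = convex hull {x, y, z}" and nc: "\<not> collinear {x, y, z}"
      and inF: "x \<in> F" "y \<in> F" and gram: "x \<bullet> y = t" and cF: "(1 - 2 * q) *\<^sub>R x + q *\<^sub>R y + q *\<^sub>R z = h F *\<^sub>R n F"
      and h2F: "(h F)\<^sup>2 = 1 - 2 * q * (1 - t)" and q: "0 < q" and den: "0 < 3 - 4 * t + g" "0 < 1 - t"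
    obtain G where G: "G facet_of P" "G \<noteq> F" "x \<in> G" "y \<in> G"
      using neighbour_facet[OF poly dim F hF nc] by metis
    have "n G \<bullet> (h F *\<^sub>R n F) = (1 - q) * h G + q * (n G \<bullet> z)"
      unfolding cF[symmetric] using on[OF G(1)] G(3,4) by (simp add: inner_add_right algebra_simps)
    also have "\<dots> < (1 - q) * h G + q * h G" using below[OF F G(1,2) vF G(3,4)] q by simp
    finally have 1: "h F * (n F \<bullet> n G) < h G" by (simp add: inner_commute algebra_simps)
    have 2: "h G * (n F \<bullet> n G) < h F" and h2G: "(h G)\<^sup>2 = 1 - 2 * q * (1 - t)"
    proof (atomize (full), rule data[OF G(1)])
      fix a b c assume vG: "vertices G = {a, b, c}" and inG: "a \<in> G" "b \<in> G" "c \<in> G" and gr: "a \<bullet> b = t" "a \<bullet> c = t" "b \<bullet> c = g"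
        and cG: "(1 - 2 * q) *\<^sub>R a + q *\<^sub>R b + q *\<^sub>R c = h G *\<^sub>R n G" and h2G: "(h G)\<^sup>2 = 1 - 2 * q * (1 - t)"
      have xy: "x \<in> {a, b, c}" "y \<in> {a, b, c}" "x \<noteq> y"
        using vF vG G vertices_facet[OF F] vertices_facet[OF G(1)] nc by auto
      have eq: "n F \<bullet> (h G *\<^sub>R n G) = (1 - 2 * q) * (n F \<bullet> a) + q * (n F \<bullet> b) + q * (n F \<bullet> c)"
        unfolding cG[symmetric] by (simp add: inner_add_right)
      consider "{x, y} = {a, b}" | "{x, y} = {a, c}" | "{x, y} = {b, c}" using xy by auto
      then have "n F \<bullet> (h G *\<^sub>R n G) < h F"
      proof cases
        case 1
        then have ab: "a \<in> F" "b \<in> F" using inF by (auto simp: doubleton_eq_iff)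
        then have "q * (n F \<bullet> c) < q * h F" using below[OF G(1) F G(2)[symmetric] vG] q by simp
        then show ?thesis unfolding eq using on[OF F] ab by (simp add: algebra_simps)
      next
        case 2
        then have ac: "a \<in> F" "c \<in> F" using inF by (auto simp: doubleton_eq_iff)
        have "vertices G = {a, c, b}" using vG by auto
        then have "q * (n F \<bullet> b) < q * h F" using below[OF G(1) F G(2)[symmetric] _ ac] q by simp
        then show ?thesis unfolding eq using on[OF F] ac by (simp add: algebra_simps)
      next
        case 3
        then have bc: "b \<in> F" "c \<in> F" using inF by (auto simp: doubleton_eq_iff)
        \<comment> \<open>A leg of \<open>F\<close> is here the base of \<open>G\<close>; so the
          facets are equilateral and all circumcentre coordinates are 1/3, which settles the sign of
          the apex coordinate.\<close>
        have "t = g" using 3 gram gr by (auto simp: doubleton_eq_iff inner_commute)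
        then have q3: "q = 1 / 3" using den by (simp add: q_def field_simps)
        have "vertices G = {b, c, a}" using vG by auto
        then have "n F \<bullet> a < h F" using below[OF G(1) F G(2)[symmetric] _ bc] by simp
        then show ?thesis unfolding eq using on[OF F] bc by (simp add: q3)
      qed
      then show "h G * (n F \<bullet> n G) < h F \<and> (h G)\<^sup>2 = 1 - 2 * q * (1 - t)" using h2G by simp
    qed
    have nu: "\<bar>n F \<bullet> n G\<bar> \<le> 1"
      using Cauchy_Schwarz_ineq2[of "n F" "n G"] N(1)[OF F] N(1)[OF G(1)] by (simp add: norm_eq_sqrt_inner)
    \<comment> \<open>Only the squares of the offsets agree. Equal signs give
      \<open>h F * (1 - \<nu>) > 0\<close> for the inner product \<open>\<nu>\<close> of the unit
      normals, hence \<open>h F > 0\<close>; opposite signs make the inequalities \<open>1\<close>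
      and \<open>2\<close> contradict each other.\<close>
    from h2F h2G have "(h G)\<^sup>2 = (h F)\<^sup>2" by simp
    then have "h G = h F \<or> h G = - h F" by (simp add: power2_eq_iff)
    then show "0 < h F"
    proof
      assume "h G = h F"
      then have "0 < h F * (1 - n F \<bullet> n G)" using 1 by (simp add: algebra_simps)
      then show ?thesis using nu by (auto simp: zero_less_mult_iff)
    next
      assume "h G = - h F"
      then show ?thesis using 1 2 by (simp add: algebra_simps)
    qed
  qed
  define d where "d = sqrt (1 - 2 * q * (1 - t))"
  have hd: "h F = d" if F: "F facet_of P" for F
    by (rule data[OF F]) (use hpos[OF F] in \<open>simp add: d_def real_sqrt_unique[symmetric]\<close>)
  obtain F0 where F0: "F0 facet_of P" using polytope_facet_exists[OF poly] dim by auto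
  have d: "0 < d" using hpos[OF F0] hd[OF F0] by simp
  define m where "m = (\<lambda>T. n (convex hull T) /\<^sub>R d)"
  have m: "m (vertices F) \<bullet> x = (n F \<bullet> x) / d" if "F facet_of P" for F x
    using hullF[OF that] by (simp add: m_def divide_inverse)
  \<comment> \<open>The circumcentre of \<open>F0\<close> has distance \<open>d\<close> from the
    origin and so cannot pass the plane of the neighbour across the base, which also has distance
    \<open>d\<close>. This forces the apex coordinate \<open>1 - 2 * q\<close> to be
    nonnegative.\<close>
  have acute: "2 * t \<le> 1 + g"
  proof (rule data[OF F0])
    fix x y z assume vF: "vertices F0 = {x, y, z}" and hF: "F0 = convex hull {x, y, z}" and nc: "\<not> collinear {x, y, z}"
      and cF: "(1 - 2 * q) *\<^sub>R x + q *\<^sub>R y + q *\<^sub>R z = h F0 *\<^sub>R n F0"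
      and q: "0 < q" and den: "0 < 3 - 4 * t + g" "0 < 1 - t"
    have perm: "F0 = convex hull {y, z, x}" "\<not> collinear {y, z, x}" "vertices F0 = {y, z, x}"
      using hF nc vF by (simp_all add: insert_commute)
    obtain G where G: "G facet_of P" "G \<noteq> F0" "y \<in> G" "z \<in> G"
      using neighbour_facet[OF poly dim F0 perm(1,2)] by metis
    have lt: "n G \<bullet> x < d" using below[OF F0 G(1,2) perm(3) G(3,4)] hd[OF G(1)] by simp
    have "n G \<bullet> n F0 \<le> 1"
      using norm_cauchy_schwarz[of "n G" "n F0"] N(1)[OF F0] N(1)[OF G(1)] by (simp add: norm_eq_sqrt_inner)
    then have "d * (n G \<bullet> n F0) \<le> d" using d by simp
    moreover have "n G \<bullet> (h F0 *\<^sub>R n F0) = (1 - 2 * q) * (n G \<bullet> x) + 2 * q * d"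
      unfolding cF[symmetric] using on[OF G(1)] G(3,4) hd[OF G(1)] by (simp add: inner_add_right)
    ultimately have "0 \<le> (1 - 2 * q) * (d - n G \<bullet> x)" using hd[OF F0] by (simp add: algebra_simps)
    then have "0 \<le> 1 - 2 * q" using lt by (simp add: zero_le_mult_iff)
    then have "2 * q * (3 - 4 * t + g) \<le> 3 - 4 * t + g" using den(1) by simp
    then show ?thesis using den by (simp add: q_def)
  qed
  have fin: "finite (vertices P)"
    unfolding vertices_def using finite_polyhedron_extreme_points[OF polytope_imp_polyhedron[OF poly]] .
  have tri: "isosceles_triangulation (vertices P) \<T> m t g"
  proof unfold_locales
    show "finite (vertices P)" by (rule fin)
    show "norm v = 1" if "v \<in> vertices P" for v using that sph by (auto simp: vertices_def)
    show "T \<subseteq> vertices P" if "T \<in> \<T>" for T using that vertices_facet by (auto simp: \<T>_def)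
    show "card T = 3" if "T \<in> \<T>" for T using that card3 by (auto simp: \<T>_def)
    show "m T \<bullet> v = 1" if "T \<in> \<T>" "v \<in> T" for T v
    proof -
      obtain F where F: "F facet_of P" "T = vertices F" using \<open>T \<in> \<T>\<close> by (auto simp: \<T>_def)
      then have "v \<in> F" using vertices_facet[OF F(1)] \<open>v \<in> T\<close> by blast
      then show ?thesis using m[OF F(1)] on[OF F(1)] hd[OF F(1)] d F(2) by simp
    qed
    show "m T \<bullet> v < 1" if "T \<in> \<T>" "v \<in> vertices P" "v \<notin> T" for T v
    proof -
      obtain F where F: "F facet_of P" "T = vertices F" using \<open>T \<in> \<T>\<close> by (auto simp: \<T>_def)
      have "v \<notin> F" using vertices_facet[OF F(1)] F(2) that by blast
      moreover have vP: "v \<in> P" using hull_subset[of "vertices P" convex] convex_hull_vertices[OF poly] that(2) by blast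
      ultimately have "n F \<bullet> v \<noteq> h F" using N(3)[OF F(1)] by blast
      moreover have "n F \<bullet> v \<le> h F" using N(2)[OF F(1)] vP by blast
      ultimately show ?thesis using m[OF F(1)] hd[OF F(1)] d F(2) by simp
    qed
    show "x \<in> convex hull (vertices P)" if x: "\<And>T. T \<in> \<T> \<Longrightarrow> m T \<bullet> x \<le> 1" for x
      unfolding convex_hull_vertices[OF poly]
    proof (rule in_polytope_of_facets[OF poly dim N(3) N(2)])
      fix F assume F: "F facet_of P"
      then have "m (vertices F) \<bullet> x \<le> 1" using x by (auto simp: \<T>_def)
      then show "n F \<bullet> x \<le> h F" using m[OF F] hd[OF F] d by (simp add: divide_simps)
    qed
    show "\<exists>x y z. T = {x, y, z} \<and> x \<bullet> y = t \<and> x \<bullet> z = t \<and> y \<bullet> z = g" if "T \<in> \<T>" for T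
    proof -
      obtain F where F: "F facet_of P" "T = vertices F" using \<open>T \<in> \<T>\<close> by (auto simp: \<T>_def)
      show ?thesis unfolding F(2) by (rule data[OF F(1)]) blast
    qed
    show "2 * t \<le> 1 + g" by (rule acute)
    show "vertices P \<noteq> {}" using convex_hull_vertices[OF poly] dim by auto
  qed
  have inj: "inj_on vertices {F. F facet_of P}" using hullF by (metis inj_on_inverseI mem_Collect_eq)
  have "surface_area P = (\<Sum>F | F facet_of P. sqrt ((1 - g) * (3 - 4 * t + g)) / 2)"
    unfolding surface_area_def by (intro sum.cong refl) (use data in blast)
  then have area: "surface_area P = real (card \<T>) * (sqrt ((1 - g) * (3 - 4 * t + g)) / 2)"
    by (simp add: \<T>_def card_image[OF inj])
  have edges: "\<exists>T'\<in>\<T>. T' \<noteq> T \<and> x \<in> T' \<and> y \<in> T'" if T: "T \<in> \<T>" and xy: "x \<in> T" "y \<in> T" "x \<noteq> y" for T x y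
  proof -
    obtain F where F: "F facet_of P" "T = vertices F" using T by (auto simp: \<T>_def)
    obtain a b c where abc: "\<not> collinear {a, b, c}" "F = convex hull {a, b, c}" using D[OF F(1)] by metis
    have "T = {a, b, c}" unfolding F(2) abc(2) by (rule vertices_triangle(1)[OF abc(1)])
    then obtain z where z: "{a, b, c} = {x, y, z}" using xy by auto
    obtain G where G: "G facet_of P" "G \<noteq> F" "x \<in> G" "y \<in> G"
      using neighbour_facet[OF poly dim F(1) abc(2)[unfolded z] abc(1)[unfolded z]] by metis
    have "vertices G \<noteq> T" using inj G F by (auto simp: inj_on_def)
    moreover have "x \<in> vertices G" "y \<in> vertices G"
      using vertices_facet[OF G(1)] vertices_facet[OF F(1)] xy F(2) G by auto
    ultimately show ?thesis using G(1) by (auto simp: \<T>_def)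
  qed
  show ?thesis using that[OF tri area edges] by blast
qed

section \<open>The extremal bipyramid\<close>

text \<open>In a plane, unit vectors with a prescribed inner product with \<open>z\<close> come in
  mirror pairs, whose sum is twice the projection onto \<open>z\<close>.\<close>

lemma plane_reflection:
  fixes e y z w :: "real^3"
  assumes "e \<bullet> e = 1" "y \<bullet> y = 1" "z \<bullet> z = 1" "w \<bullet> w = 1"
    and "y \<bullet> e = 0" "z \<bullet> e = 0" "w \<bullet> e = 0" and eq: "y \<bullet> z = w \<bullet> z" and "y \<noteq> w"
  shows "y + w = (2 * (y \<bullet> z)) *\<^sub>R z"
proof -
  define f where "f = cross3 e z"
  note fr = orthonormal_frame_3[OF assms(1,3,6), folded f_def]
  note dy = fr(4)[OF assms(5)] and dw = fr(4)[OF assms(7)]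
  have "y \<bullet> y = (y \<bullet> z)\<^sup>2 + (y \<bullet> f)\<^sup>2" "w \<bullet> w = (w \<bullet> z)\<^sup>2 + (w \<bullet> f)\<^sup>2"
    by (subst (2) dy, simp add: inner_add_right power2_eq_square, subst (2) dw, simp add: inner_add_right power2_eq_square)
  then have "(y \<bullet> f)\<^sup>2 = (w \<bullet> f)\<^sup>2" using assms(2,4) eq by simp
  then have "y \<bullet> f = w \<bullet> f \<or> y \<bullet> f = - (w \<bullet> f)" by (simp add: power2_eq_iff)
  moreover have "y \<bullet> f \<noteq> w \<bullet> f" using dy dw eq assms(9) by auto
  ultimately have s: "w \<bullet> f = - (y \<bullet> f)" by simp
  have "y + w = ((y \<bullet> z) *\<^sub>R z + (y \<bullet> f) *\<^sub>R f) + ((y \<bullet> z) *\<^sub>R z - (y \<bullet> f) *\<^sub>R f)"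
    by (subst dy, subst dw) (simp add: eq s)
  also have "\<dots> = (y \<bullet> z) *\<^sub>R z + (y \<bullet> z) *\<^sub>R z" by (simp only: add_diff_eq add.assoc[symmetric]) simp
  also have "\<dots> = (y \<bullet> z + y \<bullet> z) *\<^sub>R z" by (rule scaleR_left_distrib[symmetric])
  finally show ?thesis by (simp only: mult_2)
qed

text \<open>The half-space \<open>a \<bullet> x < 1\<close> contains all other points of the sphere
  but not \<open>a\<close>.\<close>

lemma vertices_convex_hull_sphere:
  assumes "finite S" "\<And>x. x \<in> S \<Longrightarrow> norm x = 1"
  shows "vertices (convex hull S) = S"
proof -
  have "a \<notin> convex hull (S - {a})" if a: "a \<in> S" for a
  proof -
    have aa: "a \<bullet> a = 1" using assms(2)[OF a] by (simp add: norm_eq_1)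
    have "S - {a} \<subseteq> {x. a \<bullet> x < 1}"
    proof
      fix x assume x: "x \<in> S - {a}"
      then have "x \<bullet> x = 1" using assms(2) by (simp add: norm_eq_1)
      moreover have "0 < (x - a) \<bullet> (x - a)" using x by simp
      ultimately show "x \<in> {x. a \<bullet> x < 1}" using aa by (simp add: inner_diff_left inner_diff_right inner_commute)
    qed
    then have "convex hull (S - {a}) \<subseteq> {x. a \<bullet> x < 1}" by (rule hull_minimal) (rule convex_halfspace_lt)
    then show ?thesis using aa by auto
  qed
  then show ?thesis
    using extreme_point_of_convex_hull_convex_independent[OF finite_imp_compact[OF assms(1)]] by (auto simp: vertices_def)
qed

section \<open>Equilateral pentagons on a great circle\<close>

lemma lessThan_5: "{..<5::nat} = {0, 1, 2, 3, 4}"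
  by (auto simp: less_Suc_eq numeral_eq_Suc)

text \<open>Each vertex reflects one neighbour to the other, giving a linear recurrence. The roots
  of the quadratic are the cosines of 72 and 144 degrees; sides and diagonals exchange them between
  the convex and the star order, so the quadratic covers both orders and all pairs.\<close>

lemma pentagon_products:
  fixes p :: "nat \<Rightarrow> real^3"
  assumes e: "e \<bullet> e = 1" and p: "\<And>i. i < 5 \<Longrightarrow> p i \<bullet> p i = 1 \<and> p i \<bullet> e = 0" and inj: "inj_on p {..<5}"
    and adj: "\<And>i. i < 5 \<Longrightarrow> p i \<bullet> p ((i + 1) mod 5) = \<gamma>" and ij: "i < 5" "j < 5" "i \<noteq> j"
  shows "4 * (p i \<bullet> p j)\<^sup>2 + 2 * (p i \<bullet> p j) = 1"
proof -
  have a: "p 0 \<bullet> p 1 = \<gamma>" "p 1 \<bullet> p 2 = \<gamma>" "p 2 \<bullet> p 3 = \<gamma>" "p 3 \<bullet> p 4 = \<gamma>" "p 4 \<bullet> p 0 = \<gamma>"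
    using adj[of 0] adj[of 1] adj[of 2] adj[of 3] adj[of 4] by (simp_all add: numeral_2_eq_2[symmetric])
  have a': "p 1 \<bullet> p 0 = \<gamma>" "p 2 \<bullet> p 1 = \<gamma>" "p 3 \<bullet> p 2 = \<gamma>" "p 4 \<bullet> p 3 = \<gamma>" "p 0 \<bullet> p 4 = \<gamma>"
    using a by (simp_all add: inner_commute)
  have u: "p 0 \<bullet> p 0 = 1" "p 1 \<bullet> p 1 = 1" "p 2 \<bullet> p 2 = 1" "p 3 \<bullet> p 3 = 1" "p 4 \<bullet> p 4 = 1"
    "p 0 \<bullet> e = 0" "p 1 \<bullet> e = 0" "p 2 \<bullet> e = 0" "p 3 \<bullet> e = 0" "p 4 \<bullet> e = 0" using p by simp_all
  have ne: "p 0 \<noteq> p 1" "p 0 \<noteq> p 2" "p 1 \<noteq> p 3" "p 2 \<noteq> p 4" "p 3 \<noteq> p 0" "p 4 \<noteq> p 1"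
    using inj by (auto simp: inj_on_def lessThan_5)
  have r: "p 2 = (2 * \<gamma>) *\<^sub>R p 1 - p 0" "p 3 = (2 * \<gamma>) *\<^sub>R p 2 - p 1" "p 4 = (2 * \<gamma>) *\<^sub>R p 3 - p 2"
    "p 0 = (2 * \<gamma>) *\<^sub>R p 4 - p 3" "p 1 = (2 * \<gamma>) *\<^sub>R p 0 - p 4"
    using plane_reflection[OF e u(1,2,3,6,7,8) _ ne(2)] plane_reflection[OF e u(2,3,4,7,8,9) _ ne(3)]
      plane_reflection[OF e u(3,4,5,8,9,10) _ ne(4)] plane_reflection[OF e u(4,5,1,9,10,6) _ ne(5)]
      plane_reflection[OF e u(5,1,2,10,6,7) _ ne(6)] a a' by (simp_all add: algebra_simps)
  have d2: "p 0 \<bullet> p 2 = 2 * \<gamma>\<^sup>2 - 1" "p 1 \<bullet> p 3 = 2 * \<gamma>\<^sup>2 - 1" "p 2 \<bullet> p 4 = 2 * \<gamma>\<^sup>2 - 1" "p 3 \<bullet> p 0 = 2 * \<gamma>\<^sup>2 - 1" "p 4 \<bullet> p 1 = 2 * \<gamma>\<^sup>2 - 1"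
    using arg_cong[OF r(1), of "\<lambda>z. p 0 \<bullet> z"] arg_cong[OF r(2), of "\<lambda>z. p 1 \<bullet> z"] arg_cong[OF r(3), of "\<lambda>z. p 2 \<bullet> z"]
      arg_cong[OF r(4), of "\<lambda>z. p 3 \<bullet> z"] arg_cong[OF r(5), of "\<lambda>z. p 4 \<bullet> z"] a u
    by (simp_all add: inner_diff_right power2_eq_square)
  \<comment> \<open>Here the product is computed from one end of the cycle, in \<open>d2\<close>
    from the other; comparing them closes the pentagon and gives a cubic with the spurious root
    1.\<close>
  have "p 0 \<bullet> p 3 = 2 * \<gamma> * (p 0 \<bullet> p 2) - p 0 \<bullet> p 1"
    using arg_cong[OF r(2), of "\<lambda>z. p 0 \<bullet> z"] by (simp add: inner_diff_right)
  then have "(\<gamma> - 1) * (4 * \<gamma>\<^sup>2 + 2 * \<gamma> - 1) = 0"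
    using a d2 by (simp add: inner_commute power2_eq_square algebra_simps)
  moreover have "\<gamma> \<noteq> 1"
  proof
    assume "\<gamma> = 1"
    then have "(p 0 - p 1) \<bullet> (p 0 - p 1) = 0" using a a' u by (simp add: inner_diff_left inner_diff_right)
    with ne(1) show False by simp
  qed
  ultimately have \<gamma>: "4 * \<gamma>\<^sup>2 + 2 * \<gamma> = 1" by simp
  then have w: "2 * \<gamma>\<^sup>2 - 1 = - \<gamma> - 1 / 2" by simp
  have \<gamma>': "4 * (- \<gamma> - 1 / 2)\<^sup>2 + 2 * (- \<gamma> - 1 / 2) = 1" using \<gamma> by (simp add: power2_eq_square algebra_simps)
  have "i \<in> {0, 1, 2, 3, 4}" "j \<in> {0, 1, 2, 3, 4}" using ij by auto
  then have "p i \<bullet> p j = \<gamma> \<or> p i \<bullet> p j = - \<gamma> - 1 / 2"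
    using ij(3) a a' d2[unfolded w] by (auto simp: inner_commute)
  then show ?thesis using \<gamma> \<gamma>' by auto
qed

text \<open>The recurrence is a rotation by the angle with cosine \<open>g\<close>, of order five by
  the quadratic. All products of distinct terms are \<open>g\<close> or \<open>- g - 1 / 2\<close>;
  the excluded values of \<open>g\<close> keep both different from 1.\<close>

lemma regular_pentagon_walk:
  fixes a b :: "real^3"
  assumes u: "a \<bullet> a = 1" "b \<bullet> b = 1" "a \<bullet> b = g" and g: "4 * g\<^sup>2 + 2 * g = 1" "g \<noteq> 1" "g \<noteq> - 3 / 2"
    and p: "p 0 = a" "p (Suc 0) = b" "\<And>k. p (Suc (Suc k)) = (2 * g) *\<^sub>R p (Suc k) - p k"
  shows "p 5 = p 0" "inj_on p {..<5}"
proof -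
  have g2: "g * g = (1 - 2 * g) / 4" using g(1) by (simp add: power2_eq_square)
  have g2': "g * (g * x) = (1 - 2 * g) / 4 * x" for x using g2 by (simp add: mult.assoc[symmetric])
  have p2: "p 2 = (2 * g) *\<^sub>R b - a" using p by (simp add: numeral_eq_Suc)
  have p3: "p 3 = (- 2 * g) *\<^sub>R b - (2 * g) *\<^sub>R a"
  proof -
    have "p 3 = (2 * g) *\<^sub>R p 2 - b" using p(2) p(3)[of 1] by (simp add: numeral_eq_Suc)
    also have "\<dots> = (4 * (g * g) - 1) *\<^sub>R b - (2 * g) *\<^sub>R a" unfolding p2 by (simp add: algebra_simps)
    also have "4 * (g * g) - 1 = - 2 * g" using g2 by simp
    finally show ?thesis .
  qed
  have p4: "p 4 = (2 * g) *\<^sub>R a - b"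
  proof -
    have "p 4 = (2 * g) *\<^sub>R p 3 - p 2" using p(3)[of 2] by (simp add: numeral_eq_Suc)
    also have "\<dots> = (- 4 * (g * g) - 2 * g) *\<^sub>R b + (1 - 4 * (g * g)) *\<^sub>R a" unfolding p2 p3 by (simp add: algebra_simps)
    also have "- 4 * (g * g) - 2 * g = - 1" using g2 by simp
    also have "1 - 4 * (g * g) = 2 * g" using g2 by simp
    finally show ?thesis by simp
  qed
  have "p 5 = (2 * g) *\<^sub>R p 4 - p 3" using p(3)[of 3] by (simp add: numeral_eq_Suc)
  also have "\<dots> = (4 * (g * g) + 2 * g) *\<^sub>R a" unfolding p3 p4 by (simp add: algebra_simps)
  also have "4 * (g * g) + 2 * g = 1" using g2 by simp
  also have "1 *\<^sub>R a = p 0" using p(1) by simp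
  finally show "p 5 = p 0" .
  have p': "p 0 = a" "p 1 = b" using p by simp_all
  have ba: "b \<bullet> a = g" using u by (simp add: inner_commute)
  have ip: "p 0 \<bullet> p 1 = g" "p 0 \<bullet> p 2 = - g - 1 / 2" "p 0 \<bullet> p 3 = - g - 1 / 2" "p 0 \<bullet> p 4 = g"
    "p 1 \<bullet> p 2 = g" "p 1 \<bullet> p 3 = - g - 1 / 2" "p 1 \<bullet> p 4 = - g - 1 / 2" "p 2 \<bullet> p 3 = g" "p 2 \<bullet> p 4 = - g - 1 / 2" "p 3 \<bullet> p 4 = g"
    unfolding p' p2 p3 p4 using u ba
    by (simp_all add: inner_diff_left inner_diff_right g2 g2' field_simps)
  have "p 0 \<bullet> p 0 = 1" "p 1 \<bullet> p 1 = 1" "p 2 \<bullet> p 2 = 1" "p 3 \<bullet> p 3 = 1" "p 4 \<bullet> p 4 = 1"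
    unfolding p' p2 p3 p4 using u ba
    by (simp_all add: inner_diff_left inner_diff_right g2 g2' field_simps)
  then have sq: "p i \<bullet> p i = 1" if "i \<in> {0, 1, 2, 3, 4}" for i using that by auto
  show "inj_on p {..<5}"
  proof (rule inj_onI, rule ccontr)
    fix i j assume "i \<in> {..<5}" "j \<in> {..<5}" and eq: "p i = p j" and ij: "i \<noteq> j"
    then have "i \<in> {0, 1, 2, 3, 4}" "j \<in> {0, 1, 2, 3, 4}" by (simp_all only: lessThan_5)
    then have "p i \<bullet> p j = g \<or> p i \<bullet> p j = - g - 1 / 2"
      using ij ip by (auto simp: inner_commute)
    moreover have "p i \<bullet> p j = 1" using sq[of i] eq \<open>i \<in> {0, 1, 2, 3, 4}\<close> by simp
    ultimately show False using g(2,3) by auto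
  qed
qed

text \<open>Legs have product 0, so a pair with nonzero product must be the base, and the third
  point the apex.\<close>

lemma isosceles_triple:
  fixes p q w x y z :: "real^3"
  assumes "{p, q, w} = {x, y, z}" "card {x, y, z} = 3" "p \<noteq> q" "p \<noteq> w" "q \<noteq> w"
    and "x \<bullet> y = 0" "x \<bullet> z = 0" "y \<bullet> z = g" "p \<bullet> q \<noteq> 0"
  shows "p \<bullet> w = 0 \<and> q \<bullet> w = 0 \<and> p \<bullet> q = g"
proof -
  have "p \<in> {x, y, z}" "q \<in> {x, y, z}" "w \<in> {x, y, z}" using assms(1) by auto
  then show ?thesis using assms(3-9) by (auto simp: inner_commute)
qed

context isosceles_triangulation
begin

text \<open>Across the edge from \<open>e\<close> to \<open>p (Suc k)\<close> the new vertex is the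
  mirror image of \<open>p k\<close>, so the facets at \<open>e\<close> follow the pentagon walk.
  The facet below one pentagon side supplies the opposite pole, and these seven points exhaust
  \<open>V\<close>.\<close>

lemma bipyramid_vertices:
  assumes t: "t = 0" and g: "g = (sqrt 5 - 1) / 4" and cardV: "card V = 7"
    and e: "e \<in> V" "\<And>T. T \<in> \<T> \<Longrightarrow> e \<in> T \<Longrightarrow> \<exists>y z. T = {e, y, z} \<and> e \<bullet> y = 0 \<and> e \<bullet> z = 0 \<and> y \<bullet> z = g"
    and edges: "\<And>T x y. T \<in> \<T> \<Longrightarrow> x \<in> T \<Longrightarrow> y \<in> T \<Longrightarrow> x \<noteq> y \<Longrightarrow> \<exists>T'\<in>\<T>. T' \<noteq> T \<and> x \<in> T' \<and> y \<in> T'"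
  obtains p where "inj_on p {..<5::nat}" "p 5 = p 0" "V = {e, - e} \<union> p ` {..<5}"
    "\<And>i. p i \<bullet> p i = 1 \<and> p i \<bullet> e = 0 \<and> p i \<bullet> p (Suc i) = g"
proof -
  have g0: "g \<noteq> 0" "g \<noteq> 1" "g \<noteq> - 3 / 2" and g4: "4 * g\<^sup>2 + 2 * g = 1"
    using sqrt5_bounds by (simp_all add: g power2_eq_square field_simps)
  have ee: "e \<bullet> e = 1" using norm_V[OF e(1)] by (simp add: norm_eq_1)
  obtain T0 where T0: "T0 \<in> \<T>" "e \<in> T0" by (rule star_nonempty[OF e(1)])
  obtain a b where ab: "T0 = {e, a, b}" using e(2)[OF T0] by blast
  \<comment> \<open>Pairs of consecutive terms turn the second-order recurrence into a primitive
    recursion.\<close>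
  define q where "q = rec_nat (a, b) (\<lambda>k x. (snd x, (2 * g) *\<^sub>R snd x - fst x))"
  define p where "p = (\<lambda>k. fst (q k))"
  have p: "p 0 = a" "p (Suc 0) = b" "\<And>k. p (Suc (Suc k)) = (2 * g) *\<^sub>R p (Suc k) - p k"
    by (simp_all add: p_def q_def)
  have gram: "y \<bullet> y = 1 \<and> z \<bullet> z = 1 \<and> y \<bullet> e = 0 \<and> z \<bullet> e = 0 \<and> y \<bullet> z = g \<and> e \<noteq> y \<and> e \<noteq> z \<and> y \<noteq> z"
    if T: "{e, y, z} \<in> \<T>" for y z
  proof -
    obtain y' z' where *: "{e, y, z} = {e, y', z'}" "e \<bullet> y' = 0" "e \<bullet> z' = 0" "y' \<bullet> z' = g" using e(2)[OF T] by auto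
    have ne: "e \<noteq> y" "e \<noteq> z" "y \<noteq> z" using card_3[OF T] by (auto simp: card_insert_if split: if_splits)
    have "e \<noteq> y'" "e \<noteq> z'" using *(2,3) ee by auto
    then have "{y, z} = {y', z'}" using *(1) ne by (simp add: insert_eq_iff)
    then have "e \<bullet> y = 0" "e \<bullet> z = 0" "y \<bullet> z = g" using *(2-4) by (auto simp: doubleton_eq_iff inner_commute)
    moreover have "norm y = 1" "norm z = 1" using subset_V[OF T] norm_V by auto
    ultimately show ?thesis using ne by (simp add: norm_eq_1 inner_commute)
  qed
  have walk: "{e, p k, p (Suc k)} \<in> \<T>" for k
  proof (induction k)
    case 0
    then show ?case using T0 ab p by simp
  next
    case (Suc k)
    note gk = gram[OF Suc]
    obtain T' where T': "T' \<in> \<T>" "T' \<noteq> {e, p k, p (Suc k)}" "e \<in> T'" "p (Suc k) \<in> T'"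
      using edges[OF Suc, of e "p (Suc k)"] gk by auto
    obtain y z where yz: "T' = {e, y, z}" using e(2)[OF T'(1,3)] by blast
    then obtain w where w: "T' = {e, p (Suc k), w}" using T'(4) gk by auto
    have Tw: "{e, p (Suc k), w} \<in> \<T>" using T'(1) w by simp
    note gw = gram[OF Tw]
    have "p k \<noteq> w" using T'(2) w by (auto simp: insert_commute)
    then have "p k + w = (2 * (p k \<bullet> p (Suc k))) *\<^sub>R p (Suc k)"
      using gk gw ee by (intro plane_reflection[of e]) (auto simp: inner_commute)
    then have "w = p (Suc (Suc k))" using gk unfolding p(3) by (simp add: algebra_simps)
    then show ?case using Tw by simp
  qed
  have gp: "p i \<bullet> p i = 1 \<and> p i \<bullet> e = 0 \<and> p i \<bullet> p (Suc i) = g" for i using gram[OF walk[of i]] by blast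
  have pV: "p i \<in> V" for i using subset_V[OF walk[of i]] by simp
  have "a \<bullet> a = 1" "b \<bullet> b = 1" "a \<bullet> b = g" using gp[of 0] gp[of "Suc 0"] p by simp_all
  from regular_pentagon_walk[OF this g4 g0(2,3) p] have p5: "p 5 = p 0" and inj: "inj_on p {..<5}" by auto
  have "- e \<in> V"
  proof -
    note g01 = gram[OF walk[of 0]]
    \<comment> \<open>This facet lies across the side from \<open>p 0\<close> to \<open>p 1\<close>.
      Its apex is orthogonal to both ends of that side, hence a multiple of \<open>e\<close>, and it
      is not \<open>e\<close> itself.\<close>
    obtain T' where T': "T' \<in> \<T>" "T' \<noteq> {e, p 0, p (Suc 0)}" "p 0 \<in> T'" "p (Suc 0) \<in> T'"
      using edges[OF walk[of 0], of "p 0" "p (Suc 0)"] g01 by auto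
    obtain u w' where T'w: "T' = {p 0, u, w'}" using tripleE[OF T'(1,3)] by metis
    then obtain w where w: "T' = {p 0, p (Suc 0), w}" using T'(4) g01 by auto
    have wne: "p 0 \<noteq> w" "p (Suc 0) \<noteq> w" using card_3[OF T'(1)] unfolding w by (auto simp: card_insert_if split: if_splits)
    obtain x y z where xyz: "T' = {x, y, z}" "x \<bullet> y = t" "x \<bullet> z = t" "y \<bullet> z = g" using isoscelesE[OF T'(1)] by metis
    have orth: "p 0 \<bullet> w = 0 \<and> p (Suc 0) \<bullet> w = 0 \<and> p 0 \<bullet> p (Suc 0) = g"
      by (rule isosceles_triple[of _ _ _ x y z]) (use xyz w wne g01 card_3[OF T'(1)] t g0 in auto)
    have wu: "w \<bullet> w = 1" and wV: "w \<in> V" using subset_V[OF T'(1)] norm_V w by (auto simp: norm_eq_1)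
    have "\<not> collinear {0, p 0, p (Suc 0)}"
    proof
      assume "collinear {0, p 0, p (Suc 0)}"
      moreover have "p 0 \<noteq> 0" "p (Suc 0) \<noteq> 0" using gp[of 0] gp[of "Suc 0"] by auto
      ultimately obtain k where k: "p (Suc 0) = k *\<^sub>R p 0" by (auto simp: collinear_lemma)
      then have "g = k" "k * k = 1" using g01 by (auto simp: inner_commute)
      then show False using gram_bounds(2) by (simp add: power2_eq_square)
    qed
    then have we: "w = (w \<bullet> e) *\<^sub>R e"
      using ee g01 orth by (intro orthogonal_plane_parallel) (auto simp: inner_commute)
    then have "(w \<bullet> e) * (w \<bullet> e) = 1" using wu ee by (metis inner_scaleR_left inner_commute)
    then have "w \<bullet> e = 1 \<or> w \<bullet> e = - 1" by (simp add: square_eq_1_iff)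
    moreover have "w \<noteq> e" using T'(2) w by (auto simp: insert_commute)
    ultimately have "w = - e" using we by auto
    then show ?thesis using wV by simp
  qed
  have "{e, - e} \<union> p ` {..<5} \<subseteq> V" using e(1) \<open>- e \<in> V\<close> pV by auto
  moreover have "card ({e, - e} \<union> p ` {..<5}) = 7"
  proof -
    have "e \<noteq> - e"
    proof
      assume "e = - e"
      from arg_cong[OF this, of "\<lambda>x. e \<bullet> x"] show False using ee by simp
    qed
    moreover have "e \<notin> p ` {..<5}" "- e \<notin> p ` {..<5}"
    proof -
      have "p i \<noteq> e \<and> p i \<noteq> - e" for i using gp[of i] ee by auto
      then show "e \<notin> p ` {..<5}" "- e \<notin> p ` {..<5}" by (metis imageE)+
    qed
    moreover have "card (p ` {..<5}) = 5" using inj by (simp add: card_image)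
    ultimately show ?thesis by (simp add: card_insert_if)
  qed
  ultimately have "V = {e, - e} \<union> p ` {..<5}" using finite_V cardV by (metis card_subset_eq)
  then show ?thesis using that[of p] inj p5 gp by blast
qed

end

section \<open>Comparison with the bipyramid over the equator\<close>

lemma mem_equator: "x \<in> equator \<longleftrightarrow> norm x = 1 \<and> x \<bullet> e3 = 0"
proof -
  have "x \<in> orthogonal_comp (span {e3}) \<longleftrightarrow> x \<bullet> e3 = 0"
    by (auto simp: orthogonal_comp_def span_singleton orthogonal_def inner_commute dest: bspec[where x = e3])
  then show ?thesis by (auto simp: equator_def)
qed

lemma e3_unit: "e3 \<bullet> e3 = 1"
  by (simp add: e3_def inner_axis)

lemma bound_value:
  defines "B \<equiv> 5 / 4 * sqrt (50 - 6 * sqrt 5)"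
  shows "0 \<le> B" "B\<^sup>2 = 25 / 16 * (50 - 6 * sqrt 5)" "7.560546 \<le> B" "B < 7.560547"
proof -
  have r: "0 \<le> 50 - 6 * sqrt 5" using sqrt5_bounds by simp
  show "0 \<le> B" using r by (simp add: B_def)
  show B2: "B\<^sup>2 = 25 / 16 * (50 - 6 * sqrt 5)" using r by (simp add: B_def power_mult_distrib power2_eq_square)
  \<comment> \<open>The lower bound in \<open>sqrt5_bounds\<close> is slightly too coarse for the
    sixth decimal of the upper estimate.\<close>
  have s: "2.2360679 < sqrt 5" "sqrt 5 < 2.2360680"
    by (rule real_less_rsqrt, simp add: power2_eq_square) (rule real_less_lsqrt, simp_all add: power2_eq_square)
  show "7.560546 \<le> B"
    by (rule power2_le_imp_le[OF _ \<open>0 \<le> B\<close>]) (unfold B2, use s in \<open>simp add: power2_eq_square\<close>)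
  show "B < 7.560547"
    by (rule power2_less_imp_less) (unfold B2, use s in \<open>simp_all add: power2_eq_square\<close>)
qed

lemma bipyramid_of_vertices:
  fixes p :: "nat \<Rightarrow> real^3"
  assumes e: "e \<bullet> e = 1" and p: "inj_on p {..<5}" "p 5 = p 0" "\<And>i. p i \<bullet> p i = 1 \<and> p i \<bullet> e = 0 \<and> p i \<bullet> p (Suc i) = g"
  obtains f where "orthogonal_transformation f"
    "equatorial_pentagonal_bipyramid (f ` (convex hull ({e, - e} \<union> p ` {..<5})))"
proof -
  have "norm e = norm e3" using e e3_unit by (simp add: norm_eq)
  then obtain f where f: "orthogonal_transformation f" "f e = e3"
    using orthogonal_transformation_exists by blast
  have lin: "linear f" and ip: "\<And>x y. f x \<bullet> f y = x \<bullet> y" using f(1) by (auto simp: orthogonal_transformation_def)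
  define V where "V = (f \<circ> p) ` {..<5}"
  have hull: "f ` (convex hull ({e, - e} \<union> p ` {..<5})) = convex hull ({e3, - e3} \<union> V)"
    by (simp add: convex_hull_linear_image[OF lin] image_Un linear_neg[OF lin] f(2) V_def image_comp)
  have eq: "V \<subseteq> equator"
  proof
    fix x assume "x \<in> V"
    then obtain i where x: "x = f (p i)" by (auto simp: V_def)
    have "x \<bullet> x = 1" "x \<bullet> e3 = 0" using p(3)[of i] by (simp_all add: x ip f(2)[symmetric])
    then show "x \<in> equator" by (simp add: mem_equator norm_eq_1)
  qed
  have "dist (p i) (p ((i + 1) mod 5)) = sqrt (2 - 2 * g)" if "i < 5" for i
  proof -
    have "p ((i + 1) mod 5) = p (Suc i)"
    proof (cases "i = 4")
      case True
      then show ?thesis using p(2) by simp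
    next
      case False
      then show ?thesis using that by simp
    qed
    then show ?thesis using p(3)[of i] p(3)[of "Suc i"]
      by (simp add: dist_norm norm_eq_sqrt_inner inner_diff_left inner_diff_right inner_commute)
  qed
  moreover have "dist (f x) (f y) = dist x y" for x y using f(1) orthogonal_transformation_isometry by blast
  ultimately have "\<forall>i<5. dist ((f \<circ> p) i) ((f \<circ> p) ((i + 1) mod 5)) = sqrt (2 - 2 * g)" by simp
  moreover have "inj_on (f \<circ> p) {..<5}"
    using p(1) orthogonal_transformation_inj[OF f(1)] by (auto simp: inj_on_def)
  ultimately have "equilateral_pentagon V" unfolding equilateral_pentagon_def V_def by blast
  then show ?thesis using that[OF f(1)] eq hull unfolding equatorial_pentagonal_bipyramid_def by blast
qed

text \<open>The pentagon may be listed in convex or in star order, so its pairwise products are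
  recorded only through their common quadratic.\<close>

lemma vertices_of_bipyramid:
  assumes f: "orthogonal_transformation f" and bip: "equatorial_pentagonal_bipyramid (f ` P)"
  obtains e W where "vertices P = {e, - e} \<union> W" "e \<bullet> e = 1" "card ({e, - e} \<union> W) = 7"
    "\<And>x. x \<in> W \<Longrightarrow> x \<bullet> e = 0"
    "\<And>x y. x \<in> W \<Longrightarrow> y \<in> W \<Longrightarrow> x \<noteq> y \<Longrightarrow> 4 * (x \<bullet> y)\<^sup>2 + 2 * (x \<bullet> y) = 1"
proof -
  obtain p l where V: "p ` {..<5} \<subseteq> equator" and inj: "inj_on p {..<5}"
    and l: "\<And>i. i < 5 \<Longrightarrow> dist (p i) (p ((i + 1) mod 5)) = l" and hull: "f ` P = convex hull ({e3, - e3} \<union> p ` {..<5::nat})"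
    using bip unfolding equatorial_pentagonal_bipyramid_def equilateral_pentagon_def by blast
  have lin: "linear f" and ip: "\<And>x y. f x \<bullet> f y = x \<bullet> y" using f by (auto simp: orthogonal_transformation_def)
  have injf: "inj f" and surjf: "surj f" using f by (simp_all add: orthogonal_transformation_inj orthogonal_transformation_surj)
  define e where "e = inv f e3"
  define q where "q = (\<lambda>i. inv f (p i))"
  have fe: "f e = e3" and fq: "\<And>i. f (q i) = p i" using surjf by (simp_all add: e_def q_def surj_f_inv_f)
  define W where "W = q ` {..<5}"
  have ee: "e \<bullet> e = 1" using ip[of e e] fe e3_unit by simp
  have q: "q i \<bullet> q i = 1 \<and> q i \<bullet> e = 0" if "i < 5" for i
  proof -
    have "p i \<in> equator" using V that by blast
    then show ?thesis using ip[of "q i" "q i"] ip[of "q i" e] fe fq by (simp add: mem_equator norm_eq_1)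
  qed
  have injq: "inj_on q {..<5}" using inj fq by (metis (mono_tags, lifting) inj_on_def)
  have adj: "q i \<bullet> q ((i + 1) mod 5) = 1 - l\<^sup>2 / 2" if "i < 5" for i
  proof -
    have "p i \<bullet> p i = 1" "p ((i + 1) mod 5) \<bullet> p ((i + 1) mod 5) = 1"
      using q[OF that] q[of "(i + 1) mod 5"] ip fq by (metis mod_less_divisor zero_less_numeral)+
    moreover have "l\<^sup>2 = (p i - p ((i + 1) mod 5)) \<bullet> (p i - p ((i + 1) mod 5))"
      using l[OF that] by (simp add: dist_norm power2_norm_eq_inner[symmetric])
    ultimately have "l\<^sup>2 = 2 - 2 * (p i \<bullet> p ((i + 1) mod 5))" by (simp add: inner_diff_left inner_diff_right inner_commute)
    then show ?thesis using ip[of "q i" "q ((i + 1) mod 5)"] fq by (simp add: field_simps)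
  qed
  have prod: "4 * (x \<bullet> y)\<^sup>2 + 2 * (x \<bullet> y) = 1" if "x \<in> W" "y \<in> W" "x \<noteq> y" for x y
    using that pentagon_products[OF ee q injq adj] by (auto simp: W_def)
  have "f ` (convex hull ({e, - e} \<union> W)) = f ` P"
    unfolding hull by (simp add: convex_hull_linear_image[OF lin] image_Un linear_neg[OF lin] fe W_def image_image fq)
  then have P: "P = convex hull ({e, - e} \<union> W)" using injf by (metis inj_image_eq_iff)
  have "vertices P = {e, - e} \<union> W"
    unfolding P by (rule vertices_convex_hull_sphere) (use q ee in \<open>auto simp: W_def norm_eq_1\<close>)
  moreover have "card ({e, - e} \<union> W) = 7"
  proof -
    have "e \<noteq> - e"
    proof
      assume "e = - e"
      from arg_cong[OF this, of "\<lambda>x. e \<bullet> x"] show False using ee by simp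
    qed
    moreover have "x \<bullet> e = 0" if "x \<in> W" for x using that q by (auto simp: W_def)
    then have "e \<notin> W" "- e \<notin> W" using ee by force+
    moreover have "card W = 5" "finite W" using injq by (simp_all add: W_def card_image)
    ultimately show ?thesis by (simp add: card_insert_if)
  qed
  ultimately show ?thesis using that[of e W] ee prod q by (auto simp: W_def)
qed

context isosceles_triangulation
begin

text \<open>A facet at \<open>e\<close> cannot contain \<open>- e\<close>, where its functional is
  -1. Its other two vertices are therefore orthogonal to \<open>e\<close> but, having a nonzero
  product, not to each other, and \<open>e\<close> must be the apex.\<close>

lemma bipyramid_gram:
  assumes V: "V = {e, - e} \<union> W" and e: "e \<bullet> e = 1" and W: "\<And>x. x \<in> W \<Longrightarrow> x \<bullet> e = 0"
    "\<And>x y. x \<in> W \<Longrightarrow> y \<in> W \<Longrightarrow> x \<noteq> y \<Longrightarrow> 4 * (x \<bullet> y)\<^sup>2 + 2 * (x \<bullet> y) = 1"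
  shows "t = 0" "4 * g\<^sup>2 + 2 * g = 1"
proof -
  have "e \<in> V" using V by simp
  then obtain T where T: "T \<in> \<T>" "e \<in> T" by (rule star_nonempty)
  have "- e \<notin> T" using normal_on[OF T] normal_on[OF T(1), of "- e"] by auto
  then have TW: "T - {e} \<subseteq> W" using subset_V[OF T(1)] V by auto
  obtain x y z where xyz: "T = {x, y, z}" "x \<bullet> y = t" "x \<bullet> z = t" "y \<bullet> z = g" "x \<noteq> y" "x \<noteq> z" "y \<noteq> z"
    using isoscelesE[OF T(1)] by metis
  have nz: "x \<bullet> y \<noteq> 0" if "x \<in> W" "y \<in> W" "x \<noteq> y" for x y using W(2)[OF that] by auto
  from T(2) xyz(1) consider "e = x" | "e = y" | "e = z" by auto
  then have "t = 0 \<and> 4 * g\<^sup>2 + 2 * g = 1"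
  proof cases
    case 1
    then have "y \<in> W" "z \<in> W" using TW xyz by auto
    then show ?thesis using W(1)[of y] W(2)[of y z] xyz 1 by (auto simp: inner_commute)
  next
    case 2
    then have "x \<in> W" "z \<in> W" using TW xyz by auto
    then show ?thesis using W(1)[of x] nz[of x z] xyz 2 by auto
  next
    case 3
    then have "x \<in> W" "y \<in> W" using TW xyz by auto
    then show ?thesis using W(1)[of x] nz[of x y] xyz 3 by auto
  qed
  then show "t = 0" "4 * g\<^sup>2 + 2 * g = 1" by auto
qed

end

theorem theorem1p1:
  fixes P :: "(real^3) set"
  assumes "P \<in> isosceles_polytopes 7"
  shows "surface_area P \<le> 5 / 4 * sqrt (50 - 6 * sqrt 5) \<and>
    7.560546 \<le> 5 / 4 * sqrt (50 - 6 * sqrt 5) \<and>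
    5 / 4 * sqrt (50 - 6 * sqrt 5) < 7.560547 \<and>
    (surface_area P = 5 / 4 * sqrt (50 - 6 * sqrt 5) \<longleftrightarrow>
      (\<exists>f. orthogonal_transformation f \<and> equatorial_pentagonal_bipyramid (f ` P)))"
proof -
  define B where "B = 5 / 4 * sqrt (50 - 6 * sqrt 5)"
  define V where "V = vertices P"
  define \<T> where "\<T> = vertices ` {F. F facet_of P}"
  note B = bound_value[folded B_def]
  have poly: "polytope P" and cardV: "card V \<le> 7"
    using assms by (auto simp: isosceles_polytopes_def inscribed_polytopes_def V_def vertices_def)
  obtain n t g where tri: "isosceles_triangulation V \<T> n t g"
    and area: "surface_area P = real (card \<T>) * (sqrt ((1 - g) * (3 - 4 * t + g)) / 2)"
    and edges: "\<And>T x y. T \<in> \<T> \<Longrightarrow> x \<in> T \<Longrightarrow> y \<in> T \<Longrightarrow> x \<noteq> y \<Longrightarrow> \<exists>T'\<in>\<T>. T' \<noteq> T \<and> x \<in> T' \<and> y \<in> T'"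
    using isosceles_polytope_triangulation[OF assms, folded V_def \<T>_def] by metis
  interpret isosceles_triangulation V \<T> n t g by (rule tri)
  have area': "surface_area P = real (card \<T>) * facet_area" unfolding facet_area_def by (rule area)
  have nonneg: "0 \<le> surface_area P" unfolding area' using facet_area_nonneg by simp
  have seven: "card V = 7 \<Longrightarrow> (surface_area P)\<^sup>2 = 100 * facet_area\<^sup>2"
    using card_facets[OF V_nonempty] by (simp add: area' power_mult_distrib)
  have few: "(surface_area P)\<^sup>2 < B\<^sup>2" if "card V \<noteq> 7"
    unfolding B(2) area' using area_bound_few_vertices that cardV by simp
  have "(surface_area P)\<^sup>2 \<le> B\<^sup>2"
  proof (cases "card V = 7")
    case True
    then show ?thesis using seven area_bound_7_vertices(1) unfolding B(2) by simp
  next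
    case False
    then show ?thesis using few by simp
  qed
  then have le: "surface_area P \<le> B" using B(1) by (rule power2_le_imp_le)
  have "\<exists>f. orthogonal_transformation f \<and> equatorial_pentagonal_bipyramid (f ` P)" if eq: "surface_area P = B"
  proof -
    have 7: "card V = 7" using few eq by auto
    have "facet_area\<^sup>2 = (25 - 3 * sqrt 5) / 32" using seven[OF 7] eq B(2) by simp
    from area_bound_7_vertices(2)[OF 7 this] obtain e where t: "t = 0" and g: "g = (sqrt 5 - 1) / 4" and e: "e \<in> V"
      "\<And>T. T \<in> \<T> \<Longrightarrow> e \<in> T \<Longrightarrow> \<exists>y z. T = {e, y, z} \<and> e \<bullet> y = 0 \<and> e \<bullet> z = 0 \<and> y \<bullet> z = g" by blast
    obtain p where p: "inj_on p {..<5::nat}" "p 5 = p 0" "V = {e, - e} \<union> p ` {..<5}"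
      "\<And>i. p i \<bullet> p i = 1 \<and> p i \<bullet> e = 0 \<and> p i \<bullet> p (Suc i) = g"
      using bipyramid_vertices[OF t g 7 e edges] by blast
    have ee: "e \<bullet> e = 1" using norm_V[OF e(1)] by (simp add: norm_eq_1)
    have "P = convex hull ({e, - e} \<union> p ` {..<5})" using convex_hull_vertices[OF poly] p(3) V_def by simp
    then show ?thesis using bipyramid_of_vertices[OF ee p(1,2,4)] by metis
  qed
  moreover have "surface_area P = B"
    if f: "orthogonal_transformation f" "equatorial_pentagonal_bipyramid (f ` P)" for f
  proof -
    obtain e W where eW: "V = {e, - e} \<union> W" "e \<bullet> e = 1" "card ({e, - e} \<union> W) = 7"
      "\<And>x. x \<in> W \<Longrightarrow> x \<bullet> e = 0" "\<And>x y. x \<in> W \<Longrightarrow> y \<in> W \<Longrightarrow> x \<noteq> y \<Longrightarrow> 4 * (x \<bullet> y)\<^sup>2 + 2 * (x \<bullet> y) = 1"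
      using vertices_of_bipyramid[OF f] unfolding V_def by blast
    note tg = bipyramid_gram[OF eW(1,2,4,5)]
    have 7: "card V = 7" using eW by simp
    have fa: "facet_area\<^sup>2 = (1 - g) * (3 + g) / 4" using facet_area_sq tg(1) by simp
    have "(4 * g + 1)\<^sup>2 = (sqrt 5)\<^sup>2" using tg(2) by (simp add: power2_eq_square algebra_simps)
    then have "4 * g + 1 = sqrt 5 \<or> 4 * g + 1 = - sqrt 5" by (simp only: power2_eq_iff)
    \<comment> \<open>The other root, the cosine of 144 degrees, is excluded by the area bound
      itself: it would give the squared facet area (25 + 3 sqrt 5)/32.\<close>
    moreover have "4 * g + 1 \<noteq> - sqrt 5"
    proof
      assume "4 * g + 1 = - sqrt 5"
      then have g: "g = (- sqrt 5 - 1) / 4" by simp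
      have "(1 - g) * (3 + g) / 4 = (25 + 3 * sqrt 5) / 32" unfolding g by (simp add: field_simps)
      then show False using area_bound_7_vertices(1)[OF 7] sqrt5_bounds unfolding fa by simp
    qed
    ultimately have g: "g = (sqrt 5 - 1) / 4" by simp
    have "(1 - g) * (3 + g) / 4 = (25 - 3 * sqrt 5) / 32" unfolding g by (simp add: field_simps)
    then have "facet_area\<^sup>2 = (25 - 3 * sqrt 5) / 32" unfolding fa .
    then have "(surface_area P)\<^sup>2 = B\<^sup>2" using seven[OF 7] B(2) by simp
    then show ?thesis using nonneg B(1) by (simp add: power2_eq_iff_nonneg)
  qed
  ultimately show ?thesis using le B(3,4) unfolding B_def by blast
qed

end
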